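(* Let $A,B\in\mathcal{MC}$, let $n>0$ be an integer, and let $P_A:=A\cap g_A^{-1}(1)$, $P_B:=B\cap g_B^{-1}(1)$ and $P_{B^\circ}:=B^*\cap (s_B^* )^{-1}(1)$. (1) Let $m_A,m_B,m_{B^\circ}$ be finite measures supported on $P_A,P_B,P_{B^\circ}$ respectively. These measures determine accurate approximation schemes for $A\otimes B$, $\mathrm{Sym}^n(A)$ and $\mathrm{Hom}_{\mathcal{AC}}(A,B)$ by SDR sets. (2) If $A$ and $B$ are polyhedral and $m_A,m_B,m_{B^\circ}$ are the counting measures on the vertices of $P_A,P_B,P_{B^\circ}$ respectively, then the approximation schemes converge after finitely many steps, yielding projected spectrahedral representations of the polyhedral cones $A\otimes B$, $\mathrm{Sym}^n(A)$ and $\mathrm{Hom}_{\mathcal{AC}}(A,B)$.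
   Context: Categories. All vector spaces are real and finite-dimensional. $\mathcal{AC}$ has as objects pairs $(C,LC)$ with $C\subseteq LC$ a closed, full-dimensional, pointed convex cone (pointed: some $\phi\in(LC)^*$, called a grading, is $\ge0$ on $C$ with $C\cap\ker\phi=\{0\}$); morphisms $\mathrm{Hom}_{\mathcal{AC}}(C_1,C_2)$ are linear maps $LC_1\to LC_2$ carrying $C_1$ into $C_2$, viewed as a cone in $\mathrm{Hom}(LC_1,LC_2)$. $\mathcal{MC}$ has as objects triples $(C,g_C,s_C)$ with $C\in\mathcal{AC}$, $g_C:C\to\mathbb{R}_+$ a morphism that is a grading, $s_C:\mathbb{R}_+\to C$ a section of $g_C$ with $s_C(1)\in\mathrm{int}(C)$. The dual is $(C^*,s_C^*,g_C^* )$, $C^*$ the dual cone. $A\otimes B:=\mathrm{Cone}\{a\otimes b\}\subseteq LA\otimes LB$, $\mathrm{Sym}^n(A):=\mathrm{Cone}\{a_1\cdots a_n\}\subseteq\mathrm{Sym}^n(LA)$. One has $\mathrm{Hom}_{\mathcal{AC}}(A,B)=(A\otimes B^* )^*$ via $\langle f,a\otimes\beta\rangle=\beta(f(a))$. Convex bodies. Let $E_A$ be the affine space $g_A^{-1}(1)\subseteq LA$ made into a vector space with origin $s_A(1)$ (similarly $E_B$, $E_{B^\circ}$ for $B^*$ with grading $s_B^*$ and section $g_B^*$), so $P_A\subseteq E_A$ is a convex body with $0$ in its interior, and $P_{B^\circ}$ is the polar of $P_B$. The polar of $S\subseteq E$ is $S^\circ=\{\lambda\in E^*:\lambda(x)\ge-1\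 \forall x\in S\}$. The base (the slice where the grading equals $1$) of $A\otimes B$ is $P_A\otimes P_B=\mathrm{Conv}\{(a,b,a\otimes b)\}\subseteq E_A\times E_B\times(E_A\otimes E_B)$; that of $\mathrm{Sym}^n(A)$ is $\mathrm{Sym}^n(P_A)=\mathrm{Conv}\{(e_1(p),\dots,e_n(p)):p\in P_A^n\}\subseteq\prod_{j=1}^n\mathrm{Sym}^j(E_A)$ with $e_j$ the elementary symmetric polynomials; that of $\mathrm{Hom}_{\mathcal{AC}}(A,B)$ (grading $f\mapsto g_B(f(s_A(1)))$) is $(P_A\otimes P_{B^\circ})^\circ$. Spectrahedra. A spectrahedron in $E\cong\mathbb{R}^N$ is a set $\{x:M_0+\sum x_iM_i\succeq0\}$ with $M_i$ symmetric matrices; an SDR set is a linear projection of a spectrahedron, i.e. $\{x:\exists y\in\mathbb{R}^k,\ M_0+\sum x_iM_i+\sum y_jN_j\succeq0\}$. Approximation scheme. "A finite measure supported on $S$" means that every open neighborhood of every point of $S$ has positive measure (and the measure lives on $S$). Given a compact $S\subseteq\mathbb{R}^N$, a finite measure $\mu$ supported on $S$, and a polynomial map $T:\mathbb{R}^N\to\mathbb{R}^r$ with components $T_i$, set $Q_k:=\{\lambda\in\mathbb{R}^r:\int_S(1+\sum_i\lambda_iT_i(x))a(x)^2\,d\mu(x)\ge0\text{ for all polynomials }a\text{ of degree}\le k\}$. These are spectrahedra with $Q_{k+1}\subseteq Q_k$, and the polars $Q_k^\circ$ are SDR sets. - The scheme for $A\otimes B$: $S=P_A\times P_B$, $\mu=m_A\times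 m_B$, $T(a,b)=(a,b,a\otimes b)$. Accurate means $P_A\otimes P_B=\overline{\bigcup_kQ_k^\circ}$ (and $A\otimes B$ is approximated by the corresponding cones). - The scheme for $\mathrm{Sym}^n(A)$: $S=P_A^n$, $\mu=m_A^n$, $T=(e_1,\dots,e_n)$. Accurate means $\mathrm{Sym}^n(P_A)=\overline{\bigcup_kQ_k^\circ}$. - The scheme for $\mathrm{Hom}_{\mathcal{AC}}(A,B)$: dual to that for $A\otimes B^*$, i.e. $S=P_A\times P_{B^\circ}$, $\mu=m_A\times m_{B^\circ}$, $T(a,\beta)=(a,\beta,a\otimes\beta)$, approximating by the spectrahedra $Q_k$. Accurate means $(P_A\otimes P_{B^\circ})^\circ=\bigcap_kQ_k$. In part (2) the sets $P_A,P_B,P_{B^\circ}$ in the definition of $S$ are replaced by their finite vertex sets, and convergence after finitely many steps means that for some $k$ the set $Q_k^\circ$ (respectively $Q_k$ for Hom) equals the base being approximated. *)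

theory Defs
  imports "HOL-Analysis.Analysis" "HOL-Library.Poly_Mapping"
begin

section \<open>Cones\<close>

definition is_grading :: "'v::euclidean_space set \<Rightarrow> ('v \<Rightarrow> real) \<Rightarrow> bool" where
  "is_grading C \<phi> \<longleftrightarrow> linear \<phi> \<and> (\<forall>x\<in>C. 0 \<le> \<phi> x) \<and> C \<inter> {x. \<phi> x = 0} = {0}"

definition AC_object :: "'v::euclidean_space set \<Rightarrow> bool" where
  "AC_object C \<longleftrightarrow>
     convex_cone C \<and> closed C \<and> aff_dim C = int DIM('v) \<and> (\<exists>\<phi>. is_grading C \<phi>)"

definition AC_hom ::
  "'v::euclidean_space set \<Rightarrow> 'w::euclidean_space set \<Rightarrow> ('v \<Rightarrow> 'w) \<Rightarrow> bool" where
  "AC_hom C D f \<longleftrightarrow> linear f \<and> f ` C \<subseteq> D"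

record 'v mc_obj =
  cone_of :: "'v set"
  grad :: "'v \<Rightarrow> real"
  sect :: "real \<Rightarrow> 'v"

definition MC_object :: "'v::euclidean_space mc_obj \<Rightarrow> bool" where
  "MC_object X \<longleftrightarrow>
     AC_object (cone_of X) \<and>
     AC_hom (cone_of X) {0..} (grad X) \<and> is_grading (cone_of X) (grad X) \<and>
     AC_hom {0..} (cone_of X) (sect X) \<and> (\<forall>t. grad X (sect X t) = t) \<and>
     sect X 1 \<in> interior (cone_of X)"

text \<open>Dual spaces are identified with the spaces themselves through the inner product, so
  that a functional is a vector acting by \<open>(\<bullet>)\<close>, and the transpose of a linear map is its
  \<^const>\<open>adjoint\<close>.\<close>

definition dual_cone :: "'v::euclidean_space set \<Rightarrow> 'v set" where
  "dual_cone C = {\<phi>. \<forall>x\<in>C. 0 \<le> \<phi> \<bullet> x}"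

definition mc_dual :: "'v::euclidean_space mc_obj \<Rightarrow> 'v mc_obj" where
  "mc_dual X = \<lparr>cone_of = dual_cone (cone_of X), grad = adjoint (sect X), sect = adjoint (grad X)\<rparr>"

definition slice :: "'v::euclidean_space mc_obj \<Rightarrow> 'v set" where
  "slice X = cone_of X \<inter> {x. grad X x = 1}"

text \<open>The affine space \<open>{x. grad X x = 1}\<close> with origin \<open>sect X 1\<close> is identified with the
  linear space below through \<open>x \<mapsto> x - sect X 1\<close>.\<close>

definition espace :: "'v::euclidean_space mc_obj \<Rightarrow> 'v set" where
  "espace X = {x. grad X x = 0}"

definition polar_in :: "'e::euclidean_space set \<Rightarrow> 'e set \<Rightarrow> 'e set" where
  "polar_in E S = {y \<in> E. \<forall>x\<in>S. y \<bullet> x \<ge> -1}"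


section \<open>Spectrahedra in a subspace \<open>E\<close> of a Euclidean space\<close>

text \<open>Symmetric \<open>m \<times> m\<close> matrices are functions on \<open>{..<m} \<times> {..<m}\<close>, as their size has to be
  quantified existentially. Coordinates are those of the ambient space; every affine map
  on \<open>E\<close> extends to it.\<close>

definition symmat :: "nat \<Rightarrow> (nat \<Rightarrow> nat \<Rightarrow> real) \<Rightarrow> bool" where
  "symmat m M \<longleftrightarrow> (\<forall>i<m. \<forall>j<m. M i j = M j i)"

definition psd :: "nat \<Rightarrow> (nat \<Rightarrow> nat \<Rightarrow> real) \<Rightarrow> bool" where
  "psd m M \<longleftrightarrow> symmat m M \<and> (\<forall>v. 0 \<le> (\<Sum>i<m. \<Sum>j<m. v i * M i j * v j))"

definition spectrahedron_in :: "'e::euclidean_space set \<Rightarrow> 'e set \<Rightarrow> bool" where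
  "spectrahedron_in E X \<longleftrightarrow>
     (\<exists>m M0 M. symmat m M0 \<and> (\<forall>b\<in>Basis. symmat m (M b)) \<and>
        X = {x \<in> E. psd m (\<lambda>i j. M0 i j + (\<Sum>b\<in>Basis. (x \<bullet> b) * M b i j))})"

definition SDR_in :: "'e::euclidean_space set \<Rightarrow> 'e set \<Rightarrow> bool" where
  "SDR_in E X \<longleftrightarrow>
     (\<exists>m k M0 M N. symmat m M0 \<and> (\<forall>b\<in>Basis. symmat m (M b)) \<and> (\<forall>l<k. symmat m (N l)) \<and>
        X = {x \<in> E. \<exists>y::nat \<Rightarrow> real.
               psd m (\<lambda>i j. M0 i j + (\<Sum>b\<in>Basis. (x \<bullet> b) * M b i j) + (\<Sum>l<k. y l * N l i j))})"

lemma spectrahedron_imp_SDR: "spectrahedron_in E X \<Longrightarrow> SDR_in E X"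
  unfolding spectrahedron_in_def SDR_in_def
  apply (elim exE conjE)
  subgoal for m M0 M
    by (rule exI[of _ m], rule exI[of _ 0], rule exI[of _ M0], rule exI[of _ M]) simp
  done


section \<open>The approximation scheme\<close>

definition exponents :: "nat \<Rightarrow> ('x::euclidean_space \<Rightarrow> nat) set" where
  "exponents k = {\<alpha> \<in> Basis \<rightarrow>\<^sub>E {..k}. (\<Sum>b\<in>Basis. \<alpha> b) \<le> k}"

definition polynomials_upto :: "nat \<Rightarrow> ('x::euclidean_space \<Rightarrow> real) set" where
  "polynomials_upto k =
     {a. \<exists>c. a = (\<lambda>x. \<Sum>\<alpha>\<in>exponents k. c \<alpha> * (\<Prod>b\<in>Basis. (x \<bullet> b) ^ \<alpha> b))}"

definition finite_measure_supported_on ::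
  "'x::euclidean_space measure \<Rightarrow> 'x set \<Rightarrow> bool" where
  "finite_measure_supported_on \<mu> S \<longleftrightarrow>
     sets \<mu> = sets borel \<and> finite_measure \<mu> \<and> emeasure \<mu> (- S) = 0 \<and>
     (\<forall>x\<in>S. \<forall>U. open U \<and> x \<in> U \<longrightarrow> emeasure \<mu> U > 0)"

text \<open>The sets \<open>Q\<^sub>k\<close>. Here \<open>E\<close> is the space in which \<open>T\<close> takes its values. When \<open>S\<close> lies
  in an affine subspace, the polynomials of degree at most \<open>k\<close> on that subspace are the
  restrictions of those on the ambient space.\<close>

definition moment_set ::
  "'e::euclidean_space set \<Rightarrow> 'x::euclidean_space set \<Rightarrow> 'x measure \<Rightarrow> ('x \<Rightarrow> 'e) \<Rightarrow> nat \<Rightarrow> 'e set"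
where
  "moment_set E S \<mu> T k =
     {u \<in> E. \<forall>a\<in>polynomials_upto k.
        0 \<le> set_lebesgue_integral \<mu> S (\<lambda>x. (1 + u \<bullet> T x) * (a x)\<^sup>2)}"

definition vertices :: "'v::euclidean_space set \<Rightarrow> 'v set" where
  "vertices P = {v. v extreme_point_of P}"

text \<open>The counting measure on \<open>V\<close> as a Borel measure on the ambient space.\<close>

definition counting_measure_on :: "'v::euclidean_space set \<Rightarrow> 'v measure" where
  "counting_measure_on V = distr (count_space V) borel (\<lambda>x. x)"


section \<open>Tensor products and \<open>Hom\<close>\<close>

definition tensor :: "real^'d \<Rightarrow> real^'e \<Rightarrow> real^'e^'d" where
  "tensor a b = (\<chi> i j. a $ i * b $ j)"

definition tensor_cone :: "(real^'d) mc_obj \<Rightarrow> (real^'e) mc_obj \<Rightarrow> (real^'e^'d) set" where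
  "tensor_cone A B = convex_cone hull {tensor a b | a b. a \<in> cone_of A \<and> b \<in> cone_of B}"

definition tensor_space ::
  "(real^'d) mc_obj \<Rightarrow> (real^'e) mc_obj \<Rightarrow> ((real^'d) \<times> (real^'e) \<times> (real^'e^'d)) set" where
  "tensor_space A B =
     espace A \<times> espace B \<times> span {tensor x y | x y. x \<in> espace A \<and> y \<in> espace B}"

definition tensor_map ::
  "(real^'d) mc_obj \<Rightarrow> (real^'e) mc_obj \<Rightarrow> (real^'d) \<times> (real^'e) \<Rightarrow> (real^'d) \<times> (real^'e) \<times> (real^'e^'d)"
where
  "tensor_map A B p =
     (let x = fst p - sect A 1; y = snd p - sect B 1 in (x, y, tensor x y))"

definition tensor_base ::
  "(real^'d) mc_obj \<Rightarrow> (real^'e) mc_obj \<Rightarrow> ((real^'d) \<times> (real^'e) \<times> (real^'e^'d)) set" where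
  "tensor_base A B = convex hull (tensor_map A B ` (slice A \<times> slice B))"

text \<open>With \<open>s = sect A 1\<close>, \<open>t = sect B 1\<close>, the decomposition of \<open>(\<real>s \<oplus> E\<^sub>A) \<otimes> (\<real>t \<oplus> E\<^sub>B)\<close>
  identifies \<open>tensor_space A B\<close> with the affine space of tensors of degree \<open>1\<close>. The
  resulting map sends \<open>tensor_map A B (a, b)\<close> to \<open>tensor a b\<close>.\<close>

definition tensor_embed ::
  "(real^'d) mc_obj \<Rightarrow> (real^'e) mc_obj \<Rightarrow> (real^'d) \<times> (real^'e) \<times> (real^'e^'d) \<Rightarrow> real^'e^'d" where
  "tensor_embed A B = (\<lambda>(x, y, z).
     tensor (sect A 1) (sect B 1) + tensor x (sect B 1) + tensor (sect A 1) y + z)"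

definition tensor_cone_over ::
  "(real^'d) mc_obj \<Rightarrow> (real^'e) mc_obj \<Rightarrow> ((real^'d) \<times> (real^'e) \<times> (real^'e^'d)) set
     \<Rightarrow> (real^'e^'d) set" where
  "tensor_cone_over A B K = cone hull (tensor_embed A B ` K)"

definition tensor_scheme ::
  "(real^'d) mc_obj \<Rightarrow> (real^'e) mc_obj \<Rightarrow> (real^'d) set \<Rightarrow> (real^'d) measure
     \<Rightarrow> (real^'e) set \<Rightarrow> (real^'e) measure \<Rightarrow> nat \<Rightarrow> ((real^'d) \<times> (real^'e) \<times> (real^'e^'d)) set" where
  "tensor_scheme A B SA mA SB mB =
     moment_set (tensor_space A B) (SA \<times> SB) (mA \<Otimes>\<^sub>M mB) (tensor_map A B)"

text \<open>Linear maps are represented by their matrices.\<close>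

definition Hom_cone :: "(real^'d) mc_obj \<Rightarrow> (real^'e) mc_obj \<Rightarrow> (real^'d^'e) set" where
  "Hom_cone A B = {f. AC_hom (cone_of A) (cone_of B) ((*v) f)}"

definition Hom_space ::
  "(real^'d) mc_obj \<Rightarrow> (real^'e) mc_obj \<Rightarrow> ((real^'d) \<times> (real^'e) \<times> (real^'e^'d)) set" where
  "Hom_space A B = tensor_space A (mc_dual B)"

definition Hom_base ::
  "(real^'d) mc_obj \<Rightarrow> (real^'e) mc_obj \<Rightarrow> ((real^'d) \<times> (real^'e) \<times> (real^'e^'d)) set" where
  "Hom_base A B = polar_in (Hom_space A B) (tensor_base A (mc_dual B))"

text \<open>A point \<open>u\<close> of the dual of \<open>Hom_space A B\<close> corresponds to the linear map \<open>f\<close> of degree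
  \<open>1\<close> for which the pairing of \<open>f\<close> with \<open>a \<otimes> \<beta>\<close>, i.e. \<open>\<beta>(f(a))\<close>, is the affine function
  \<open>1 + u\<close> at the point corresponding to \<open>a \<otimes> \<beta>\<close>, for all \<open>a\<close> and \<open>\<beta>\<close> of degree \<open>1\<close>.\<close>

definition Hom_cone_over ::
  "(real^'d) mc_obj \<Rightarrow> (real^'e) mc_obj \<Rightarrow> ((real^'d) \<times> (real^'e) \<times> (real^'e^'d)) set
     \<Rightarrow> (real^'d^'e) set" where
  "Hom_cone_over A B K = cone hull {f. \<exists>u\<in>K. \<forall>a \<beta>. grad A a = 1 \<and> grad (mc_dual B) \<beta> = 1 \<longrightarrow>
     \<beta> \<bullet> (f *v a) = 1 + u \<bullet> tensor_map A (mc_dual B) (a, \<beta>)}"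

definition Hom_scheme ::
  "(real^'d) mc_obj \<Rightarrow> (real^'e) mc_obj \<Rightarrow> (real^'d) set \<Rightarrow> (real^'d) measure
     \<Rightarrow> (real^'e) set \<Rightarrow> (real^'e) measure \<Rightarrow> nat \<Rightarrow> ((real^'d) \<times> (real^'e) \<times> (real^'e^'d)) set" where
  "Hom_scheme A B = tensor_scheme A (mc_dual B)"


section \<open>Symmetric powers\<close>

text \<open>The symmetric algebra of \<open>\<real>\<^sup>d\<close> is the polynomial ring in variables indexed by
  \<open>'d\<close>, with \<open>Sym\<^sup>j\<close> its part of degree \<open>j\<close>. Its part of degree at most \<open>n = CARD('n)\<close>,
  the direct sum of the \<open>Sym\<^sup>j\<close> for \<open>0 \<le> j \<le> n\<close>, is the Euclidean space of coefficient vectors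
  indexed by the finite type of monomials of degree at most \<open>n\<close>.\<close>

type_synonym 'd sym_alg = "('d \<Rightarrow>\<^sub>0 nat) \<Rightarrow>\<^sub>0 real"

definition mdeg :: "('d::finite \<Rightarrow>\<^sub>0 nat) \<Rightarrow> nat" where
  "mdeg m = (\<Sum>i\<in>UNIV. Poly_Mapping.lookup m i)"

typedef ('d::finite, 'n::finite) monom_upto = "{m :: 'd \<Rightarrow>\<^sub>0 nat. mdeg m \<le> CARD('n)}"
  morphisms exponent_of monom_of
  by (rule exI[of _ 0]) (simp add: mdeg_def)

instance monom_upto :: (finite, finite) finite
proof
  have "finite {m :: 'a \<Rightarrow>\<^sub>0 nat. mdeg m \<le> CARD('b)}"
  proof (rule finite_imageD)
    have "Poly_Mapping.lookup m i \<le> CARD('b)" if "mdeg m \<le> CARD('b)" for m :: "'a \<Rightarrow>\<^sub>0 nat" and i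
      using that member_le_sum[of i UNIV "Poly_Mapping.lookup m"] unfolding mdeg_def by simp
    then have "Poly_Mapping.lookup ` {m :: 'a \<Rightarrow>\<^sub>0 nat. mdeg m \<le> CARD('b)} \<subseteq> UNIV \<rightarrow>\<^sub>E {..CARD('b)}"
      by auto
    then show "finite (Poly_Mapping.lookup ` {m :: 'a \<Rightarrow>\<^sub>0 nat. mdeg m \<le> CARD('b)})"
      by (rule finite_subset) (simp add: finite_PiE)
  qed (auto simp: inj_on_def Poly_Mapping.lookup_inject)
  then show "finite (UNIV :: ('a, 'b) monom_upto set)"
    by (metis type_definition.Abs_image[OF type_definition_monom_upto] finite_imageI)
qed

definition lin :: "real^'d \<Rightarrow> 'd sym_alg" where
  "lin a = (\<Sum>i\<in>UNIV. Poly_Mapping.single (Poly_Mapping.single i 1) (a $ i))"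

definition to_vec :: "'d::finite sym_alg \<Rightarrow> real^('d, 'n::finite) monom_upto" where
  "to_vec p = (\<chi> m. Poly_Mapping.lookup p (exponent_of m))"

definition of_vec :: "real^('d::finite, 'n::finite) monom_upto \<Rightarrow> 'd sym_alg" where
  "of_vec z = (\<Sum>m\<in>UNIV. Poly_Mapping.single (exponent_of m) (z $ m))"

definition hom_part ::
  "nat \<Rightarrow> real^('d::finite, 'n::finite) monom_upto \<Rightarrow> real^('d, 'n) monom_upto" where
  "hom_part j z = (\<chi> m. if mdeg (exponent_of m) = j then z $ m else 0)"

definition Sym_top :: "(real^('d::finite, 'n::finite) monom_upto) set" \<comment> \<open>\<open>Sym\<^sup>n(\<real>\<^sup>d)\<close>\<close> where
  "Sym_top = {z. hom_part CARD('n) z = z}"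

definition Sym_cone ::
  "(real^'d) mc_obj \<Rightarrow> (real^('d, 'n::finite) monom_upto) set" where
  "Sym_cone A = convex_cone hull {to_vec (\<Prod>i\<in>UNIV. lin (a i)) | a::'n \<Rightarrow> real^'d. \<forall>i. a i \<in> cone_of A}"

text \<open>The product of the \<open>Sym\<^sup>j(E\<^sub>A)\<close>, \<open>1 \<le> j \<le> n\<close>, as an internal direct sum.\<close>

definition Sym_space ::
  "(real^'d) mc_obj \<Rightarrow> (real^('d, 'n::finite) monom_upto) set" where
  "Sym_space A = span {to_vec (\<Prod>i<j. lin (x i)) | j x. 1 \<le> j \<and> j \<le> CARD('n) \<and> (\<forall>i<j. x i \<in> espace A)}"

definition elem_sym :: "nat \<Rightarrow> (real^'d)^'n \<Rightarrow> 'd sym_alg" where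
  "elem_sym j p = (\<Sum>J | card J = j. \<Prod>i\<in>J. lin (p $ i))"

definition Sym_map ::
  "(real^'d) mc_obj \<Rightarrow> (real^'d)^'n \<Rightarrow> real^('d, 'n::finite) monom_upto" where
  "Sym_map A p = (\<Sum>j=1..CARD('n). to_vec (elem_sym j (\<chi> i. p $ i - sect A 1)))"

definition power_set :: "'v set \<Rightarrow> ('v^'n::finite) set" where
  "power_set P = {p. \<forall>i. p $ i \<in> P}"

definition power_measure :: "'v::euclidean_space measure \<Rightarrow> ('v^'n::finite) measure" where
  "power_measure \<mu> = distr (\<Pi>\<^sub>M i\<in>UNIV. \<mu>) borel (\<lambda>f. \<chi> i. f i)"

definition Sym_base ::
  "(real^'d) mc_obj \<Rightarrow> (real^('d, 'n::finite) monom_upto) set" where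
  "Sym_base A = convex hull (Sym_map A ` power_set (slice A))"

text \<open>With \<open>s = sect A 1\<close>, the decomposition \<open>Sym\<^sup>n(\<real>s \<oplus> E\<^sub>A) = (\<Oplus>j. s\<^sup>n\<^sup>-\<^sup>j Sym\<^sup>j(E\<^sub>A))\<close>
  identifies \<open>Sym_space A\<close> with the affine space of elements of degree \<open>1\<close>. The resulting
  map sends \<open>Sym_map A p\<close> to the product of the \<open>p\<^sub>i\<close>.\<close>

definition Sym_embed ::
  "(real^'d) mc_obj \<Rightarrow> real^('d, 'n::finite) monom_upto \<Rightarrow> real^('d, 'n) monom_upto" where
  "Sym_embed A z = to_vec (lin (sect A 1) ^ CARD('n) +
     (\<Sum>j=1..CARD('n). lin (sect A 1) ^ (CARD('n) - j) * of_vec (hom_part j z)))"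

definition Sym_cone_over ::
  "(real^'d) mc_obj \<Rightarrow> (real^('d, 'n::finite) monom_upto) set
     \<Rightarrow> (real^('d, 'n) monom_upto) set" where
  "Sym_cone_over A K = cone hull (Sym_embed A ` K)"

definition Sym_scheme ::
  "(real^'d) mc_obj \<Rightarrow> (real^'d) set \<Rightarrow> (real^'d) measure
     \<Rightarrow> nat \<Rightarrow> (real^('d, 'n::finite) monom_upto) set" where
  "Sym_scheme A SA mA =
     moment_set (Sym_space A) (power_set SA :: ((real^'d)^'n) set) (power_measure mA) (Sym_map A)"


section \<open>Accuracy and finite convergence\<close>

text \<open>In each predicate the first conjunct is the representation of the approximants by
  linear matrix inequalities, the second the (exact or asymptotic) recovery of the base, and
  the third that of the cone. A spectrahedron is in particular an SDR set.\<close>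

definition tensor_accurate ::
  "(real^'d) mc_obj \<Rightarrow> (real^'e) mc_obj \<Rightarrow> (nat \<Rightarrow> ((real^'d) \<times> (real^'e) \<times> (real^'e^'d)) set) \<Rightarrow> bool"
where
  "tensor_accurate A B Q \<longleftrightarrow>
     (\<forall>k. SDR_in (tensor_space A B) (polar_in (tensor_space A B) (Q k))) \<and>
     tensor_base A B = closure (\<Union>k. polar_in (tensor_space A B) (Q k)) \<and>
     tensor_cone A B = closure (\<Union>k. tensor_cone_over A B (polar_in (tensor_space A B) (Q k)))"

definition tensor_finitely_convergent ::
  "(real^'d) mc_obj \<Rightarrow> (real^'e) mc_obj \<Rightarrow> (nat \<Rightarrow> ((real^'d) \<times> (real^'e) \<times> (real^'e^'d)) set) \<Rightarrow> bool"
where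
  "tensor_finitely_convergent A B Q \<longleftrightarrow>
     (\<exists>k. SDR_in (tensor_space A B) (polar_in (tensor_space A B) (Q k)) \<and>
          polar_in (tensor_space A B) (Q k) = tensor_base A B \<and>
          tensor_cone_over A B (polar_in (tensor_space A B) (Q k)) = tensor_cone A B)"

definition Sym_accurate ::
  "(real^'d) mc_obj \<Rightarrow> (nat \<Rightarrow> (real^('d, 'n::finite) monom_upto) set) \<Rightarrow> bool" where
  "Sym_accurate A Q \<longleftrightarrow>
     (\<forall>k. SDR_in (Sym_space A) (polar_in (Sym_space A) (Q k))) \<and>
     Sym_base A = closure (\<Union>k. polar_in (Sym_space A) (Q k)) \<and>
     Sym_cone A = closure (\<Union>k. Sym_cone_over A (polar_in (Sym_space A) (Q k)))"

definition Sym_finitely_convergent ::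
  "(real^'d) mc_obj \<Rightarrow> (nat \<Rightarrow> (real^('d, 'n::finite) monom_upto) set) \<Rightarrow> bool" where
  "Sym_finitely_convergent A Q \<longleftrightarrow>
     (\<exists>k. SDR_in (Sym_space A) (polar_in (Sym_space A) (Q k)) \<and>
          polar_in (Sym_space A) (Q k) = Sym_base A \<and>
          Sym_cone_over A (polar_in (Sym_space A) (Q k)) = Sym_cone A)"

definition Hom_accurate ::
  "(real^'d) mc_obj \<Rightarrow> (real^'e) mc_obj \<Rightarrow> (nat \<Rightarrow> ((real^'d) \<times> (real^'e) \<times> (real^'e^'d)) set) \<Rightarrow> bool"
where
  "Hom_accurate A B Q \<longleftrightarrow>
     (\<forall>k. spectrahedron_in (Hom_space A B) (Q k)) \<and>
     Hom_base A B = (\<Inter>k. Q k) \<and>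
     Hom_cone A B = (\<Inter>k. Hom_cone_over A B (Q k))"

definition Hom_finitely_convergent ::
  "(real^'d) mc_obj \<Rightarrow> (real^'e) mc_obj \<Rightarrow> (nat \<Rightarrow> ((real^'d) \<times> (real^'e) \<times> (real^'e^'d)) set) \<Rightarrow> bool"
where
  "Hom_finitely_convergent A B Q \<longleftrightarrow>
     (\<exists>k. spectrahedron_in (Hom_space A B) (Q k) \<and>
          Q k = Hom_base A B \<and>
          Hom_cone_over A B (Q k) = Hom_cone A B)"

end

theory Submission
  imports Defs
begin

text \<open>All three schemes are instances of one: a compact set \<open>S\<close> with a finite measure of full
  support and a continuous map \<open>T\<close> from \<open>S\<close> to a subspace \<open>E\<close> (the locale \<open>moment_scheme\<close>). The
  moment sets \<open>Q k\<close> decrease to the polar of \<open>T ` S\<close> (\<open>Inter_moment_set\<close>). If \<open>1 + u \<bullet> T\<close> is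
  nonnegative on \<open>S\<close>, then so are all its integrals against squares. If it is negative somewhere,
  then its integral against the square of its negative part is negative, and by the Weierstrass
  theorem a polynomial can take the place of the negative part. When \<open>S\<close> is finite, interpolation
  polynomials isolate its points, and some \<open>Q k\<close> equals the polar (\<open>moment_set_finite\<close>).

  To represent \<open>Q k\<close> and its polar by matrix inequalities, choose polynomials \<open>p\<^sub>i\<close> that form an
  orthonormal basis, with respect to the measure, of the polynomials of degree at most \<open>k\<close> on
  \<open>S\<close>, and let \<open>V\<^sub>i\<^sub>j\<close> be the integral of \<open>p\<^sub>i p\<^sub>j T\<close>. Then \<open>u\<close> lies in \<open>Q k\<close> if and only if the matrix
  with entries \<open>\<delta>\<^sub>i\<^sub>j + u \<bullet> V\<^sub>i\<^sub>j\<close> is positive semidefinite (\<open>moment_set_eq_gram\<close>). Dually, the polar of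
  \<open>Q k\<close> consists of the sums \<open>\<Sum> G\<^sub>i\<^sub>j V\<^sub>i\<^sub>j\<close> with \<open>G\<close> positive semidefinite of trace at most one
  (\<open>moment_set_eq_polar\<close>), and such sums form a projected spectrahedron. The identity matrix that
  orthonormality produces is essential here: it bounds the trace, which makes this set compact,
  so that no closure has to be taken in the bipolar theorem. The bipolar theorem also turns the
  intersection of the \<open>Q k\<close> into the closed union of their polars
  (\<open>closure_Union_polar_in\<close>), which is therefore the convex hull of \<open>T ` S\<close>.

  It remains to recognise the data. Slices of cones are compact, and products and powers of
  measures of full support have full support. The bases of the tensor product and of the symmetric
  power are the convex hulls of the images of \<open>tensor_map\<close> and \<open>Sym_map\<close>. Since these maps are
  affine in each argument, the vertices of the slices generate the same hulls, and in the polyhedral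
  case there are finitely many of them. An affine embedding puts each base at degree one in its
  cone, away from the origin, so convergence of bases becomes convergence of cones
  (\<open>closure_Union_cone_hull\<close>). The base of \<open>Hom\<close> is the polar of the base of a tensor product, and
  linear maps of degree one correspond to functionals on the tensor space
  (\<open>hom_point_exists\<close>). The polyhedral cones have finitely many generators or finitely many
  linear conditions, hence are given by diagonal matrix inequalities.\<close>

section \<open>Polars inside a subspace\<close>

text \<open>Functionals on a subspace are restrictions of functionals on the whole space; orthogonal
  projection picks the one that lies in the subspace. This is how polars computed in the ambient
  space are transported into \<open>E\<close>.\<close>

lemma subspace_representative:
  fixes E :: "'e::euclidean_space set"
  assumes "subspace E"
  obtains u where "u \<in> E" "\<And>v. v \<in> E \<Longrightarrow> u \<bullet> v = w \<bullet> v"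
proof -
  obtain y z where "y \<in> span E" "\<And>v. v \<in> span E \<Longrightarrow> orthogonal z v" "w = y + z"
    using orthogonal_subspace_decomp_exists[of E w] by metis
  moreover have "span E = E"
    using assms by simp
  ultimately show ?thesis
    using that[of y] by (simp add: orthogonal_def inner_add_left)
qed

text \<open>A hyperplane that separates \<open>y\<close> from \<open>K\<close> misses the origin because \<open>0 \<in> K\<close>, so it can be
  scaled to level \<open>-1\<close>, and its normal can be projected to \<open>E\<close>.\<close>

lemma polar_separation:
  fixes K :: "'e::euclidean_space set"
  assumes E: "subspace E" and K: "K \<subseteq> E" "closed K" "convex K" "0 \<in> K" and y: "y \<in> E" "y \<notin> K"
  obtains u where "u \<in> polar_in E K" "u \<bullet> y < -1"
proof -
  obtain a b where ab: "a \<bullet> y < b" "\<And>x. x \<in> K \<Longrightarrow> b < a \<bullet> x"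
    using separating_hyperplane_closed_point[of K y] K y by blast
  then have b: "b < 0" using K(4) by force
  obtain u where u: "u \<in> E" "\<And>v. v \<in> E \<Longrightarrow> u \<bullet> v = ((1 / (- b)) *\<^sub>R a) \<bullet> v"
    using subspace_representative[OF E] by blast
  have "u \<in> polar_in E K"
  proof -
    have "u \<bullet> x \<ge> -1" if "x \<in> K" for x
    proof -
      have "u \<bullet> x = (a \<bullet> x) / (- b)" using u(2) that K(1) by auto
      moreover have "b < a \<bullet> x" using ab(2) that by simp
      ultimately show ?thesis
        using b by (simp add: le_divide_eq divide_le_eq minus_divide_right[symmetric])
    qed
    then show ?thesis using u by (simp add: polar_in_def)
  qed
  moreover have "u \<bullet> y < -1"
  proof -
    have "u \<bullet> y = (a \<bullet> y) / (- b)" using u(2)[OF y(1)] by simp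
    then show ?thesis using ab(1) b by (simp add: less_divide_eq divide_less_eq minus_divide_right[symmetric])
  qed
  ultimately show ?thesis using that by blast
qed

lemma polar_in_mono: "S \<subseteq> S' \<Longrightarrow> polar_in E S' \<subseteq> polar_in E S"
  by (auto simp: polar_in_def)

lemma polar_in_bipolar:
  fixes K :: "'e::euclidean_space set"
  assumes "subspace E" "K \<subseteq> E" "closed K" "convex K" "0 \<in> K"
  shows "polar_in E (polar_in E K) = K"
proof
  show "K \<subseteq> polar_in E (polar_in E K)"
    using assms(2) by (auto simp: polar_in_def inner_commute)
  show "polar_in E (polar_in E K) \<subseteq> K"
  proof
    fix y assume y: "y \<in> polar_in E (polar_in E K)"
    show "y \<in> K"
    proof (rule ccontr)
      assume "y \<notin> K"
      then obtain u where "u \<in> polar_in E K" "u \<bullet> y < -1"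
        using polar_separation[OF assms, of y] y by (auto simp: polar_in_def)
      then show False using y by (auto simp: polar_in_def inner_commute not_le[symmetric])
    qed
  qed
qed

lemma zero_in_polar_in: "subspace E \<Longrightarrow> 0 \<in> polar_in E S"
  by (simp add: polar_in_def subspace_0)

lemma convex_polar_in:
  assumes "subspace E" shows "convex (polar_in E S)"
proof -
  have "polar_in E S = E \<inter> (\<Inter>x\<in>S. {y. x \<bullet> y \<ge> -1})"
    by (auto simp: polar_in_def inner_commute)
  then show ?thesis
    using subspace_imp_convex[OF assms] by (simp add: convex_Int convex_INT convex_halfspace_ge)
qed

lemma polar_in_convex_hull: "polar_in E (convex hull X) = polar_in E X"
proof
  show "polar_in E (convex hull X) \<subseteq> polar_in E X"
    by (rule polar_in_mono) (simp add: hull_subset)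
  show "polar_in E X \<subseteq> polar_in E (convex hull X)"
  proof
    fix u assume u: "u \<in> polar_in E X"
    then have "convex hull X \<subseteq> {x. u \<bullet> x \<ge> -1}"
      by (intro hull_minimal convex_halfspace_ge) (auto simp: polar_in_def)
    then show "u \<in> polar_in E (convex hull X)"
      using u by (auto simp: polar_in_def)
  qed
qed

text \<open>Polarity turns intersections into closed unions. A point of \<open>B\<close> outside the closed union
  would be separated from all the polars by one \<open>u\<close>; the bipolar theorem puts \<open>u\<close> into every
  \<open>Q k\<close>, hence into the polar of \<open>B\<close>, where it cannot take a value below \<open>-1\<close> on \<open>B\<close>.\<close>

lemma closure_Union_polar_in:
  fixes B :: "'e::euclidean_space set"
  assumes E: "subspace E" and B: "B \<subseteq> E" "closed B" "convex B" "0 \<in> B"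
    and Q: "decseq Q" "\<And>k. polar_in E (polar_in E (Q k)) = Q k" "(\<Inter>k. Q k) = polar_in E B"
  shows "closure (\<Union>k. polar_in E (Q k)) = B"
proof
  let ?K = "closure (\<Union>k. polar_in E (Q k))"
  have sub: "polar_in E (Q k) \<subseteq> B" for k
  proof -
    have "polar_in E B \<subseteq> Q k" using Q(3) by auto
    then have "polar_in E (Q k) \<subseteq> polar_in E (polar_in E B)" by (rule polar_in_mono)
    then show ?thesis by (simp add: polar_in_bipolar[OF E B])
  qed
  then show KB: "?K \<subseteq> B"
    using B(2) by (intro closure_minimal) auto
  show "B \<subseteq> ?K"
  proof (rule ccontr)
    assume "\<not> B \<subseteq> ?K"
    then obtain b where b: "b \<in> B" "b \<notin> ?K" by blast
    have "convex (\<Union>k. polar_in E (Q k))"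
      unfolding convex_def
    proof (clarify)
      fix x y i j and a b :: real
      assume x: "x \<in> polar_in E (Q i)" and y: "y \<in> polar_in E (Q j)" and ab: "0 \<le> a" "0 \<le> b" "a + b = 1"
      have "Q (max i j) \<subseteq> Q i" "Q (max i j) \<subseteq> Q j"
        using Q(1) by (auto simp: decseq_def)
      then have "x \<in> polar_in E (Q (max i j))" "y \<in> polar_in E (Q (max i j))"
        using x y polar_in_mono[of "Q (max i j)" "Q i" E] polar_in_mono[of "Q (max i j)" "Q j" E] by auto
      then have "a *\<^sub>R x + b *\<^sub>R y \<in> polar_in E (Q (max i j))"
        using convex_polar_in[OF E] ab by (simp add: convex_def)
      then show "a *\<^sub>R x + b *\<^sub>R y \<in> (\<Union>k. polar_in E (Q k))" by blast
    qed
    then have "convex ?K" by (rule convex_closure)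
    moreover have "0 \<in> ?K"
      using zero_in_polar_in[OF E] by (intro closure_subset[THEN subsetD]) simp
    moreover have "?K \<subseteq> E" using KB B(1) by blast
    ultimately obtain u where u: "u \<in> polar_in E ?K" "u \<bullet> b < -1"
      using polar_separation[OF E, of ?K b] b B(1) by blast
    have "u \<in> Q k" for k
    proof -
      have "polar_in E (Q k) \<subseteq> ?K"
        by (rule order_trans[OF _ closure_subset]) auto
      from polar_in_mono[OF this] have "u \<in> polar_in E (polar_in E (Q k))" using u(1) by auto
      then show ?thesis using Q(2) by simp
    qed
    then have "u \<in> polar_in E B" using Q(3) by auto
    then have "-1 \<le> u \<bullet> b" using b(1) unfolding polar_in_def by blast
    then show False using u(2) by linarith
  qed
qed


section \<open>Positive semidefinite matrices and linear matrix inequalities\<close>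

lemma sum_lessThan_plus:
  "(\<Sum>i<m+n. f i) = (\<Sum>i<m. f i) + (\<Sum>i<n. f (m + i :: nat))" for f :: "nat \<Rightarrow> 'a::comm_monoid_add"
  by (induction n) (simp_all add: add.assoc)

lemma psd_cong:
  assumes "\<And>i j. i < m \<Longrightarrow> j < m \<Longrightarrow> A i j = B i j"
  shows "psd m A \<longleftrightarrow> psd m B"
proof -
  have "(\<Sum>i<m. \<Sum>j<m. v i * A i j * v j) = (\<Sum>i<m. \<Sum>j<m. v i * B i j * v j)" for v
    using assms by (intro sum.cong refl) simp
  then show ?thesis using assms by (simp add: psd_def symmat_def)
qed

definition blockdiag :: "nat \<Rightarrow> (nat \<Rightarrow> nat \<Rightarrow> real) \<Rightarrow> (nat \<Rightarrow> nat \<Rightarrow> real) \<Rightarrow> nat \<Rightarrow> nat \<Rightarrow> real" where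
  "blockdiag m A B = (\<lambda>i j. if i < m \<and> j < m then A i j
     else if m \<le> i \<and> m \<le> j then B (i - m) (j - m) else 0)"

lemma symmat_blockdiag:
  assumes "symmat m A" "symmat n B" shows "symmat (m + n) (blockdiag m A B)"
  using assms unfolding symmat_def blockdiag_def by auto

lemma psd_blockdiag: "psd (m + n) (blockdiag m A B) \<longleftrightarrow> psd m A \<and> psd n B"
proof -
  have quad: "(\<Sum>i<m+n. \<Sum>j<m+n. v i * blockdiag m A B i j * v j) =
      (\<Sum>i<m. \<Sum>j<m. v i * A i j * v j) + (\<Sum>i<n. \<Sum>j<n. v (m + i) * B i j * v (m + j))" for v
    unfolding sum_lessThan_plus by (simp add: blockdiag_def)
  have sym: "symmat (m + n) (blockdiag m A B) \<longleftrightarrow> symmat m A \<and> symmat n B"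
  proof
    assume s: "symmat (m + n) (blockdiag m A B)"
    have "A i j = A j i" if "i < m" "j < m" for i j
      using s that unfolding symmat_def blockdiag_def by (metis trans_less_add1)
    moreover have "B i j = B j i" if "i < n" "j < n" for i j
    proof -
      have "blockdiag m A B (m + i) (m + j) = blockdiag m A B (m + j) (m + i)"
        using s that unfolding symmat_def by simp
      then show ?thesis by (simp add: blockdiag_def)
    qed
    ultimately show "symmat m A \<and> symmat n B" by (simp add: symmat_def)
  qed (simp add: symmat_blockdiag)
  show ?thesis
  proof
    assume p: "psd (m + n) (blockdiag m A B)"
    have "0 \<le> (\<Sum>i<m. \<Sum>j<m. v i * A i j * v j)" for v
    proof -
      have "0 \<le> (\<Sum>i<m+n. \<Sum>j<m+n. (if i < m then v i else 0) * blockdiag m A B i j * (if j < m then v j else 0))"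
        using spec[OF conjunct2[OF p[unfolded psd_def]], of "\<lambda>i. if i < m then v i else 0"] .
      then show ?thesis by (simp only: quad) simp
    qed
    moreover have "0 \<le> (\<Sum>i<n. \<Sum>j<n. v i * B i j * v j)" for v
    proof -
      have "0 \<le> (\<Sum>i<m+n. \<Sum>j<m+n. (if i < m then 0 else v (i - m)) * blockdiag m A B i j * (if j < m then 0 else v (j - m)))"
        using spec[OF conjunct2[OF p[unfolded psd_def]], of "\<lambda>i. if i < m then 0 else v (i - m)"] .
      then show ?thesis by (simp only: quad) simp
    qed
    ultimately show "psd m A \<and> psd n B" using p sym by (simp add: psd_def)
  next
    assume "psd m A \<and> psd n B"
    then show "psd (m + n) (blockdiag m A B)"
      unfolding psd_def quad sym by auto
  qed
qed

lemma quad_Suc: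
  assumes "symmat (Suc m) G"
  shows "(\<Sum>i<Suc m. \<Sum>j<Suc m. v i * G i j * v j) =
    (\<Sum>i<m. \<Sum>j<m. v i * G i j * v j) + 2 * v m * (\<Sum>i<m. v i * G i m) + (v m)\<^sup>2 * G m m"
proof -
  have "(\<Sum>j<m. v m * G m j * v j) = v m * (\<Sum>i<m. v i * G i m)"
    unfolding sum_distrib_left using assms by (intro sum.cong) (auto simp: symmat_def)
  moreover have "(\<Sum>i<m. v i * G i m * v m) = v m * (\<Sum>i<m. v i * G i m)"
    unfolding sum_distrib_left by (intro sum.cong) auto
  ultimately show ?thesis
    by (simp add: sum.distrib power2_eq_square algebra_simps)
qed

lemma linear_nonneg_imp_zero:
  fixes a b :: real
  assumes "\<And>t. 0 \<le> a + t * b" shows "b = 0"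
proof (rule ccontr)
  assume "b \<noteq> 0"
  then have "a + (- (a + 1) / b) * b = -1" by simp
  then show False using assms[of "- (a + 1) / b"] by linarith
qed

text \<open>Induction on the size, by eliminating the last variable. If the last diagonal entry is zero,
  so is the last row, and otherwise subtracting a rank one matrix leaves the Schur complement.\<close>

lemma psd_sum_of_squares:
  assumes "psd m G"
  obtains v :: "nat \<Rightarrow> nat \<Rightarrow> real" where "\<And>i j. i < m \<Longrightarrow> j < m \<Longrightarrow> G i j = (\<Sum>l<m. v l i * v l j)"
proof -
  have "\<exists>v::nat \<Rightarrow> nat \<Rightarrow> real. \<forall>i<m. \<forall>j<m. G i j = (\<Sum>l<m. v l i * v l j)"
    using assms
  proof (induction m arbitrary: G)
    case 0
    then show ?case by simp
  next
    case (Suc m)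
    then have sym: "symmat (Suc m) G" by (simp add: psd_def)
    have q: "0 \<le> (\<Sum>i<m. \<Sum>j<m. v i * G i j * v j) + 2 * t * (\<Sum>i<m. v i * G i m) + t\<^sup>2 * G m m" for v t
    proof -
      have "0 \<le> (\<Sum>i<Suc m. \<Sum>j<Suc m. (v(m := t)) i * G i j * (v(m := t)) j)"
        using Suc.prems unfolding psd_def by blast
      then show ?thesis unfolding quad_Suc[OF sym] by simp
    qed
    have diag: "0 \<le> G m m" using q[of "\<lambda>_. 0" 1] by simp
    show ?case
    proof (cases "G m m = 0")
      case True
      have zero: "G i m = 0" if "i < m" for i
      proof -
        have "(\<Sum>k<m. (if k = i then 1 else 0) * G k m) = G i m"
          using that by (simp add: if_distrib[of "\<lambda>x. x * _"] cong: if_cong)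
        then have "0 \<le> (\<Sum>k<m. \<Sum>j<m. (if k = i then 1 else 0) * G k j * (if j = i then 1 else 0)) + t * (2 * G i m)" for t
          using q[of "\<lambda>k. if k = i then 1 else 0" t] True by (simp add: algebra_simps)
        from linear_nonneg_imp_zero[OF this] show ?thesis by simp
      qed
      have "psd m G"
        using q[of _ 0] sym by (simp add: psd_def symmat_def)
      then obtain v :: "nat \<Rightarrow> nat \<Rightarrow> real" where v: "\<And>i j. i < m \<Longrightarrow> j < m \<Longrightarrow> G i j = (\<Sum>l<m. v l i * v l j)"
        using Suc.IH by metis
      show ?thesis
      proof (intro exI allI impI)
        fix i j assume "i < Suc m" "j < Suc m"
        then show "G i j = (\<Sum>l<Suc m. (if l < m \<and> i < m then v l i else 0) * (if l < m \<and> j < m then v l j else 0))"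
          using v zero True sym unfolding symmat_def by (cases "i < m"; cases "j < m") (simp_all add: less_Suc_eq)
      qed
    next
      case False
      with diag have pos: "0 < G m m" by simp
      \<comment> \<open>The Schur complement: its quadratic form is the minimum of that of \<open>G\<close> over the last coordinate.\<close>
      define H where "H i j = G i j - G i m * G j m / G m m" for i j
      have "psd m H"
        unfolding psd_def
      proof (intro conjI allI)
        show "symmat m H" using sym by (auto simp: symmat_def H_def)
        fix v :: "nat \<Rightarrow> real"
        let ?L = "\<Sum>i<m. v i * G i m"
        have "(\<Sum>i<m. \<Sum>j<m. v i * (G i m * G j m / G m m) * v j) = ?L * ?L / G m m"
          unfolding sum_product sum_divide_distrib by (intro sum.cong refl) (simp add: algebra_simps)
        then have "(\<Sum>i<m. \<Sum>j<m. v i * H i j * v j) = (\<Sum>i<m. \<Sum>j<m. v i * G i j * v j) - ?L * ?L / G m m"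
          unfolding H_def by (simp add: left_diff_distrib right_diff_distrib sum_subtractf)
        moreover have "2 * (- ?L / G m m) * ?L + (- ?L / G m m)\<^sup>2 * G m m = - (?L * ?L / G m m)"
          using pos by (simp add: power2_eq_square field_simps)
        ultimately show "0 \<le> (\<Sum>i<m. \<Sum>j<m. v i * H i j * v j)"
          using q[of v "- ?L / G m m"] by linarith
      qed
      then obtain v :: "nat \<Rightarrow> nat \<Rightarrow> real" where v: "\<And>i j. i < m \<Longrightarrow> j < m \<Longrightarrow> H i j = (\<Sum>l<m. v l i * v l j)"
        using Suc.IH by metis
      define w where "w l i = (if l < m then (if i < m then v l i else 0) else G i m / sqrt (G m m))" for l i
      have sq: "sqrt (G m m) * sqrt (G m m) = G m m" using pos by simp
      show ?thesis
      proof (intro exI[of _ w] allI impI)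
        fix i j assume ij: "i < Suc m" "j < Suc m"
        have last: "w m i * w m j = G i m * G j m / G m m"
          unfolding w_def using sq by (simp add: field_simps)
        show "G i j = (\<Sum>l<Suc m. w l i * w l j)"
        proof (cases "i < m \<and> j < m")
          case True
          then have "(\<Sum>l<m. w l i * w l j) = H i j"
            using v by (simp add: w_def)
          then show ?thesis using last by (simp add: H_def)
        next
          case False
          then have "(\<Sum>l<m. w l i * w l j) = 0"
            by (intro sum.neutral) (auto simp: w_def)
          moreover have "G i j = G i m * G j m / G m m"
          proof (cases "j = m")
            case True
            then show ?thesis using pos by simp
          next
            case False
            with \<open>\<not> (i < m \<and> j < m)\<close> ij have "i = m" by simp
            moreover have "G m j = G j m" using sym ij by (simp add: symmat_def)
            ultimately show ?thesis using pos by simp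
          qed
          ultimately show ?thesis using last by simp
        qed
      qed
    qed
  qed
  then show ?thesis using that by blast
qed

lemma psd_rank_one: "0 \<le> c \<Longrightarrow> psd m (\<lambda>i j. c * (v i * v j))"
proof -
  assume c: "0 \<le> c"
  have "(\<Sum>i<m. \<Sum>j<m. w i * (c * (v i * v j)) * w j) = c * (\<Sum>i<m. w i * v i)\<^sup>2" for w
    unfolding power2_eq_square sum_product unfolding sum_distrib_left
    by (intro sum.cong refl) (simp add: algebra_simps)
  then show ?thesis using c by (simp add: psd_def symmat_def)
qed

lemma psd_diag_nonneg:
  assumes "psd m G" "i < m" shows "0 \<le> G i i"
proof -
  obtain v :: "nat \<Rightarrow> nat \<Rightarrow> real" where "\<And>i j. i < m \<Longrightarrow> j < m \<Longrightarrow> G i j = (\<Sum>l<m. v l i * v l j)"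
    using psd_sum_of_squares[OF assms(1)] by blast
  then show ?thesis using assms(2) by (simp add: sum_nonneg)
qed

text \<open>This bound is what makes the body of matrices of trace at most one compact.\<close>

lemma psd_entry_le_trace:
  assumes G: "psd m G" and ij: "i < m" "j < m"
  shows "\<bar>G i j\<bar> \<le> (\<Sum>i<m. G i i)"
proof -
  obtain v :: "nat \<Rightarrow> nat \<Rightarrow> real" where v: "\<And>i j. i < m \<Longrightarrow> j < m \<Longrightarrow> G i j = (\<Sum>l<m. v l i * v l j)"
    using psd_sum_of_squares[OF G] by blast
  have le: "G k k \<le> (\<Sum>i<m. G i i)" if "k < m" for k
    using that psd_diag_nonneg[OF G] by (intro member_le_sum) auto
  have "\<bar>G i j\<bar> \<le> (\<Sum>l<m. \<bar>v l i * v l j\<bar>)" using v ij by simp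
  also have "\<dots> \<le> (\<Sum>l<m. (v l i * v l i + v l j * v l j) / 2)"
  proof (rule sum_mono)
    fix l
    show "\<bar>v l i * v l j\<bar> \<le> (v l i * v l i + v l j * v l j) / 2"
      using zero_le_square[of "v l i - v l j"] zero_le_square[of "v l i + v l j"]
      by (simp add: abs_le_iff algebra_simps)
  qed
  also have "\<dots> = (G i i + G j j) / 2"
    using v ij by (simp add: sum.distrib sum_divide_distrib[symmetric])
  also have "\<dots> \<le> (\<Sum>i<m. G i i)" using le[OF ij(1)] le[OF ij(2)] by simp
  finally show ?thesis .
qed

text \<open>A linear matrix inequality in \<open>x\<close> and in the first \<open>k\<close> entries of the auxiliary \<open>y\<close>.
  Keeping the auxiliary variables unquantified makes conjunctions block diagonal.\<close>

definition lmi :: "nat \<Rightarrow> ('e::euclidean_space \<Rightarrow> (nat \<Rightarrow> real) \<Rightarrow> bool) \<Rightarrow> bool" where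
  "lmi k P \<longleftrightarrow> (\<exists>m M0 M N. symmat m M0 \<and> (\<forall>b\<in>Basis. symmat m (M b)) \<and> (\<forall>l<k. symmat m (N l)) \<and>
     (\<forall>x y. P x y \<longleftrightarrow>
       psd m (\<lambda>i j. M0 i j + (\<Sum>b\<in>Basis. (x \<bullet> b) * M b i j) + (\<Sum>l<k. y l * N l i j))))"

lemma SDR_in_lmi:
  assumes "lmi k P" shows "SDR_in E {x \<in> E. \<exists>y. P x y}"
proof -
  obtain m M0 M N where sym: "symmat m M0" "\<forall>b\<in>Basis. symmat m (M b)" "\<forall>l<k. symmat m (N l)"
    and P: "\<And>x y. P x y \<longleftrightarrow> psd m (\<lambda>i j. M0 i j + (\<Sum>b\<in>Basis. (x \<bullet> b) * M b i j) + (\<Sum>l<k. y l * N l i j))"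
    using assms unfolding lmi_def by blast
  have "P = (\<lambda>x y. psd m (\<lambda>i j. M0 i j + (\<Sum>b\<in>Basis. (x \<bullet> b) * M b i j) + (\<Sum>l<k. y l * N l i j)))"
    using P by blast
  with sym show ?thesis
    unfolding SDR_in_def
    by - (rule exI[of _ m], rule exI[of _ k], rule exI[of _ M0], rule exI[of _ M], rule exI[of _ N], simp)
qed

lemma lmi_True: "lmi k (\<lambda>x y. True)"
  unfolding lmi_def
  by (rule exI[of _ 0]) (simp add: psd_def symmat_def)

lemma lmi_conj:
  assumes "lmi k P" "lmi k Q" shows "lmi k (\<lambda>x y. P x y \<and> Q x y)"
proof -
  obtain m M0 M N where P: "symmat m M0" "\<forall>b\<in>Basis. symmat m (M b)" "\<forall>l<k. symmat m (N l)"
     "\<And>x y. P x y \<longleftrightarrow> psd m (\<lambda>i j. M0 i j + (\<Sum>b\<in>Basis. (x \<bullet> b) * M b i j) + (\<Sum>l<k. y l * N l i j))"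
    using assms(1) unfolding lmi_def by blast
  obtain m' M0' M' N' where Q: "symmat m' M0'" "\<forall>b\<in>Basis. symmat m' (M' b)" "\<forall>l<k. symmat m' (N' l)"
     "\<And>x y. Q x y \<longleftrightarrow> psd m' (\<lambda>i j. M0' i j + (\<Sum>b\<in>Basis. (x \<bullet> b) * M' b i j) + (\<Sum>l<k. y l * N' l i j))"
    using assms(2) unfolding lmi_def by blast
  show ?thesis
    unfolding lmi_def
  proof (intro exI conjI ballI allI impI)
    show "symmat (m + m') (blockdiag m M0 M0')" using P Q by (intro symmat_blockdiag)
    show "symmat (m + m') (blockdiag m (M b) (M' b))" if "b \<in> Basis" for b
      using P Q that by (intro symmat_blockdiag) auto
    show "symmat (m + m') (blockdiag m (N l) (N' l))" if "l < k" for l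
      using P Q that by (intro symmat_blockdiag) auto
    fix x :: 'a and y :: "nat \<Rightarrow> real"
    have eq: "(\<lambda>i j. blockdiag m M0 M0' i j + (\<Sum>b\<in>Basis. (x \<bullet> b) * blockdiag m (M b) (M' b) i j) +
            (\<Sum>l<k. y l * blockdiag m (N l) (N' l) i j)) =
        blockdiag m (\<lambda>i j. M0 i j + (\<Sum>b\<in>Basis. (x \<bullet> b) * M b i j) + (\<Sum>l<k. y l * N l i j))
          (\<lambda>i j. M0' i j + (\<Sum>b\<in>Basis. (x \<bullet> b) * M' b i j) + (\<Sum>l<k. y l * N' l i j))"
      by (intro ext) (auto simp: blockdiag_def)
    show "(P x y \<and> Q x y) =
      psd (m + m') (\<lambda>i j. blockdiag m M0 M0' i j + (\<Sum>b\<in>Basis. (x \<bullet> b) * blockdiag m (M b) (M' b) i j) +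
            (\<Sum>l<k. y l * blockdiag m (N l) (N' l) i j))"
      unfolding eq psd_blockdiag P(4) Q(4) ..
  qed
qed

lemma lmi_ball:
  assumes "finite I" "\<And>a. a \<in> I \<Longrightarrow> lmi k (P a)"
  shows "lmi k (\<lambda>x y. \<forall>a\<in>I. P a x y)"
  using assms
proof (induction I rule: finite_induct)
  case empty
  then show ?case using lmi_True by simp
next
  case (insert a I)
  then have "lmi k (\<lambda>x y. P a x y \<and> (\<forall>a\<in>I. P a x y))"
    by (intro lmi_conj) auto
  then show ?case by simp
qed

lemma lmi_affine_nonneg: "lmi k (\<lambda>x y. 0 \<le> c + w \<bullet> x + (\<Sum>l<k. d l * y l))"
  unfolding lmi_def
proof (intro exI conjI ballI allI impI)
  fix x :: 'a and y :: "nat \<Rightarrow> real"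
  have "(\<Sum>b\<in>Basis. (x \<bullet> b) * (w \<bullet> b)) = w \<bullet> x"
    by (subst euclidean_inner[of w x]) (simp add: mult.commute)
  moreover have "psd 1 (\<lambda>i j. a) \<longleftrightarrow> 0 \<le> a" for a
  proof -
    have "0 \<le> a \<Longrightarrow> 0 \<le> t * a * t" for t :: real
      by (metis mult.assoc mult.commute mult_nonneg_nonneg zero_le_square)
    then show ?thesis
      using spec[of "\<lambda>v. 0 \<le> v 0 * a * v 0" "\<lambda>_. 1"] by (auto simp: psd_def symmat_def)
  qed
  ultimately show "(0 \<le> c + w \<bullet> x + (\<Sum>l<k. d l * y l)) =
      psd 1 (\<lambda>i j. c + (\<Sum>b\<in>Basis. (x \<bullet> b) * (w \<bullet> b)) + (\<Sum>l<k. y l * d l))"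
    by (simp add: mult.commute)
qed (auto simp: symmat_def)

text \<open>Halfspaces are linear matrix inequalities of size one.\<close>

lemma SDR_in_polyhedron:
  fixes X :: "'e::euclidean_space set"
  assumes "polyhedron X" "X \<subseteq> E" shows "SDR_in E X"
proof -
  obtain F where F: "finite F" "X = \<Inter>F" "\<forall>h\<in>F. \<exists>a b. a \<noteq> 0 \<and> h = {x. a \<bullet> x \<le> b}"
    using assms(1) unfolding polyhedron_def by blast
  then obtain a b where ab: "\<And>h. h \<in> F \<Longrightarrow> h = {x. a h \<bullet> x \<le> b h}" by metis
  have "lmi 0 (\<lambda>x y. \<forall>h\<in>F. 0 \<le> b h + (- a h) \<bullet> x + (\<Sum>l<0. 0 * y l))"
    by (intro lmi_ball F(1) lmi_affine_nonneg)
  then have "SDR_in E {x \<in> E. \<exists>y::nat \<Rightarrow> real. \<forall>h\<in>F. 0 \<le> b h + (- a h) \<bullet> x + (\<Sum>l<0. 0 * y l)}"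
    by (rule SDR_in_lmi)
  moreover have "{x \<in> E. \<exists>y::nat \<Rightarrow> real. \<forall>h\<in>F. 0 \<le> b h + (- a h) \<bullet> x + (\<Sum>l<0. 0 * y l)} = X"
    using assms(2) F(2) ab by auto
  ultimately show ?thesis by simp
qed

section \<open>Spectrahedra given by a Gram matrix\<close>

definition gram_spectrahedron :: "'e::euclidean_space set \<Rightarrow> nat \<Rightarrow> (nat \<Rightarrow> nat \<Rightarrow> 'e) \<Rightarrow> 'e set" where
  "gram_spectrahedron E r V = {u \<in> E. psd r (\<lambda>i j. (if i = j then 1 else 0) + u \<bullet> V i j)}"

text \<open>The polar of \<open>gram_spectrahedron\<close>; the trace bound is dual to the identity matrix there.\<close>

definition gram_body :: "nat \<Rightarrow> (nat \<Rightarrow> nat \<Rightarrow> 'e::euclidean_space) \<Rightarrow> 'e set" where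
  "gram_body r V = {\<Sum>i<r. \<Sum>j<r. G i j *\<^sub>R V i j | G. psd r G \<and> (\<Sum>i<r. G i i) \<le> 1}"

lemma gram_bodyI:
  "psd r G \<Longrightarrow> (\<Sum>i<r. G i i) \<le> 1 \<Longrightarrow> (\<Sum>i<r. \<Sum>j<r. G i j *\<^sub>R V i j) \<in> gram_body r V"
  unfolding gram_body_def by (rule CollectI, rule exI[of _ G]) simp

lemma spectrahedron_in_gram:
  assumes "\<And>i j. V i j = V j i"
  shows "spectrahedron_in E (gram_spectrahedron E r V)"
  unfolding spectrahedron_in_def
proof (intro exI conjI ballI)
  show "symmat r (\<lambda>i j. if i = j then 1 else 0)" by (auto simp: symmat_def)
  show "symmat r (\<lambda>i j. V i j \<bullet> b)" for b using assms by (simp add: symmat_def)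
  have "(\<Sum>b\<in>Basis. (x \<bullet> b) * (V i j \<bullet> b)) = x \<bullet> V i j" for x :: 'a and i j
    by (subst euclidean_inner[of x]) simp
  then show "gram_spectrahedron E r V =
      {x \<in> E. psd r (\<lambda>i j. (if i = j then 1 else 0) + (\<Sum>b\<in>Basis. (x \<bullet> b) * (V i j \<bullet> b)))}"
    by (simp add: gram_spectrahedron_def)
qed

text \<open>Both inclusions rest on writing a positive semidefinite \<open>G\<close> as a sum of rank one matrices:
  pairing \<open>u\<close> with the point of \<open>G = v v\<^sup>T\<close> gives the quadratic form of \<open>u \<bullet> V\<close> at \<open>v\<close>,
  while the identity matrix contributes the trace of \<open>G\<close>.\<close>

lemma polar_in_gram_body:
  assumes sym: "\<And>i j. V i j = V j i"
  shows "polar_in E (gram_body r V) = gram_spectrahedron E r V"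
proof -
  have "(\<forall>x\<in>gram_body r V. u \<bullet> x \<ge> -1) \<longleftrightarrow> psd r (\<lambda>i j. (if i = j then 1 else 0) + u \<bullet> V i j)" for u
  proof -
    have quad: "(\<Sum>i<r. \<Sum>j<r. v i * ((if i = j then 1 else 0) + u \<bullet> V i j) * v j) =
        (\<Sum>i<r. v i * v i) + (\<Sum>i<r. \<Sum>j<r. v i * v j * (u \<bullet> V i j))" for v :: "nat \<Rightarrow> real"
    proof -
      have "(\<Sum>j<r. v i * ((if i = j then 1 else 0) + u \<bullet> V i j) * v j) =
          v i * v i + (\<Sum>j<r. v i * v j * (u \<bullet> V i j))" if "i < r" for i
      proof -
        have "(\<Sum>j<r. v i * ((if i = j then 1 else 0) + u \<bullet> V i j) * v j) =
            (\<Sum>j<r. (if i = j then v i * v i else 0) + v i * v j * (u \<bullet> V i j))"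
          by (intro sum.cong refl) (auto simp: algebra_simps)
        then show ?thesis using that by (simp add: sum.distrib)
      qed
      then show ?thesis by (simp add: sum.distrib)
    qed
    show ?thesis
    proof
      assume u: "\<forall>x\<in>gram_body r V. u \<bullet> x \<ge> -1"
      show "psd r (\<lambda>i j. (if i = j then 1 else 0) + u \<bullet> V i j)"
        unfolding psd_def quad
      proof (intro conjI allI)
        show "symmat r (\<lambda>i j. (if i = j then 1 else 0) + u \<bullet> V i j)"
          using sym by (auto simp: symmat_def)
        fix v :: "nat \<Rightarrow> real"
        let ?s = "\<Sum>i<r. v i * v i"
        show "0 \<le> ?s + (\<Sum>i<r. \<Sum>j<r. v i * v j * (u \<bullet> V i j))"
        proof (cases "?s = 0")
          case True
          then have "v i * v i = 0" if "i < r" for i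
            using that by (subst (asm) sum_nonneg_eq_0_iff) auto
          then show ?thesis using True by simp
        next
          case False
          then have s: "0 < ?s"
            using sum_nonneg[of "{..<r}" "\<lambda>i. v i * v i"] by (simp add: less_le)
          let ?G = "\<lambda>i j. (1 / ?s) * (v i * v j)"
          have "psd r ?G" using s by (intro psd_rank_one) simp
          moreover have "(\<Sum>i<r. ?G i i) \<le> 1"
            unfolding sum_distrib_left[symmetric] using s by (simp only: times_divide_eq_left) simp
          ultimately have "(\<Sum>i<r. \<Sum>j<r. ?G i j *\<^sub>R V i j) \<in> gram_body r V"
            by (rule gram_bodyI)
          then have "-1 \<le> u \<bullet> (\<Sum>i<r. \<Sum>j<r. ?G i j *\<^sub>R V i j)" using u by blast
          also have "\<dots> = (1 / ?s) * (\<Sum>i<r. \<Sum>j<r. v i * v j * (u \<bullet> V i j))"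
            unfolding inner_sum_right sum_distrib_left inner_scaleR_right by (simp only: mult.assoc)
          finally have "-1 \<le> (1 / ?s) * (\<Sum>i<r. \<Sum>j<r. v i * v j * (u \<bullet> V i j))" .
          moreover have "0 \<le> s + X" if "0 < s" "-1 \<le> (1 / s) * X" for s X :: real
            using that by (simp add: field_simps)
          ultimately show ?thesis using s by blast
        qed
      qed
    next
      assume p: "psd r (\<lambda>i j. (if i = j then 1 else 0) + u \<bullet> V i j)"
      show "\<forall>x\<in>gram_body r V. u \<bullet> x \<ge> -1"
      proof
        fix x assume "x \<in> gram_body r V"
        then obtain G where G: "psd r G" "(\<Sum>i<r. G i i) \<le> 1" "x = (\<Sum>i<r. \<Sum>j<r. G i j *\<^sub>R V i j)"
          unfolding gram_body_def by blast
        obtain v :: "nat \<Rightarrow> nat \<Rightarrow> real" where v: "\<And>i j. i < r \<Longrightarrow> j < r \<Longrightarrow> G i j = (\<Sum>l<r. v l i * v l j)"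
          using psd_sum_of_squares[OF G(1)] by blast
        have tr: "(\<Sum>i<r. G i i) = (\<Sum>l<r. \<Sum>i<r. v l i * v l i)"
          by (subst sum.swap) (simp add: v)
        have "u \<bullet> x = (\<Sum>i<r. \<Sum>j<r. \<Sum>l<r. v l i * v l j * (u \<bullet> V i j))"
          unfolding G(3) using v by (simp add: inner_sum_right sum_distrib_right)
        also have "\<dots> = (\<Sum>l<r. \<Sum>i<r. \<Sum>j<r. v l i * v l j * (u \<bullet> V i j))"
          by (subst sum.swap, subst sum.swap) (intro sum.cong refl sum.swap)
        finally have "(\<Sum>i<r. G i i) + u \<bullet> x =
            (\<Sum>l<r. (\<Sum>i<r. v l i * v l i) + (\<Sum>i<r. \<Sum>j<r. v l i * v l j * (u \<bullet> V i j)))"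
          unfolding tr by (simp add: sum.distrib)
        also have "\<dots> \<ge> 0"
          using p unfolding psd_def quad by (intro sum_nonneg) blast
        finally show "u \<bullet> x \<ge> -1" using G(2) by linarith
      qed
    qed
  qed
  then show ?thesis
    by (simp add: polar_in_def gram_spectrahedron_def)
qed

lemma gram_body_subset:
  assumes "subspace E" "\<And>i j. V i j \<in> E" shows "gram_body r V \<subseteq> E"
  unfolding gram_body_def using assms by (auto intro!: subspace_sum subspace_scale)

lemma zero_in_gram_body: "0 \<in> gram_body r V"
proof -
  have "psd r (\<lambda>i j. 0)" by (simp add: psd_def symmat_def)
  then show ?thesis unfolding gram_body_def
    by (intro CollectI exI[of _ "\<lambda>i j. 0"]) simp
qed

lemma psd_convex_combination:
  assumes "psd m A" "psd m B" "0 \<le> a" "0 \<le> b"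
  shows "psd m (\<lambda>i j. a * A i j + b * B i j)"
proof -
  have "(\<Sum>i<m. \<Sum>j<m. v i * (a * A i j + b * B i j) * v j) =
     a * (\<Sum>i<m. \<Sum>j<m. v i * A i j * v j) + b * (\<Sum>i<m. \<Sum>j<m. v i * B i j * v j)" for v
    unfolding sum_distrib_left sum.distrib[symmetric] by (intro sum.cong refl) (simp add: algebra_simps)
  then show ?thesis using assms by (auto simp: psd_def symmat_def)
qed

lemma convex_gram_body: "convex (gram_body r V)"
  unfolding convex_def
proof (intro ballI allI impI)
  fix x y and a b :: real
  assume "x \<in> gram_body r V" "y \<in> gram_body r V" and ab: "0 \<le> a" "0 \<le> b" "a + b = 1"
  then obtain G H where G: "psd r G" "(\<Sum>i<r. G i i) \<le> 1" "x = (\<Sum>i<r. \<Sum>j<r. G i j *\<^sub>R V i j)"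
    and H: "psd r H" "(\<Sum>i<r. H i i) \<le> 1" "y = (\<Sum>i<r. \<Sum>j<r. H i j *\<^sub>R V i j)"
    unfolding gram_body_def by blast
  let ?F = "\<lambda>i j. a * G i j + b * H i j"
  have "psd r ?F" using psd_convex_combination G(1) H(1) ab by blast
  moreover have "(\<Sum>i<r. ?F i i) \<le> 1"
    using convex_bound_le[OF G(2) H(2) ab] by (simp add: sum.distrib sum_distrib_left)
  moreover have "a *\<^sub>R x + b *\<^sub>R y = (\<Sum>i<r. \<Sum>j<r. ?F i j *\<^sub>R V i j)"
    unfolding G(3) H(3) by (simp add: scaleR_sum_right sum.distrib scaleR_left_distrib)
  ultimately show "a *\<^sub>R x + b *\<^sub>R y \<in> gram_body r V"
    using gram_bodyI[of r ?F V] by simp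
qed

text \<open>Positive semidefinite matrices of trace at most one have entries in \<open>[-1, 1]\<close>, so the body
  is a continuous image of a closed subset of a compact box.\<close>

lemma compact_gram_body: "compact (gram_body r V)"
proof -
  let ?P = "Pi\<^sub>E (UNIV::(nat \<times> nat) set) (\<lambda>_. {-1..1::real})"
  let ?C = "?P \<inter> {g. psd r (\<lambda>i j. g (i, j)) \<and> (\<Sum>i<r. g (i, i)) \<le> 1}"
  let ?F = "\<lambda>g. \<Sum>i<r. \<Sum>j<r. g (i, j) *\<^sub>R V i j"
  have coord: "continuous_on UNIV (\<lambda>g::nat \<times> nat \<Rightarrow> real. g p)" for p
    by (rule continuous_on_product_coordinates)
  have "compactin (product_topology (\<lambda>_. euclidean) UNIV) ?P"
    by (simp add: compactin_PiE)
  then have "compact ?P"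
    by (simp add: euclidean_product_topology)
  moreover have "closed {g::nat \<times> nat \<Rightarrow> real. psd r (\<lambda>i j. g (i, j)) \<and> (\<Sum>i<r. g (i, i)) \<le> 1}"
  proof -
    have "{g::nat \<times> nat \<Rightarrow> real. psd r (\<lambda>i j. g (i, j)) \<and> (\<Sum>i<r. g (i, i)) \<le> 1} =
       (\<Inter>i\<in>{..<r}. \<Inter>j\<in>{..<r}. {g. g (i, j) = g (j, i)}) \<inter>
       (\<Inter>v. {g. 0 \<le> (\<Sum>i<r. \<Sum>j<r. v i * g (i, j) * v j)}) \<inter> {g. (\<Sum>i<r. g (i, i)) \<le> 1}"
      by (auto simp: psd_def symmat_def)
    also have "closed \<dots>"
      by (intro closed_Int closed_INT ballI closed_Collect_le closed_Collect_eq continuous_intros coord)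
    finally show ?thesis .
  qed
  ultimately have "compact ?C" by (rule compact_Int_closed)
  moreover have "continuous_on ?C ?F"
    by (intro continuous_intros continuous_on_subset[OF coord]) auto
  ultimately have "compact (?F ` ?C)" by (intro compact_continuous_image)
  moreover have "?F ` ?C = gram_body r V"
  proof
    show "?F ` ?C \<subseteq> gram_body r V"
      by (auto intro: gram_bodyI)
    show "gram_body r V \<subseteq> ?F ` ?C"
    proof
      fix x assume "x \<in> gram_body r V"
      then obtain G where G: "psd r G" "(\<Sum>i<r. G i i) \<le> 1" "x = (\<Sum>i<r. \<Sum>j<r. G i j *\<^sub>R V i j)"
        unfolding gram_body_def by blast
      let ?g = "\<lambda>(i, j). if i < r \<and> j < r then G i j else 0"
      have "psd r (\<lambda>i j. ?g (i, j))"
        using G(1) by (subst psd_cong[of r _ G]) auto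
      moreover have "(\<Sum>i<r. ?g (i, i)) \<le> 1" using G(2) by simp
      moreover have "?g \<in> ?P"
      proof -
        have "\<bar>G i j\<bar> \<le> 1" if "i < r" "j < r" for i j
          using psd_entry_le_trace[OF G(1) that] G(2) by linarith
        then show ?thesis by (auto simp: abs_le_iff minus_le_iff)
      qed
      moreover have "x = ?F ?g" unfolding G(3) by simp
      ultimately show "x \<in> ?F ` ?C" by blast
    qed
  qed
  ultimately show ?thesis by simp
qed

text \<open>The entries of the Gram matrix are the auxiliary variables. Splitting each of them into
  \<open>y (i * r + j) + y (j * r + i)\<close> makes the matrix symmetric for all values of \<open>y\<close>, as a linear
  matrix inequality requires.\<close>

lemma SDR_in_gram_body:
  assumes E: "subspace E" and V: "\<And>i j. V i j \<in> E" and sym: "\<And>i j. V i j = V j i"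
  shows "SDR_in E (gram_body r V)"
proof -
  \<comment> \<open>The auxiliary variable \<open>y (i * r + j)\<close> holds half of the entry \<open>(i, j)\<close> of the Gram matrix.\<close>
  define S where "S y = (\<lambda>i j. y (i * r + j) + y (j * r + i))" for y :: "nat \<Rightarrow> real"
  let ?X = "{x \<in> E. \<exists>y. psd r (S y) \<and> (\<Sum>i<r. S y i i) \<le> 1 \<and> x = (\<Sum>i<r. \<Sum>j<r. S y i j *\<^sub>R V i j)}"
  let ?e = "\<lambda>i j l. ((if l = i * r + j then 1 else 0) + (if l = j * r + i then 1 else 0)) :: real"
  define d where "d c l = (\<Sum>i<r. \<Sum>j<r. c i j * ?e i j l)"
    for c :: "nat \<Rightarrow> nat \<Rightarrow> real" and l
  have idx: "i * r + j < r * r" if "i < r" "j < r" for i j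
  proof -
    have "i * r + j < Suc i * r" using that by simp
    also have "\<dots> \<le> r * r" using that by (intro mult_le_mono1) simp
    finally show ?thesis .
  qed
  have pick: "(\<Sum>l<r*r. ?e i j l * y l) = S y i j"
    if "i < r" "j < r" for i j and y :: "nat \<Rightarrow> real"
    using idx[OF that] idx[OF that(2,1)]
    by (simp add: distrib_right sum.distrib S_def if_distrib[of "\<lambda>x. x * _"] cong: if_cong)
  have lin: "(\<Sum>l<r*r. d c l * y l) = (\<Sum>i<r. \<Sum>j<r. c i j * S y i j)" for c y
  proof -
    have "(\<Sum>l<r*r. d c l * y l) = (\<Sum>l<r*r. \<Sum>i<r. \<Sum>j<r. c i j *
        (?e i j l * y l))"
      unfolding d_def sum_distrib_right by (simp add: mult.assoc)
    also have "\<dots> = (\<Sum>i<r. \<Sum>j<r. \<Sum>l<r*r. c i j *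
        (?e i j l * y l))"
      by (simp only: sum.swap[of _ "{..<r*r}" "{..<r}"])
    also have "\<dots> = (\<Sum>i<r. \<Sum>j<r. c i j * S y i j)"
      unfolding sum_distrib_left[symmetric] using pick by simp
    finally show ?thesis .
  qed
  have psd: "lmi (r*r) (\<lambda>(x::'a) y. psd r (S y))"
    unfolding lmi_def
  proof (intro exI conjI ballI allI impI)
    show "symmat r (\<lambda>i j. 0)" "symmat r (\<lambda>i j. 0)" by (simp_all add: symmat_def)
    show "symmat r (\<lambda>i j. ?e i j l)" for l
      by (simp add: symmat_def)
    show "psd r (S y) = psd r (\<lambda>i j. 0 + (\<Sum>b\<in>Basis. (x \<bullet> b) * 0) +
       (\<Sum>l<r*r. y l * ?e i j l))"
      for x :: 'a and y :: "nat \<Rightarrow> real"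
      using pick by (intro psd_cong) (simp add: mult.commute)
  qed
  define P where "P = (\<lambda>(x::'a) y. psd r (S y) \<and>
      0 \<le> 1 + 0 \<bullet> x + (\<Sum>l<r*r. - d (\<lambda>i j. if i = j then 1 else 0) l * y l) \<and>
      (\<forall>b\<in>Basis. 0 \<le> 0 + b \<bullet> x + (\<Sum>l<r*r. - d (\<lambda>i j. V i j \<bullet> b) l * y l)) \<and>
      (\<forall>b\<in>Basis. 0 \<le> 0 + (- b) \<bullet> x + (\<Sum>l<r*r. d (\<lambda>i j. V i j \<bullet> b) l * y l)))"
  have "lmi (r*r) P"
    unfolding P_def by (intro lmi_conj psd lmi_ball lmi_affine_nonneg finite_Basis)
  then have "SDR_in E {x \<in> E. \<exists>y. P x y}" by (rule SDR_in_lmi)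
  moreover have "P x y \<longleftrightarrow> psd r (S y) \<and> (\<Sum>i<r. S y i i) \<le> 1 \<and> x = (\<Sum>i<r. \<Sum>j<r. S y i j *\<^sub>R V i j)" for x y
  proof -
    have tr: "(\<Sum>i<r. \<Sum>j<r. (if i = j then 1 else 0) * S y i j) = (\<Sum>i<r. S y i i)"
      by (intro sum.cong refl) (simp add: if_distrib[of "\<lambda>x. x * _"] cong: if_cong)
    have co: "(\<Sum>i<r. \<Sum>j<r. (V i j \<bullet> b) * S y i j) = (\<Sum>i<r. \<Sum>j<r. S y i j *\<^sub>R V i j) \<bullet> b" for b
      by (simp add: inner_sum_left mult.commute)
    show ?thesis
      unfolding P_def euclidean_eq_iff[of x] minus_mult_left[symmetric] sum_negf lin tr co
      by (auto simp: inner_commute intro: antisym)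
  qed
  ultimately have "SDR_in E ?X"
    by simp
  moreover have "?X = gram_body r V"
  proof
    show "gram_body r V \<subseteq> ?X"
    proof
      fix x assume x: "x \<in> gram_body r V"
      then obtain G where G: "psd r G" "(\<Sum>i<r. G i i) \<le> 1" "x = (\<Sum>i<r. \<Sum>j<r. G i j *\<^sub>R V i j)"
        unfolding gram_body_def by blast
      define y where "y l = G (l div r) (l mod r) / 2" for l
      have S: "S y i j = G i j" if "i < r" "j < r" for i j
        using that G(1) by (simp add: S_def y_def psd_def symmat_def)
      have "psd r (S y)" using G(1) S by (subst psd_cong[of r _ G]) auto
      moreover have "x \<in> E" using gram_body_subset[of E V r] E V x by blast
      ultimately show "x \<in> ?X"
        using G S by (auto intro!: exI[of _ y])
    qed
  qed (auto intro: gram_bodyI)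
  ultimately show ?thesis by simp
qed

section \<open>Polynomials\<close>

definition monomial_of :: "('x::euclidean_space \<Rightarrow> nat) \<Rightarrow> 'x \<Rightarrow> real" where
  "monomial_of \<alpha> x = (\<Prod>b\<in>Basis. (x \<bullet> b) ^ \<alpha> b)"

lemma polynomials_upto_alt:
  "polynomials_upto k = {a. \<exists>c. a = (\<lambda>x. \<Sum>\<alpha>\<in>exponents k. c \<alpha> * monomial_of \<alpha> x)}"
  by (simp add: polynomials_upto_def monomial_of_def)

lemma polynomials_uptoI:
  "a = (\<lambda>x. \<Sum>\<alpha>\<in>exponents k. c \<alpha> * monomial_of \<alpha> x) \<Longrightarrow> a \<in> polynomials_upto k"
  unfolding polynomials_upto_alt mem_Collect_eq by (rule exI[of _ c])

lemma polynomials_uptoE: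
  assumes "a \<in> polynomials_upto k"
  obtains c where "a = (\<lambda>x. \<Sum>\<alpha>\<in>exponents k. c \<alpha> * monomial_of \<alpha> x)"
  using assms unfolding polynomials_upto_alt mem_Collect_eq by (elim exE)

lemma finite_exponents: "finite (exponents k :: ('x::euclidean_space \<Rightarrow> nat) set)"
  unfolding exponents_def by (rule finite_subset[of _ "Basis \<rightarrow>\<^sub>E {..k}"]) (auto intro: finite_PiE)

lemma exponents_mono: "k \<le> l \<Longrightarrow> exponents k \<subseteq> exponents l"
  unfolding exponents_def by (auto simp: PiE_def Pi_def)

lemma polynomials_upto_mono:
  assumes "k \<le> l" shows "polynomials_upto k \<subseteq> polynomials_upto l"
proof
  fix a :: "'a \<Rightarrow> real" assume "a \<in> polynomials_upto k"
  then obtain c where c: "a = (\<lambda>x. \<Sum>\<alpha>\<in>exponents k. c \<alpha> * monomial_of \<alpha> x)"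
    by (rule polynomials_uptoE)
  have "a x = (\<Sum>\<alpha>\<in>exponents l. (if \<alpha> \<in> exponents k then c \<alpha> else 0) * monomial_of \<alpha> x)" for x
  proof -
    have "(\<Sum>\<alpha>\<in>exponents l. (if \<alpha> \<in> exponents k then c \<alpha> else 0) * monomial_of \<alpha> x) =
       (\<Sum>\<alpha>\<in>exponents k. (if \<alpha> \<in> exponents k then c \<alpha> else 0) * monomial_of \<alpha> x)"
      using exponents_mono[OF assms] by (intro sum.mono_neutral_right finite_exponents) auto
    then show ?thesis by (simp add: c)
  qed
  then show "a \<in> polynomials_upto l"
    by (intro polynomials_uptoI ext)
qed

lemma polynomials_upto_add:
  assumes "a \<in> polynomials_upto k" "b \<in> polynomials_upto k"
  shows "(\<lambda>x. a x + b x) \<in> polynomials_upto k"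
proof -
  obtain c where "a = (\<lambda>x. \<Sum>\<alpha>\<in>exponents k. c \<alpha> * monomial_of \<alpha> x)"
    using assms(1) by (rule polynomials_uptoE)
  moreover obtain d where "b = (\<lambda>x. \<Sum>\<alpha>\<in>exponents k. d \<alpha> * monomial_of \<alpha> x)"
    using assms(2) by (rule polynomials_uptoE)
  ultimately have "(\<lambda>x. a x + b x) = (\<lambda>x. \<Sum>\<alpha>\<in>exponents k. (c \<alpha> + d \<alpha>) * monomial_of \<alpha> x)"
    by (simp add: sum.distrib distrib_right)
  then show ?thesis by (rule polynomials_uptoI)
qed

lemma polynomials_upto_scale:
  assumes "a \<in> polynomials_upto k"
  shows "(\<lambda>x. t * a x) \<in> polynomials_upto k"
proof -
  obtain c where "a = (\<lambda>x. \<Sum>\<alpha>\<in>exponents k. c \<alpha> * monomial_of \<alpha> x)"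
    using assms by (rule polynomials_uptoE)
  then have "(\<lambda>x. t * a x) = (\<lambda>x. \<Sum>\<alpha>\<in>exponents k. (t * c \<alpha>) * monomial_of \<alpha> x)"
    by (simp add: sum_distrib_left mult.assoc)
  then show ?thesis by (rule polynomials_uptoI)
qed

lemma polynomials_upto_zero: "(\<lambda>x. 0) \<in> polynomials_upto k"
  unfolding polynomials_upto_alt by (rule CollectI, rule exI[of _ "\<lambda>_. 0"]) simp

lemma polynomials_upto_sum:
  assumes "\<And>i. i \<in> A \<Longrightarrow> a i \<in> polynomials_upto k"
  shows "(\<lambda>x. \<Sum>i\<in>A. a i x) \<in> polynomials_upto k"
  using assms
  by (induction A rule: infinite_finite_induct) (auto simp: polynomials_upto_zero intro: polynomials_upto_add)

lemma monomial_of_in_polynomials_upto: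
  assumes "\<alpha> \<in> exponents k" shows "monomial_of \<alpha> \<in> polynomials_upto k"
proof -
  have "monomial_of \<alpha> = (\<lambda>x. \<Sum>\<beta>\<in>exponents k. (if \<beta> = \<alpha> then 1 else 0) * monomial_of \<beta> x)"
    using assms by (intro ext) (simp add: finite_exponents if_distrib[of "\<lambda>x. x * _"] cong: if_cong)
  then show ?thesis by (rule polynomials_uptoI)
qed

lemma polynomials_upto_mult:
  assumes "a \<in> polynomials_upto k" "b \<in> polynomials_upto l"
  shows "(\<lambda>x. a x * b x) \<in> polynomials_upto (k + l)"
proof -
  obtain c where c: "a = (\<lambda>x. \<Sum>\<alpha>\<in>exponents k. c \<alpha> * monomial_of \<alpha> x)"
    using assms(1) by (rule polynomials_uptoE)
  obtain d where d: "b = (\<lambda>x. \<Sum>\<beta>\<in>exponents l. d \<beta> * monomial_of \<beta> x)"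
    using assms(2) by (rule polynomials_uptoE)
  have mono: "(\<lambda>x. monomial_of \<alpha> x * monomial_of \<beta> x) \<in> polynomials_upto (k + l)"
    if "\<alpha> \<in> exponents k" "\<beta> \<in> exponents l" for \<alpha> \<beta> :: "'a \<Rightarrow> nat"
  proof -
    let ?\<gamma> = "\<lambda>b\<in>Basis. \<alpha> b + \<beta> b"
    have "?\<gamma> \<in> exponents (k + l)"
      using that unfolding exponents_def
      by (auto simp: PiE_def Pi_def sum.distrib intro: add_mono)
    moreover have "(\<lambda>x. monomial_of \<alpha> x * monomial_of \<beta> x) = monomial_of ?\<gamma>"
      by (intro ext) (simp add: monomial_of_def power_add prod.distrib)
    ultimately show ?thesis by (simp add: monomial_of_in_polynomials_upto)
  qed
  have "(\<lambda>x. a x * b x) = (\<lambda>x. \<Sum>\<alpha>\<in>exponents k. \<Sum>\<beta>\<in>exponents l. (c \<alpha> * d \<beta>) * (monomial_of \<alpha> x * monomial_of \<beta> x))"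
    unfolding c d sum_product by (simp add: mult_ac)
  also have "\<dots> \<in> polynomials_upto (k + l)"
    by (intro polynomials_upto_sum polynomials_upto_scale mono)
  finally show ?thesis .
qed

text \<open>This links the polynomials of the Weierstrass theorem, which are generated by addition and
  multiplication, to those with coefficients indexed by exponents.\<close>

lemma real_polynomial_function_in_polynomials_upto:
  fixes p :: "'x::euclidean_space \<Rightarrow> real"
  assumes "real_polynomial_function p"
  shows "\<exists>k. p \<in> polynomials_upto k"
  using assms
proof (induction rule: real_polynomial_function.induct)
  case (linear f)
  have coord: "(\<lambda>x. x \<bullet> b) \<in> polynomials_upto 1" if b: "b \<in> Basis" for b :: 'x
  proof -
    let ?\<alpha> = "\<lambda>c\<in>Basis. if c = b then 1 else 0"
    have "?\<alpha> \<in> exponents 1" using b by (auto simp: exponents_def)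
    moreover have "monomial_of ?\<alpha> = (\<lambda>x. x \<bullet> b)"
    proof
      fix x
      have "monomial_of ?\<alpha> x = (\<Prod>c\<in>Basis. if c = b then x \<bullet> c else 1)"
        unfolding monomial_of_def by (intro prod.cong) auto
      then show "monomial_of ?\<alpha> x = x \<bullet> b" using b by simp
    qed
    ultimately show ?thesis using monomial_of_in_polynomials_upto[of ?\<alpha> 1] by simp
  qed
  have "f = (\<lambda>x. \<Sum>b\<in>Basis. f b * (x \<bullet> b))"
  proof
    fix x
    have "f x = f (\<Sum>b\<in>Basis. (x \<bullet> b) *\<^sub>R b)" by (simp add: euclidean_representation)
    also have "\<dots> = (\<Sum>b\<in>Basis. f b * (x \<bullet> b))"
      using bounded_linear.linear[OF linear] by (simp add: linear_sum linear_scale mult.commute)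
    finally show "f x = (\<Sum>b\<in>Basis. f b * (x \<bullet> b))" .
  qed
  moreover have "(\<lambda>x. \<Sum>b\<in>Basis. f b * (x \<bullet> b)) \<in> polynomials_upto 1"
    using coord by (intro polynomials_upto_sum polynomials_upto_scale)
  ultimately have "f \<in> polynomials_upto 1" by simp
  then show ?case by (rule exI)
next
  case (const c)
  have "(\<lambda>x::'x. 1) = monomial_of (\<lambda>b\<in>Basis. 0)"
    by (intro ext) (simp add: monomial_of_def)
  moreover have "(\<lambda>b\<in>Basis. 0) \<in> (exponents 0 :: ('x \<Rightarrow> nat) set)"
    by (simp add: exponents_def)
  ultimately have "(\<lambda>x::'x. 1) \<in> polynomials_upto 0"
    by (simp add: monomial_of_in_polynomials_upto)
  from polynomials_upto_scale[OF this, of c] show ?case by (intro exI[of _ 0]) simp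
next
  case (add f g)
  then obtain k l where "f \<in> polynomials_upto k" "g \<in> polynomials_upto l" by blast
  then have "f \<in> polynomials_upto (max k l)" "g \<in> polynomials_upto (max k l)"
    using polynomials_upto_mono[of k "max k l"] polynomials_upto_mono[of l "max k l"] by auto
  then show ?case using polynomials_upto_add by blast
next
  case (mult f g)
  then show ?case using polynomials_upto_mult by blast
qed

lemma continuous_polynomials_upto:
  assumes "a \<in> polynomials_upto k" shows "continuous_on A a"
  using assms unfolding polynomials_upto_def by (auto intro!: continuous_intros)

definition lincomb :: "nat \<Rightarrow> (nat \<Rightarrow> 'x \<Rightarrow> real) \<Rightarrow> ('x \<Rightarrow> real) set" where
  "lincomb N h = {f. \<exists>c. f = (\<lambda>x. \<Sum>j<N. c j * h j x)}"

lemma lincombI: "f = (\<lambda>x. \<Sum>j<N. c j * h j x) \<Longrightarrow> f \<in> lincomb N h"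
  unfolding lincomb_def mem_Collect_eq by (rule exI[of _ c])

lemma lincombE:
  assumes "f \<in> lincomb N h"
  obtains c where "f = (\<lambda>x. \<Sum>j<N. c j * h j x)"
  using assms unfolding lincomb_def mem_Collect_eq by (elim exE)

lemma polynomials_upto_eq_lincomb:
  obtains N h where "(polynomials_upto k :: ('x::euclidean_space \<Rightarrow> real) set) = lincomb N h"
proof -
  obtain e where e: "bij_betw e {0..<card (exponents k :: ('x \<Rightarrow> nat) set)} (exponents k :: ('x \<Rightarrow> nat) set)"
    using ex_bij_betw_nat_finite[OF finite_exponents] by blast
  let ?N = "card (exponents k :: ('x \<Rightarrow> nat) set)"
  let ?h = "\<lambda>j. monomial_of (e j)"
  from e have e': "bij_betw e {..<?N} (exponents k)" by (simp add: lessThan_atLeast0)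
  have "(polynomials_upto k :: ('x \<Rightarrow> real) set) = lincomb ?N ?h"
  proof (intro set_eqI iffI)
    fix a :: "'x \<Rightarrow> real" assume "a \<in> polynomials_upto k"
    then obtain c where c: "a = (\<lambda>x. \<Sum>\<alpha>\<in>exponents k. c \<alpha> * monomial_of \<alpha> x)"
      by (rule polynomials_uptoE)
    have "a = (\<lambda>x. \<Sum>j<?N. c (e j) * ?h j x)"
      unfolding c by (intro ext sum.reindex_bij_betw[OF e', symmetric])
    then show "a \<in> lincomb ?N ?h" by (rule lincombI)
  next
    fix a :: "'x \<Rightarrow> real" assume "a \<in> lincomb ?N ?h"
    then obtain c where c: "a = (\<lambda>x. \<Sum>j<?N. c j * ?h j x)"
      by (rule lincombE)
    have "monomial_of (e j) \<in> polynomials_upto k" if "j < ?N" for j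
      using that bij_betwE[OF e'] by (intro monomial_of_in_polynomials_upto) auto
    then show "a \<in> polynomials_upto k"
      unfolding c by (intro polynomials_upto_sum polynomials_upto_scale) auto
  qed
  then show ?thesis using that by blast
qed


section \<open>Integration of continuous functions over a compact support\<close>

locale compactly_supported_measure =
  fixes \<mu> :: "'x::euclidean_space measure" and S :: "'x set"
  assumes compact_S: "compact S" and supported: "finite_measure_supported_on \<mu> S"
begin

abbreviation I :: "('x \<Rightarrow> 'b::euclidean_space) \<Rightarrow> 'b" where
  "I f \<equiv> set_lebesgue_integral \<mu> S f"

lemma sets_mu: "sets \<mu> = sets borel"
  using supported by (simp add: finite_measure_supported_on_def)

lemma space_mu: "space \<mu> = UNIV"
  using sets_eq_imp_space_eq[OF sets_mu] by simp

lemma finite_mu: "finite_measure \<mu>"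
  using supported by (simp add: finite_measure_supported_on_def)

lemma S_sets: "S \<in> sets \<mu>"
  using compact_S by (simp add: sets_mu compact_imp_closed)

lemma integrable_continuous:
  fixes f :: "'x \<Rightarrow> 'b::euclidean_space"
  assumes "continuous_on UNIV f" shows "set_integrable \<mu> S f"
proof -
  interpret finite_measure \<mu> by (rule finite_mu)
  obtain C where C: "\<And>x. x \<in> S \<Longrightarrow> norm (f x) \<le> C"
    using compact_imp_bounded[OF compact_continuous_image[OF continuous_on_subset[OF assms] compact_S]]
    by (auto simp: bounded_iff)
  have f: "f \<in> borel_measurable \<mu>"
    using borel_measurable_continuous_onI[OF assms] by (simp add: measurable_cong_sets[OF sets_mu refl])
  show ?thesis
    unfolding set_integrable_def
  proof (rule integrable_const_bound)
    show "AE x in \<mu>. norm (indicator S x *\<^sub>R f x) \<le> max C 0"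
      using C by (intro AE_I2) (auto simp: indicator_def le_max_iff_disj)
    show "(\<lambda>x. indicator S x *\<^sub>R f x) \<in> borel_measurable \<mu>"
      using f S_sets by (intro borel_measurable_scaleR borel_measurable_indicator)
  qed
qed

lemma I_cong: "(\<And>x. x \<in> S \<Longrightarrow> f x = g x) \<Longrightarrow> I f = I g"
  using S_sets by (intro set_lebesgue_integral_cong) auto

lemma I_add:
  "continuous_on UNIV f \<Longrightarrow> continuous_on UNIV g \<Longrightarrow> I (\<lambda>x. f x + g x) = I f + I g"
  by (intro set_integral_add integrable_continuous)

lemma I_diff:
  "continuous_on UNIV f \<Longrightarrow> continuous_on UNIV g \<Longrightarrow> I (\<lambda>x. f x - g x) = I f - I g"
  by (intro set_integral_diff integrable_continuous)

lemma I_sum: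
  assumes "\<And>i. i \<in> A \<Longrightarrow> continuous_on UNIV (f i)"
  shows "I (\<lambda>x. \<Sum>i\<in>A. f i x) = (\<Sum>i\<in>A. I (f i))"
proof -
  have "I (\<lambda>x. \<Sum>i\<in>A. f i x) = (LINT x|\<mu>. (\<Sum>i\<in>A. indicator S x *\<^sub>R f i x))"
    by (simp add: set_lebesgue_integral_def scaleR_sum_right)
  also have "\<dots> = (\<Sum>i\<in>A. I (f i))"
    unfolding set_lebesgue_integral_def using integrable_continuous[OF assms]
    by (intro Bochner_Integration.integral_sum) (simp add: set_integrable_def)
  finally show ?thesis .
qed

lemma I_inner:
  assumes "continuous_on UNIV f"
  shows "I (\<lambda>x. u \<bullet> f x) = u \<bullet> I f"
proof -
  have "I (\<lambda>x. u \<bullet> f x) = (LINT x|\<mu>. u \<bullet> (indicator S x *\<^sub>R f x))"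
    by (simp add: set_lebesgue_integral_def)
  also have "\<dots> = u \<bullet> I f"
    unfolding set_lebesgue_integral_def using integrable_continuous[OF assms]
    by (intro integral_inner_right) (auto simp: set_integrable_def)
  finally show ?thesis .
qed

lemma I_nonneg:
  fixes f :: "'x \<Rightarrow> real"
  assumes "\<And>x. x \<in> S \<Longrightarrow> 0 \<le> f x" shows "0 \<le> I f"
  unfolding set_lebesgue_integral_def
  by (intro Bochner_Integration.integral_nonneg) (use assms in \<open>auto simp: indicator_def\<close>)

lemma I_le:
  fixes f :: "'x \<Rightarrow> real"
  assumes "continuous_on UNIV f" "\<And>x. x \<in> S \<Longrightarrow> f x \<le> c"
  shows "I f \<le> c * measure \<mu> S"
proof -
  have "I f \<le> I (\<lambda>x. c)"
    using assms by (intro set_integral_mono integrable_continuous) auto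
  also have "\<dots> = c * measure \<mu> S"
    unfolding set_lebesgue_integral_def using space_mu by simp
  finally show ?thesis .
qed

text \<open>The only place where the full support of the measure enters: a neighbourhood of \<open>x0\<close> on
  which \<open>f\<close> is bounded away from zero has positive measure.\<close>

lemma I_pos:
  fixes f :: "'x \<Rightarrow> real"
  assumes f: "continuous_on UNIV f" "\<And>x. x \<in> S \<Longrightarrow> 0 \<le> f x" and x0: "x0 \<in> S" "0 < f x0"
  shows "0 < I f"
proof -
  interpret finite_measure \<mu> by (rule finite_mu)
  let ?U = "{x. f x0 / 2 < f x}"
  have U: "open ?U" using f(1) by (intro open_Collect_less) auto
  have sU: "?U \<in> sets \<mu>" using U by (simp add: sets_mu)
  have "0 < emeasure \<mu> ?U"
    using supported x0 U by (auto simp: finite_measure_supported_on_def)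
  moreover have "emeasure \<mu> ?U = emeasure \<mu> (?U \<inter> S)"
  proof -
    have "emeasure \<mu> (- S) = 0" using supported by (simp add: finite_measure_supported_on_def)
    moreover have "- S \<in> sets \<mu>" using S_sets sets.compl_sets[of S \<mu>] by (simp add: space_mu Compl_eq_Diff_UNIV)
    ultimately have "- S \<in> null_sets \<mu>" by auto
    then have "emeasure \<mu> (?U - (- S)) = emeasure \<mu> ?U" using sU by (rule emeasure_Diff_null_set)
    then show ?thesis by (simp add: Diff_Compl)
  qed
  ultimately have pos: "0 < measure \<mu> (?U \<inter> S)"
    by (simp add: emeasure_eq_measure)
  have ind: "integrable \<mu> (\<lambda>x. (f x0 / 2) * indicator (?U \<inter> S) x)"
    using sU S_sets by (intro integrable_mult_right integrable_real_indicator) (auto simp: less_top[symmetric])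
  have "0 < (f x0 / 2) * measure \<mu> (?U \<inter> S)" using pos x0 by simp
  also have "\<dots> = (LINT x|\<mu>. (f x0 / 2) * indicator (?U \<inter> S) x)"
    using space_mu by simp
  also have "\<dots> \<le> I f"
    unfolding set_lebesgue_integral_def
    using integrable_continuous[OF f(1)] f(2) x0(2)
    by (intro integral_mono ind) (auto simp: set_integrable_def indicator_def)
  finally show ?thesis .
qed

lemma I_in_subspace:
  fixes f :: "'x \<Rightarrow> 'e::euclidean_space"
  assumes E: "subspace E" and f: "continuous_on UNIV f" "\<And>x. x \<in> S \<Longrightarrow> f x \<in> E"
  shows "I f \<in> E"
proof -
  obtain u where u: "u \<in> E" "\<And>v. v \<in> E \<Longrightarrow> u \<bullet> v = I f \<bullet> v"
    using subspace_representative[OF E] by blast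
  have "(I f - u) \<bullet> I f = I (\<lambda>x. (I f - u) \<bullet> f x)"
    by (rule I_inner[OF f(1), symmetric])
  also have "\<dots> = I (\<lambda>x. 0::real)"
    using f(2) u(2) by (intro I_cong) (simp add: inner_diff_left)
  finally have "(I f - u) \<bullet> I f = 0" by (simp add: set_lebesgue_integral_def)
  moreover have "(I f - u) \<bullet> u = 0" using u by (simp add: inner_diff_left)
  ultimately have "(I f - u) \<bullet> (I f - u) = 0" by (simp add: inner_diff_right)
  then show ?thesis using u(1) by simp
qed

definition orthonormal_spanning ::
  "nat \<Rightarrow> (nat \<Rightarrow> 'x \<Rightarrow> real) \<Rightarrow> nat \<Rightarrow> (nat \<Rightarrow> 'x \<Rightarrow> real) \<Rightarrow> bool" where
  "orthonormal_spanning N h r p \<longleftrightarrow> (\<forall>i<r. p i \<in> lincomb N h \<and> continuous_on UNIV (p i)) \<and>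
     (\<forall>i<r. \<forall>j<r. I (\<lambda>x. p i x * p j x) = (if i = j then 1 else 0)) \<and>
     (\<forall>f\<in>lincomb N h. \<exists>d. \<forall>x\<in>S. f x = (\<Sum>i<r. d i * p i x))"

text \<open>The Gram--Schmidt process for the inner product of \<open>L\<^sup>2(\<mu>)\<close>. A new function whose remainder
  has norm zero vanishes on \<open>S\<close> by full support and is dropped; hence the span is only recovered
  on \<open>S\<close>, where polynomials may well be linearly dependent.\<close>

lemma orthonormal_basis:
  assumes h: "\<And>j. j < N \<Longrightarrow> continuous_on UNIV (h j)"
  shows "\<exists>(r::nat) p. orthonormal_spanning N h r p"
  using h
proof (induction N)
  case 0
  show ?case by (rule exI[of _ 0]) (simp add: lincomb_def orthonormal_spanning_def)
next
  case (Suc N)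
  have up: "lincomb N h \<subseteq> lincomb (Suc N) h"
  proof
    fix f assume "f \<in> lincomb N h"
    then obtain c where c: "f = (\<lambda>x. \<Sum>j<N. c j * h j x)" by (rule lincombE)
    have "f = (\<lambda>x. \<Sum>j<Suc N. (c(N := 0)) j * h j x)" unfolding c by simp
    then show "f \<in> lincomb (Suc N) h" by (rule lincombI)
  qed
  have "\<exists>(r::nat) p. orthonormal_spanning N h r p"
    by (rule Suc.IH) (simp add: Suc.prems)
  then obtain r :: nat and p where IH: "\<forall>i<r. p i \<in> lincomb N h \<and> continuous_on UNIV (p i)"
     "\<forall>i<r. \<forall>j<r. I (\<lambda>x. p i x * p j x) = (if i = j then 1 else 0)"
     "\<forall>f\<in>lincomb N h. \<exists>d. \<forall>x\<in>S. f x = (\<Sum>i<r. d i * p i x)"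
    unfolding orthonormal_spanning_def by (elim exE conjE) (rule that)
  have p: "p i \<in> lincomb N h" "continuous_on UNIV (p i)" if "i < r" for i
    using IH(1) that by simp_all
  have orth: "I (\<lambda>x. p i x * p j x) = (if i = j then 1 else 0)" if "i < r" "j < r" for i j
    using IH(2) that by simp
  have spans: "\<exists>d. \<forall>x\<in>S. f x = (\<Sum>i<r. d i * p i x)" if "f \<in> lincomb N h" for f
    using IH(3) that by simp
  define a where "a i = I (\<lambda>x. h N x * p i x)" for i
  define g where "g x = h N x - (\<Sum>i<r. a i * p i x)" for x
  have hN: "continuous_on UNIV (h N)" using Suc.prems by simp
  have g: "continuous_on UNIV g"
    unfolding g_def using p(2) by (intro continuous_intros hN) auto
  have lin: "\<exists>d. \<exists>t. \<forall>x\<in>S. f x = (\<Sum>i<r. d i * p i x) + t * h N x" if f: "f \<in> lincomb (Suc N) h" for f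
  proof -
    obtain c where c: "f = (\<lambda>x. \<Sum>j<Suc N. c j * h j x)" using f by (rule lincombE)
    have "(\<lambda>x. \<Sum>j<N. c j * h j x) \<in> lincomb N h" by (rule lincombI[OF refl])
    then obtain d where "\<forall>x\<in>S. (\<Sum>j<N. c j * h j x) = (\<Sum>i<r. d i * p i x)" using spans by blast
    then show ?thesis unfolding c by (intro exI[of _ d] exI[of _ "c N"]) simp
  qed
  have gp: "I (\<lambda>x. g x * p j x) = 0" if j: "j < r" for j
  proof -
    have "I (\<lambda>x. g x * p j x) = I (\<lambda>x. h N x * p j x - (\<Sum>i<r. a i * (p i x * p j x)))"
      by (simp add: g_def left_diff_distrib sum_distrib_right mult.assoc)
    also have "\<dots> = a j - (\<Sum>i<r. a i * I (\<lambda>x. p i x * p j x))"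
    proof -
      have "I (\<lambda>x. \<Sum>i<r. a i * (p i x * p j x)) = (\<Sum>i<r. I (\<lambda>x. a i * (p i x * p j x)))"
        using p(2) j by (intro I_sum continuous_intros) auto
      moreover have "I (\<lambda>x. h N x * p j x - (\<Sum>i<r. a i * (p i x * p j x))) =
          I (\<lambda>x. h N x * p j x) - I (\<lambda>x. \<Sum>i<r. a i * (p i x * p j x))"
        using p(2) j by (intro I_diff continuous_intros hN) auto
      ultimately show ?thesis by (simp add: a_def)
    qed
    also have "\<dots> = 0"
      using orth j by (simp add: if_distrib[of "\<lambda>x. _ * x"] cong: if_cong)
    finally show ?thesis .
  qed
  show ?case
  proof (cases "I (\<lambda>x. g x * g x) = 0")
    case True
    have g0: "g x = 0" if "x \<in> S" for x
    proof (rule ccontr)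
      assume "g x \<noteq> 0"
      then have "0 < g x * g x" by (simp add: zero_less_mult_iff linorder_neq_iff disj_commute)
      then have "0 < I (\<lambda>x. g x * g x)"
        using that by (intro I_pos[of _ x] continuous_intros g) auto
      with True show False by simp
    qed
    have "\<exists>d. \<forall>x\<in>S. f x = (\<Sum>i<r. d i * p i x)" if fl: "f \<in> lincomb (Suc N) h" for f
    proof -
      obtain d t where f: "\<And>x. x \<in> S \<Longrightarrow> f x = (\<Sum>i<r. d i * p i x) + t * h N x" using lin[OF fl] by blast
      have "f x = (\<Sum>i<r. (d i + t * a i) * p i x)" if "x \<in> S" for x
      proof -
        have "h N x = (\<Sum>i<r. a i * p i x)" using g0[OF that] by (simp add: g_def)
        then show ?thesis using f[OF that] by (simp add: distrib_right sum.distrib sum_distrib_left mult.assoc)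
      qed
      then show ?thesis by (intro exI[of _ "\<lambda>i. d i + t * a i"]) blast
    qed
    then show ?thesis
      unfolding orthonormal_spanning_def using p orth up by (intro exI[of _ r] exI[of _ p]) blast
  next
    case False
    let ?n = "I (\<lambda>x. g x * g x)"
    have n: "0 < ?n" using False I_nonneg[of "\<lambda>x. g x * g x"] by simp
    define s where "s = sqrt ?n"
    have s: "0 < s" "s * s = ?n" using n by (auto simp: s_def)
    define q where "q = p(r := \<lambda>x. g x / s)"
    have q_old: "q i = p i" if "i < r" for i using that by (simp add: q_def)
    have q_new: "q r = (\<lambda>x. g x / s)" by (simp add: q_def)
    have "g \<in> lincomb (Suc N) h"
    proof -
      obtain c where c: "\<And>i. i < r \<Longrightarrow> p i = (\<lambda>x. \<Sum>j<N. c i j * h j x)"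
      proof -
        have "\<exists>c. p i = (\<lambda>x. \<Sum>j<N. c j * h j x)" if "i < r" for i
          using p(1)[OF that] by (rule lincombE) (rule exI)
        then show ?thesis using that by metis
      qed
      have "g = (\<lambda>x. \<Sum>j<Suc N. (if j = N then 1 else - (\<Sum>i<r. a i * c i j)) * h j x)"
      proof
        fix x
        have "(\<Sum>i<r. a i * p i x) = (\<Sum>i<r. \<Sum>j<N. a i * c i j * h j x)"
          using c by (simp add: sum_distrib_left mult.assoc)
        also have "\<dots> = (\<Sum>j<N. (\<Sum>i<r. a i * c i j) * h j x)"
          by (subst sum.swap) (simp add: sum_distrib_right)
        finally show "g x = (\<Sum>j<Suc N. (if j = N then 1 else - (\<Sum>i<r. a i * c i j)) * h j x)"
          by (simp add: g_def sum_negf)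
      qed
      then show ?thesis by (rule lincombI)
    qed
    then obtain cg where cg: "g = (\<lambda>x. \<Sum>j<Suc N. cg j * h j x)" by (rule lincombE)
    have "q r = (\<lambda>x. \<Sum>j<Suc N. (cg j / s) * h j x)"
      unfolding q_new by (simp add: cg sum_divide_distrib add_divide_distrib)
    then have qr: "q r \<in> lincomb (Suc N) h" by (rule lincombI)
    have qrc: "continuous_on UNIV (q r)"
      unfolding q_new using s by (intro continuous_intros g) auto
    have "\<forall>i<Suc r. q i \<in> lincomb (Suc N) h \<and> continuous_on UNIV (q i)"
      using p up q_old qr qrc by (auto simp: less_Suc_eq)
    moreover have "I (\<lambda>x. q i x * q j x) = (if i = j then 1 else 0)" if ij: "i < Suc r" "j < Suc r" for i j
    proof -
      consider "i < r" "j < r" | "i = r" "j < r" | "i < r" "j = r" | "i = r" "j = r"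
        using ij by (auto simp: less_Suc_eq)
      then show ?thesis
      proof cases
        case 1
        then show ?thesis using orth q_old by simp
      next
        case 2
        have "I (\<lambda>x. q i x * q j x) = I (\<lambda>x. g x * p j x / s)"
          using 2 q_old q_new by simp
        then show ?thesis using gp 2 by simp
      next
        case 3
        have "I (\<lambda>x. q i x * q j x) = I (\<lambda>x. g x * p i x / s)"
          using 3 q_old q_new by (simp add: mult.commute)
        then show ?thesis using gp 3 by simp
      next
        case 4
        have "I (\<lambda>x. q i x * q j x) = I (\<lambda>x. g x * g x / (s * s))"
          using 4 q_new by simp
        then show ?thesis using 4 s n by simp
      qed
    qed
    moreover have "\<exists>d. \<forall>x\<in>S. f x = (\<Sum>i<Suc r. d i * q i x)" if fl: "f \<in> lincomb (Suc N) h" for f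
    proof -
      obtain d t where f: "\<And>x. x \<in> S \<Longrightarrow> f x = (\<Sum>i<r. d i * p i x) + t * h N x" using lin[OF fl] by blast
      have "f x = (\<Sum>i<Suc r. (if i < r then d i + t * a i else t * s) * q i x)" if "x \<in> S" for x
      proof -
        have "h N x = g x + (\<Sum>i<r. a i * p i x)" by (simp add: g_def)
        then show ?thesis
          using f[OF that] s q_old q_new
          by (simp add: distrib_right distrib_left sum.distrib sum_distrib_left mult.assoc)
      qed
      then show ?thesis by (intro exI[of _ "\<lambda>i. if i < r then d i + t * a i else t * s"]) blast
    qed
    ultimately show ?thesis unfolding orthonormal_spanning_def by blast
  qed
qed

end

section \<open>Accuracy of the moment scheme\<close>

locale moment_scheme = compactly_supported_measure \<mu> S
  for \<mu> :: "'x::euclidean_space measure" and S :: "'x set" +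
  fixes E :: "'e::euclidean_space set" and T :: "'x \<Rightarrow> 'e"
  assumes subspace_E: "subspace E"
    and continuous_T: "continuous_on UNIV T"
    and T_in_E: "\<And>x. x \<in> S \<Longrightarrow> T x \<in> E"
begin

abbreviation Q :: "nat \<Rightarrow> 'e set" where
  "Q k \<equiv> moment_set E S \<mu> T k"

text \<open>In an orthonormal basis \<open>p\<close> of the polynomials of degree at most \<open>k\<close> on \<open>S\<close>, the integral of
  \<open>(1 + u \<bullet> T) a\<^sup>2\<close> is a quadratic form in the coordinates of \<open>a\<close>, and its matrix is the identity
  plus \<open>u \<bullet> V i j\<close>, where \<open>V i j\<close> is the integral of \<open>p i p j T\<close>.\<close>

lemma moment_set_eq_gram:
  obtains r V where "\<And>i j. V i j \<in> E" "\<And>i j. V i j = V j i" "Q k = gram_spectrahedron E r V"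
proof -
  obtain N h where Nh: "(polynomials_upto k :: ('x \<Rightarrow> real) set) = lincomb N h"
    by (rule polynomials_upto_eq_lincomb)
  have "continuous_on UNIV (h j)" if "j < N" for j
  proof -
    have "h j = (\<lambda>x. \<Sum>i<N. (if i = j then 1 else 0) * h i x)"
      using that by (intro ext) (simp add: if_distrib[of "\<lambda>x. x * _"] cong: if_cong)
    then have "h j \<in> polynomials_upto k" unfolding Nh by (rule lincombI)
    then show ?thesis by (rule continuous_polynomials_upto)
  qed
  then have "\<exists>(r::nat) p. orthonormal_spanning N h r p"
    by (rule orthonormal_basis)
  then obtain r :: nat and p where basis: "\<forall>i<r. p i \<in> lincomb N h \<and> continuous_on UNIV (p i)"
     "\<forall>i<r. \<forall>j<r. I (\<lambda>x. p i x * p j x) = (if i = j then 1 else 0)"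
     "\<forall>f\<in>lincomb N h. \<exists>d. \<forall>x\<in>S. f x = (\<Sum>i<r. d i * p i x)"
    unfolding orthonormal_spanning_def by (elim exE conjE) (rule that)
  have p: "p i \<in> polynomials_upto k" "continuous_on UNIV (p i)" if "i < r" for i
    using basis(1) that Nh by simp_all
  \<comment> \<open>Zero outside the range, so that \<open>V\<close> is symmetric with values in \<open>E\<close> for all indices.\<close>
  define V where "V i j = (if i < r \<and> j < r then I (\<lambda>x. (p i x * p j x) *\<^sub>R T x) else 0)" for i j
  have VE: "V i j \<in> E" for i j
    unfolding V_def using p(2) T_in_E subspace_E
    by (auto intro!: I_in_subspace continuous_intros continuous_T subspace_scale simp: subspace_0)
  have Vsym: "V i j = V j i" for i j
    unfolding V_def by (simp add: mult.commute conj_commute)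
  have quad: "I (\<lambda>x. (1 + u \<bullet> T x) * (\<Sum>i<r. d i * p i x)\<^sup>2) =
      (\<Sum>i<r. \<Sum>j<r. d i * ((if i = j then 1 else 0) + u \<bullet> V i j) * d j)" for u d
  proof -
    have "(1 + u \<bullet> T x) * (\<Sum>i<r. d i * p i x)\<^sup>2 =
        (\<Sum>i<r. \<Sum>j<r. (d i * d j) * (p i x * p j x + u \<bullet> ((p i x * p j x) *\<^sub>R T x)))" for x
      unfolding power2_eq_square sum_product unfolding sum_distrib_left
      by (intro sum.cong refl) (simp add: algebra_simps)
    then have "I (\<lambda>x. (1 + u \<bullet> T x) * (\<Sum>i<r. d i * p i x)\<^sup>2) =
        I (\<lambda>x. \<Sum>i<r. \<Sum>j<r. (d i * d j) * (p i x * p j x + u \<bullet> ((p i x * p j x) *\<^sub>R T x)))"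
      by simp
    also have "\<dots> = (\<Sum>i<r. I (\<lambda>x. \<Sum>j<r. (d i * d j) * (p i x * p j x + u \<bullet> ((p i x * p j x) *\<^sub>R T x))))"
      using p(2) by (intro I_sum continuous_intros continuous_T) auto
    also have "\<dots> = (\<Sum>i<r. \<Sum>j<r. I (\<lambda>x. (d i * d j) * (p i x * p j x + u \<bullet> ((p i x * p j x) *\<^sub>R T x))))"
      using p(2) by (intro sum.cong refl I_sum continuous_intros continuous_T) auto
    also have "\<dots> = (\<Sum>i<r. \<Sum>j<r. d i * ((if i = j then 1 else 0) + u \<bullet> V i j) * d j)"
    proof (intro sum.cong refl)
      fix i j assume "i \<in> {..<r}" "j \<in> {..<r}"
      then have ij: "i < r" "j < r" by auto
      have "I (\<lambda>x. p i x * p j x + u \<bullet> ((p i x * p j x) *\<^sub>R T x)) =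
          I (\<lambda>x. p i x * p j x) + I (\<lambda>x. u \<bullet> ((p i x * p j x) *\<^sub>R T x))"
        using p(2) ij by (intro I_add continuous_intros continuous_T) auto
      also have "I (\<lambda>x. u \<bullet> ((p i x * p j x) *\<^sub>R T x)) = u \<bullet> V i j"
        unfolding V_def using ij p(2) by (subst I_inner) (auto intro!: continuous_intros continuous_T)
      also have "I (\<lambda>x. p i x * p j x) = (if i = j then 1 else 0)"
        using basis(2) ij by blast
      finally show "I (\<lambda>x. (d i * d j) * (p i x * p j x + u \<bullet> ((p i x * p j x) *\<^sub>R T x))) =
          d i * ((if i = j then 1 else 0) + u \<bullet> V i j) * d j"
        by (simp only: set_integral_mult_right) (simp add: mult_ac)
    qed
    finally show ?thesis .
  qed
  have "(\<forall>a\<in>polynomials_upto k. 0 \<le> I (\<lambda>x. (1 + u \<bullet> T x) * (a x)\<^sup>2)) \<longleftrightarrow>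
      psd r (\<lambda>i j. (if i = j then 1 else 0) + u \<bullet> V i j)" for u
  proof
    assume L: "\<forall>a\<in>polynomials_upto k. 0 \<le> I (\<lambda>x. (1 + u \<bullet> T x) * (a x)\<^sup>2)"
    have "0 \<le> (\<Sum>i<r. \<Sum>j<r. d i * ((if i = j then 1 else 0) + u \<bullet> V i j) * d j)" for d
      unfolding quad[symmetric]
      using p(1) by (intro L[rule_format] polynomials_upto_sum polynomials_upto_scale) auto
    moreover have "symmat r (\<lambda>i j. (if i = j then 1 else 0) + u \<bullet> V i j)"
      unfolding symmat_def using Vsym by (auto simp: inner_commute)
    ultimately show "psd r (\<lambda>i j. (if i = j then 1 else 0) + u \<bullet> V i j)"
      by (simp add: psd_def)
  next
    assume R: "psd r (\<lambda>i j. (if i = j then 1 else 0) + u \<bullet> V i j)"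
    show "\<forall>a\<in>polynomials_upto k. 0 \<le> I (\<lambda>x. (1 + u \<bullet> T x) * (a x)\<^sup>2)"
    proof
      fix a :: "'x \<Rightarrow> real" assume "a \<in> polynomials_upto k"
      then obtain d where d: "\<forall>x\<in>S. a x = (\<Sum>i<r. d i * p i x)" using basis(3) Nh by blast
      have "I (\<lambda>x. (1 + u \<bullet> T x) * (a x)\<^sup>2) = I (\<lambda>x. (1 + u \<bullet> T x) * (\<Sum>i<r. d i * p i x)\<^sup>2)"
        using d by (intro I_cong) simp
      also have "\<dots> \<ge> 0" unfolding quad using R unfolding psd_def by blast
      finally show "0 \<le> I (\<lambda>x. (1 + u \<bullet> T x) * (a x)\<^sup>2)" .
    qed
  qed
  then have "Q k = gram_spectrahedron E r V"
    unfolding moment_set_def gram_spectrahedron_def by simp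
  with VE Vsym show ?thesis by (rule that)
qed

lemma spectrahedron_moment_set: "spectrahedron_in E (Q k)"
  by (rule moment_set_eq_gram[of k]) (simp add: spectrahedron_in_gram)

text \<open>The polar of the moment set is the compact body of all the integrals of \<open>T\<close> against sums of
  squares of total mass at most one.\<close>

lemma moment_set_eq_polar:
  obtains r V where "\<And>i j. V i j \<in> E" "\<And>i j. V i j = V j i"
    "Q k = polar_in E (gram_body r V)" "polar_in E (Q k) = gram_body r V"
proof -
  obtain r V where V: "\<And>i j. V i j \<in> E" "\<And>i j. V i j = V j i" "Q k = gram_spectrahedron E r V"
    using moment_set_eq_gram[of k] by metis
  have Q: "Q k = polar_in E (gram_body r V)"
    unfolding V(3) by (rule polar_in_gram_body[OF V(2), symmetric])
  moreover have "polar_in E (Q k) = gram_body r V"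
    unfolding Q by (intro polar_in_bipolar subspace_E gram_body_subset V(1) convex_gram_body
        zero_in_gram_body compact_imp_closed compact_gram_body)
  ultimately show ?thesis using that V by blast
qed

lemma SDR_polar_moment_set: "SDR_in E (polar_in E (Q k))"
proof -
  obtain r V where V: "\<And>i j. V i j \<in> E" "\<And>i j. V i j = V j i" "polar_in E (Q k) = gram_body r V"
    using moment_set_eq_polar[of k] by metis
  then show ?thesis using SDR_in_gram_body[OF subspace_E V(1,2)] by simp
qed

lemma moment_set_bipolar: "polar_in E (polar_in E (Q k)) = Q k"
  by (rule moment_set_eq_polar[of k]) simp

lemma decseq_moment_set: "decseq Q"
  unfolding decseq_def moment_set_def using polynomials_upto_mono by blast

lemma polar_subset_moment_set: "polar_in E (T ` S) \<subseteq> Q k"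
proof
  fix u assume u: "u \<in> polar_in E (T ` S)"
  have "0 \<le> I (\<lambda>x. (1 + u \<bullet> T x) * (a x)\<^sup>2)" for a
  proof (rule I_nonneg)
    fix x assume "x \<in> S"
    then have "-1 \<le> u \<bullet> T x" using u by (simp add: polar_in_def)
    then show "0 \<le> (1 + u \<bullet> T x) * (a x)\<^sup>2" by simp
  qed
  then show "u \<in> Q k" using u by (simp add: moment_set_def polar_in_def)
qed

text \<open>If \<open>\<phi> = 1 + u \<bullet> T\<close> is negative somewhere on \<open>S\<close>, let \<open>f\<close> be its negative part. The integral
  of \<open>\<phi> f\<^sup>2 = - f\<^sup>3\<close> is negative, and stays so when \<open>f\<close> is replaced by a polynomial close to it.\<close>

lemma Inter_moment_set: "(\<Inter>k. Q k) = polar_in E (T ` S)"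
proof
  show "polar_in E (T ` S) \<subseteq> (\<Inter>k. Q k)"
    using polar_subset_moment_set by blast
  show "(\<Inter>k. Q k) \<subseteq> polar_in E (T ` S)"
  proof
    fix u assume u: "u \<in> (\<Inter>k. Q k)"
    define \<phi> where "\<phi> x = 1 + u \<bullet> T x" for x
    define f where "f x = max 0 (- \<phi> x)" for x
    have \<phi>: "continuous_on UNIV \<phi>"
      unfolding \<phi>_def by (intro continuous_intros continuous_T)
    have f: "continuous_on UNIV f"
      unfolding f_def by (intro continuous_intros \<phi>)
    have "0 \<le> \<phi> x0" if x0: "x0 \<in> S" for x0
    proof (rule ccontr)
      assume neg: "\<not> 0 \<le> \<phi> x0"
      define \<delta> where "\<delta> = I (\<lambda>x. f x ^ 3)"
      have \<delta>: "0 < \<delta>"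
        unfolding \<delta>_def using neg x0
        by (intro I_pos[of _ x0] continuous_intros f) (auto simp: f_def)
      have "I (\<lambda>x. \<phi> x * (f x)\<^sup>2) = I (\<lambda>x. (-1) * f x ^ 3)"
        by (rule I_cong) (simp add: f_def max_def power3_eq_cube power2_eq_square)
      then have \<phi>f: "I (\<lambda>x. \<phi> x * (f x)\<^sup>2) = - \<delta>"
        unfolding \<delta>_def by (simp only: set_integral_mult_right)
      obtain C0 where C0: "\<And>x. x \<in> S \<Longrightarrow> norm (\<phi> x) \<le> C0"
        using compact_imp_bounded[OF compact_continuous_image[OF continuous_on_subset[OF \<phi>] compact_S]]
        by (auto simp: bounded_iff)
      define C where "C = max C0 1"
      have C: "1 \<le> C" "\<And>x. x \<in> S \<Longrightarrow> \<bar>\<phi> x\<bar> \<le> C" "\<And>x. x \<in> S \<Longrightarrow> \<bar>f x\<bar> \<le> C"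
        using C0 by (force simp: C_def f_def max_def)+
      define m where "m = measure \<mu> S"
      have m: "0 \<le> m" by (simp add: m_def)
      define K where "K = C * (2 * C + 1)"
      have K: "0 < K" using C(1) by (simp add: K_def)
      \<comment> \<open>\<open>C (2 C + 1) \<epsilon>\<close> bounds the change of \<open>\<phi> f\<^sup>2\<close> on \<open>S\<close>; the \<open>m + 1\<close> allows for total mass zero.\<close>
      define \<epsilon> where "\<epsilon> = min 1 (\<delta> / (K * (m + 1)))"
      have \<epsilon>: "0 < \<epsilon>" "\<epsilon> \<le> 1" using \<delta> K m by (auto simp: \<epsilon>_def)
      have "K * \<epsilon> * m < \<delta>"
      proof -
        have "K * \<epsilon> * m < K * \<epsilon> * (m + 1)" using K \<epsilon> by simp
        also have "\<dots> \<le> K * (\<delta> / (K * (m + 1))) * (m + 1)"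
          using K m by (intro mult_right_mono mult_left_mono) (auto simp: \<epsilon>_def)
        also have "\<dots> = \<delta>" using K m by simp
        finally show ?thesis .
      qed
      obtain g where g: "polynomial_function g" "\<And>x. x \<in> S \<Longrightarrow> norm (f x - g x) < \<epsilon>"
        using Stone_Weierstrass_polynomial_function[OF compact_S continuous_on_subset[OF f] \<epsilon>(1)] by blast
      have "real_polynomial_function g" using g(1) by (simp add: real_polynomial_function_eq)
      then obtain k where k: "g \<in> polynomials_upto k"
        using real_polynomial_function_in_polynomials_upto by blast
      have gc: "continuous_on UNIV g" using k by (rule continuous_polynomials_upto)
      have "0 \<le> I (\<lambda>x. \<phi> x * (g x)\<^sup>2)"
        using u k by (auto simp: moment_set_def \<phi>_def)
      moreover have "I (\<lambda>x. \<phi> x * (g x)\<^sup>2) - I (\<lambda>x. \<phi> x * (f x)\<^sup>2) =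
          I (\<lambda>x. \<phi> x * (g x)\<^sup>2 - \<phi> x * (f x)\<^sup>2)"
        by (intro I_diff[symmetric] continuous_intros \<phi> f gc)
      moreover have "I (\<lambda>x. \<phi> x * (g x)\<^sup>2 - \<phi> x * (f x)\<^sup>2) \<le> K * \<epsilon> * m"
        unfolding m_def
      proof (rule I_le)
        show "continuous_on UNIV (\<lambda>x. \<phi> x * (g x)\<^sup>2 - \<phi> x * (f x)\<^sup>2)"
          by (intro continuous_intros \<phi> f gc)
        fix x assume x: "x \<in> S"
        have "\<phi> x * (g x)\<^sup>2 - \<phi> x * (f x)\<^sup>2 = \<phi> x * (g x + f x) * (g x - f x)"
          by (simp add: power2_eq_square algebra_simps)
        also have "\<dots> \<le> \<bar>\<phi> x * (g x + f x) * (g x - f x)\<bar>" by simp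
        also have "\<dots> = \<bar>\<phi> x\<bar> * \<bar>g x + f x\<bar> * \<bar>g x - f x\<bar>" by (simp add: abs_mult)
        also have "\<dots> \<le> C * (2 * C + 1) * \<epsilon>"
        proof (intro mult_mono)
          show "\<bar>g x - f x\<bar> \<le> \<epsilon>" using g(2)[OF x] by (simp add: abs_minus_commute)
          then show "\<bar>g x + f x\<bar> \<le> 2 * C + 1" using C(3)[OF x] \<epsilon>(2) by linarith
        qed (use C x in auto)
        finally show "\<phi> x * (g x)\<^sup>2 - \<phi> x * (f x)\<^sup>2 \<le> K * \<epsilon>" by (simp add: K_def)
      qed
      ultimately show False using \<phi>f \<open>K * \<epsilon> * m < \<delta>\<close> by linarith
    qed
    then have "-1 \<le> u \<bullet> T x" if "x \<in> S" for x using that by (force simp: \<phi>_def)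
    moreover have "u \<in> E" using u by (simp add: moment_set_def)
    ultimately show "u \<in> polar_in E (T ` S)" by (simp add: polar_in_def)
  qed
qed

lemma compact_convex_hull_T: "compact (convex hull (T ` S))"
  by (intro compact_convex_hull compact_continuous_image continuous_on_subset[OF continuous_T] compact_S) simp

lemma convex_hull_T_subset: "convex hull (T ` S) \<subseteq> E"
  using T_in_E subspace_E by (intro hull_minimal subspace_imp_convex) auto

lemma polar_polar_T:
  assumes "0 \<in> convex hull (T ` S)"
  shows "polar_in E (polar_in E (T ` S)) = convex hull (T ` S)"
  using polar_in_bipolar[OF subspace_E convex_hull_T_subset _ _ assms] compact_convex_hull_T
  by (simp add: compact_imp_closed polar_in_convex_hull)

lemma closure_Union_polar_moment_set:
  assumes "0 \<in> convex hull (T ` S)"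
  shows "closure (\<Union>k. polar_in E (Q k)) = convex hull (T ` S)"
  using convex_hull_T_subset compact_convex_hull_T assms
  by (intro closure_Union_polar_in subspace_E decseq_moment_set moment_set_bipolar)
     (auto simp: Inter_moment_set polar_in_convex_hull compact_imp_closed)

text \<open>On a finite set the squares of interpolation polynomials are, up to factors, the indicators
  of points, so finitely many test functions already force \<open>1 + u \<bullet> T\<close> to be nonnegative.\<close>

lemma moment_set_finite:
  assumes S: "finite S"
  shows "\<exists>k. Q k = polar_in E (T ` S)"
proof -
  have "\<exists>k a. a \<in> polynomials_upto k \<and> a y \<noteq> 0 \<and> (\<forall>x\<in>S - {y}. a x = 0)" for y
  proof -
    \<comment> \<open>The factor at \<open>z\<close> vanishes at \<open>z\<close> but not at \<open>y\<close>.\<close>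
    let ?a = "\<lambda>x. \<Prod>z\<in>S - {y}. (x - z) \<bullet> (y - z)"
    have "real_polynomial_function (\<lambda>x. (x - z) \<bullet> (y - z))" for z :: 'x
    proof -
      have "(\<lambda>x. (x - z) \<bullet> (y - z)) = (\<lambda>x. x \<bullet> (y - z) - z \<bullet> (y - z))"
        by (simp add: inner_diff_left)
      then show ?thesis
        using real_polynomial_function_diff[OF real_polynomial_function.intros(1)[OF bounded_linear_inner_left]
            real_polynomial_function.intros(2)] by simp
    qed
    then have "real_polynomial_function ?a" using S by (intro real_polynomial_function_prod) auto
    then obtain k where "?a \<in> polynomials_upto k"
      using real_polynomial_function_in_polynomials_upto by blast
    moreover have "?a y \<noteq> 0" using S by simp
    moreover have "\<forall>x\<in>S - {y}. ?a x = 0" using S by (auto intro!: prod_zero bexI)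
    ultimately show ?thesis by blast
  qed
  then obtain K a where a: "\<And>y. a y \<in> polynomials_upto (K y)" "\<And>y. a y y \<noteq> 0" "\<And>y x. x \<in> S - {y} \<Longrightarrow> a y x = 0"
    by metis
  define k where "k = Max (K ` S)"
  have Kk: "K y \<le> k" if "y \<in> S" for y using that S by (simp add: k_def)
  have "Q k \<subseteq> polar_in E (T ` S)"
  proof
    fix u assume u: "u \<in> Q k"
    have "0 \<le> 1 + u \<bullet> T y" if y: "y \<in> S" for y
    proof (rule ccontr)
      assume neg: "\<not> 0 \<le> 1 + u \<bullet> T y"
      let ?f = "\<lambda>x. (1 + u \<bullet> T x) * (a y x)\<^sup>2"
      have "a y \<in> polynomials_upto k" using a(1)[of y] polynomials_upto_mono[OF Kk[OF y]] by blast
      then have nonneg: "0 \<le> I ?f" using u by (simp add: moment_set_def)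
      have "0 < I (\<lambda>x. (-1) * ?f x)"
      proof (rule I_pos[of _ y])
        show "continuous_on UNIV (\<lambda>x. (-1) * ?f x)"
          by (intro continuous_intros continuous_T continuous_polynomials_upto[OF a(1)])
        have pos: "0 < (-1) * ?f y" using neg a(2)[of y] by (simp add: mult_less_0_iff)
        then show "0 < (-1) * ?f y" .
        fix x assume x: "x \<in> S"
        show "0 \<le> (-1) * ?f x"
        proof (cases "x = y")
          case False
          then have "a y x = 0" using a(3)[of x y] x by simp
          then show ?thesis by simp
        qed (use pos in simp)
      qed (rule y)
      also have "\<dots> = - I ?f" by (simp only: set_integral_mult_right)
      finally show False using nonneg by simp
    qed
    then have "-1 \<le> u \<bullet> T x" if "x \<in> S" for x using that by force
    moreover have "u \<in> E" using u by (simp add: moment_set_def)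
    ultimately show "u \<in> polar_in E (T ` S)" by (simp add: polar_in_def)
  qed
  then show ?thesis using polar_subset_moment_set by blast
qed

end

section \<open>Measures on products and powers\<close>

lemma finite_measure_supported_on_Times:
  fixes \<mu> :: "'a::euclidean_space measure" and \<nu> :: "'b::euclidean_space measure"
  assumes \<mu>: "finite_measure_supported_on \<mu> S" and \<nu>: "finite_measure_supported_on \<nu> T"
    and closed: "closed S" "closed T"
  shows "finite_measure_supported_on (\<mu> \<Otimes>\<^sub>M \<nu>) (S \<times> T)"
proof -
  interpret M: finite_measure \<mu> using \<mu> by (simp add: finite_measure_supported_on_def)
  interpret N: finite_measure \<nu> using \<nu> by (simp add: finite_measure_supported_on_def)
  have sets: "sets \<mu> = sets borel" "sets \<nu> = sets borel"
    using \<mu> \<nu> by (auto simp: finite_measure_supported_on_def)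
  have space: "space \<mu> = UNIV" "space \<nu> = UNIV"
    using sets[THEN sets_eq_imp_space_eq] by auto
  have null: "emeasure \<mu> (- S) = 0" "emeasure \<nu> (- T) = 0"
    using \<mu> \<nu> by (auto simp: finite_measure_supported_on_def)
  have "sets (\<mu> \<Otimes>\<^sub>M \<nu>) = sets ((borel :: 'a measure) \<Otimes>\<^sub>M (borel :: 'b measure))"
    by (intro sets_pair_measure_cong sets)
  then have sets_pair: "sets (\<mu> \<Otimes>\<^sub>M \<nu>) = sets borel" by (simp only: borel_prod)
  have "emeasure (\<mu> \<Otimes>\<^sub>M \<nu>) (- (S \<times> T)) = 0"
  proof -
    have "(- S) \<times> UNIV \<in> null_sets (\<mu> \<Otimes>\<^sub>M \<nu>)"
      using null closed sets space N.emeasure_pair_measure_Times[of "- S" \<mu> UNIV] sets.top[of \<nu>]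
      by (intro null_setsI) (auto simp: open_Times borel_open sets_pair)
    moreover have "UNIV \<times> (- T) \<in> null_sets (\<mu> \<Otimes>\<^sub>M \<nu>)"
      using null closed sets space N.emeasure_pair_measure_Times[of UNIV \<mu> "- T"] sets.top[of \<mu>]
      by (intro null_setsI) (auto simp: open_Times borel_open sets_pair)
    ultimately have "(- S) \<times> UNIV \<union> UNIV \<times> (- T) \<in> null_sets (\<mu> \<Otimes>\<^sub>M \<nu>)" by auto
    moreover have "- (S \<times> T) = (- S) \<times> UNIV \<union> UNIV \<times> (- T)" by auto
    ultimately show ?thesis by auto
  qed
  moreover have "0 < emeasure (\<mu> \<Otimes>\<^sub>M \<nu>) U" if x: "x \<in> S \<times> T" "open U" "x \<in> U" for x U
  proof -
    obtain V W where VW: "open V" "open W" "x \<in> V \<times> W" "V \<times> W \<subseteq> U"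
      using x(2,3) by (rule open_prod_elim)
    then have "0 < emeasure \<mu> V" "0 < emeasure \<nu> W"
      using \<mu> \<nu> x(1) unfolding finite_measure_supported_on_def by (auto simp: mem_Times_iff)
    then have "0 < emeasure \<mu> V * emeasure \<nu> W" by (simp add: ennreal_zero_less_mult_iff)
    also have "\<dots> = emeasure (\<mu> \<Otimes>\<^sub>M \<nu>) (V \<times> W)"
      using VW sets by (intro N.emeasure_pair_measure_Times[symmetric]) auto
    also have "\<dots> \<le> emeasure (\<mu> \<Otimes>\<^sub>M \<nu>) U"
      using VW x sets_pair by (intro emeasure_mono) auto
    finally show ?thesis .
  qed
  ultimately show ?thesis
    unfolding finite_measure_supported_on_def
    using sets_pair finite_measure_pair_measure[OF N.finite_measure_axioms M.finite_measure_axioms] by blast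
qed

lemma prod_ennreal_pos:
  fixes f :: "'i \<Rightarrow> ennreal"
  assumes "\<And>i. 0 < f i" shows "0 < (\<Prod>i\<in>A. f i)"
  by (induction A rule: infinite_finite_induct) (simp_all add: assms ennreal_zero_less_mult_iff)

lemma continuous_on_vec_nth: "continuous_on UNIV (\<lambda>p::'v::euclidean_space^'n::finite. p $ i)"
  by (intro continuous_intros)

lemma measurable_vec_lambda:
  assumes "sets \<mu> = sets (borel :: 'v::euclidean_space measure)"
  shows "(\<lambda>f. \<chi> i. f i) \<in> (\<Pi>\<^sub>M i\<in>(UNIV::'n::finite set). \<mu>) \<rightarrow>\<^sub>M borel"
proof (rule iffD2[OF borel_measurable_euclidean_space], rule ballI)
  fix b :: "'v^'n" assume "b \<in> Basis"
  have comp: "(\<lambda>f. f i) \<in> (\<Pi>\<^sub>M i\<in>(UNIV::'n set). \<mu>) \<rightarrow>\<^sub>M borel" for i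
    using measurable_component_singleton[of i UNIV "\<lambda>_. \<mu>"] measurable_cong_sets[OF refl assms] by blast
  have "(\<lambda>f. (\<chi> i. f i) \<bullet> b) = (\<lambda>f. \<Sum>i\<in>UNIV. f i \<bullet> (b $ i))"
    by (simp add: inner_vec_def)
  moreover have "\<dots> \<in> (\<Pi>\<^sub>M i\<in>(UNIV::'n set). \<mu>) \<rightarrow>\<^sub>M borel"
    by (intro borel_measurable_sum borel_measurable_inner comp borel_measurable_const)
  ultimately show "(\<lambda>f. (\<chi> i. f i) \<bullet> b) \<in> (\<Pi>\<^sub>M i\<in>(UNIV::'n set). \<mu>) \<rightarrow>\<^sub>M borel" by simp
qed

lemma closed_power_set: "closed P \<Longrightarrow> closed (power_set P :: ('v::euclidean_space^'n::finite) set)"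
proof -
  assume P: "closed P"
  have "(power_set P :: ('v^'n) set) = (\<Inter>i. (\<lambda>p. p $ i) -` P)"
    by (auto simp: power_set_def)
  also have "closed \<dots>"
    by (intro closed_INT ballI closed_vimage P continuous_on_vec_nth)
  finally show ?thesis .
qed

lemma compact_power_set:
  assumes P: "compact P" shows "compact (power_set P :: ('v::euclidean_space^'n::finite) set)"
proof -
  obtain C where C: "\<And>x. x \<in> P \<Longrightarrow> norm x \<le> C"
    using compact_imp_bounded[OF P] by (auto simp: bounded_iff)
  have "norm p \<le> (\<Sum>i\<in>(UNIV::'n set). C)" if "p \<in> power_set P" for p :: "'v^'n"
  proof -
    have "norm p \<le> (\<Sum>i\<in>UNIV. norm (p $ i))"
      unfolding norm_vec_def by (rule L2_set_le_sum) simp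
    also have "\<dots> \<le> (\<Sum>i\<in>(UNIV::'n set). C)"
      using that C by (intro sum_mono) (auto simp: power_set_def)
    finally show ?thesis .
  qed
  then have "bounded (power_set P :: ('v^'n) set)" unfolding bounded_iff by blast
  then show ?thesis using closed_power_set compact_imp_closed[OF P] by (simp add: compact_eq_bounded_closed)
qed

lemma finite_measure_supported_on_power:
  fixes \<mu> :: "'v::euclidean_space measure"
  assumes \<mu>: "finite_measure_supported_on \<mu> S" and closed: "closed S"
  shows "finite_measure_supported_on (power_measure \<mu> :: ('v^'n::finite) measure) (power_set S)"
proof -
  let ?P = "\<Pi>\<^sub>M i\<in>(UNIV::'n set). \<mu>"
  interpret M: finite_measure \<mu> using \<mu> by (simp add: finite_measure_supported_on_def)
  interpret product_sigma_finite "\<lambda>_::'n. \<mu>" by standard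
  have sets: "sets \<mu> = sets borel" using \<mu> by (simp add: finite_measure_supported_on_def)
  have space: "space \<mu> = UNIV" using sets[THEN sets_eq_imp_space_eq] by simp
  have meas: "(\<lambda>f. \<chi> i. f i) \<in> ?P \<rightarrow>\<^sub>M (borel :: ('v^'n) measure)"
    by (rule measurable_vec_lambda[OF sets])
  have box: "emeasure ?P (PiE UNIV A) = (\<Prod>i\<in>UNIV. emeasure \<mu> (A i))" if "\<And>i. A i \<in> sets \<mu>" for A :: "'n \<Rightarrow> 'v set"
    using that by (intro emeasure_PiM) auto
  have spaceP: "space ?P = UNIV" by (auto simp: space_PiM space)
  have emeas: "emeasure (power_measure \<mu>) X = emeasure ?P ((\<lambda>f. \<chi> i. f i) -` X)" if "X \<in> sets borel" for X :: "('v^'n) set"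
    unfolding power_measure_def using that meas by (simp add: emeasure_distr spaceP)
  have fin: "finite_measure (power_measure \<mu> :: ('v^'n) measure)"
  proof (rule finite_measureI)
    have "emeasure (power_measure \<mu>) (UNIV :: ('v^'n) set) = emeasure ?P (PiE UNIV (\<lambda>_. UNIV))"
      by (simp add: emeas)
    also have "\<dots> = (\<Prod>i\<in>(UNIV::'n set). emeasure \<mu> UNIV)"
      using sets by (intro box) simp
    also have "\<dots> \<noteq> \<infinity>" using M.emeasure_finite by (simp add: ennreal_prod_eq_top power_eq_top_ennreal)
    finally show "emeasure (power_measure \<mu>) (space (power_measure \<mu> :: ('v^'n) measure)) \<noteq> \<infinity>"
      by (simp add: power_measure_def)
  qed
  have "emeasure (power_measure \<mu>) (- power_set S :: ('v^'n) set) = 0"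
  proof -
    have Sb: "- S \<in> sets \<mu>" using closed sets by (simp add: borel_open open_Compl)
    have "PiE UNIV (\<lambda>j. if j = i then - S else UNIV) \<in> null_sets ?P" for i :: 'n
    proof (rule null_setsI)
      have A: "(if j = i then - S else UNIV) \<in> sets \<mu>" for j using Sb sets by auto
      then show "PiE UNIV (\<lambda>j. if j = i then - S else UNIV) \<in> sets ?P"
        by (intro sets_PiM_I_finite) auto
      have "emeasure ?P (PiE UNIV (\<lambda>j. if j = i then - S else UNIV)) = (\<Prod>j\<in>UNIV. emeasure \<mu> (if j = i then - S else UNIV))"
        by (intro box A)
      also have "\<dots> = 0"
        using \<mu> by (intro prod_zero bexI[of _ i]) (auto simp: finite_measure_supported_on_def)
      finally show "emeasure ?P (PiE UNIV (\<lambda>j. if j = i then - S else UNIV)) = 0" .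
    qed
    then have "(\<Union>i. PiE UNIV (\<lambda>j. if j = i then - S else UNIV)) \<in> null_sets ?P" 
      by (intro null_sets_UN') (auto intro: countable_finite)
    moreover have "(\<lambda>f. \<chi> i. f i) -` (- power_set S :: ('v^'n) set) = (\<Union>i. PiE UNIV (\<lambda>j. if j = i then - S else UNIV))"
      by (auto simp: power_set_def PiE_def Pi_def)
    ultimately show ?thesis
      using closed_power_set[OF closed] by (subst emeas) (auto intro!: borel_open simp: open_Compl)
  qed
  moreover have "0 < emeasure (power_measure \<mu>) U" if x: "x \<in> power_set S" "open U" "x \<in> U" for x :: "'v^'n" and U
  proof -
    obtain e where e: "0 < e" "\<And>y. dist y x < e \<Longrightarrow> y \<in> U"
      using x(2,3) by (auto simp: open_dist)
    \<comment> \<open>The distance in the power is at most the sum of the distances of the coordinates.\<close>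
    define d where "d = e / real CARD('n)"
    have d: "0 < d" using e by (simp add: d_def)
    let ?B = "PiE UNIV (\<lambda>i::'n. ball (x $ i) d)"
    have Bs: "ball (x $ i) d \<in> sets \<mu>" for i using sets by simp
    have "0 < emeasure \<mu> (ball (x $ i) d)" for i
    proof -
      have "x $ i \<in> S" using x(1) by (simp add: power_set_def)
      moreover have "open (ball (x $ i) d)" "x $ i \<in> ball (x $ i) d" using d by auto
      ultimately show ?thesis using \<mu> unfolding finite_measure_supported_on_def by blast
    qed
    then have "0 < (\<Prod>i\<in>(UNIV::'n set). emeasure \<mu> (ball (x $ i) d))"
      by (rule prod_ennreal_pos)
    also have "\<dots> = emeasure ?P ?B" by (intro box[symmetric] Bs)
    also have "\<dots> \<le> emeasure ?P ((\<lambda>f. \<chi> i. f i) -` U)"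
    proof (rule emeasure_mono)
      show "?B \<subseteq> (\<lambda>f. \<chi> i. f i) -` U"
      proof
        fix f assume f: "f \<in> ?B"
        have near: "dist (f i) (x $ i) < d" for i
          using f by (auto simp: PiE_def Pi_def dist_commute)
        have "dist (\<chi> i. f i) x \<le> (\<Sum>i\<in>UNIV. dist (f i) (x $ i))"
          unfolding dist_vec_def using L2_set_le_sum[of UNIV "\<lambda>i. dist (f i) (x $ i)"] by simp
        also have "\<dots> < (\<Sum>i\<in>(UNIV::'n set). d)"
          using near by (intro sum_strict_mono) auto
        also have "\<dots> = e" by (simp add: d_def)
        finally show "f \<in> (\<lambda>f. \<chi> i. f i) -` U" using e(2) by simp
      qed
      show "(\<lambda>f. \<chi> i. f i) -` U \<in> sets ?P"
        using measurable_sets[OF meas borel_open[OF x(2)]] by (simp add: spaceP)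
    qed
    also have "\<dots> = emeasure (power_measure \<mu>) U"
      using x(2) by (simp add: emeas)
    finally show ?thesis .
  qed
  ultimately show ?thesis
    unfolding finite_measure_supported_on_def using fin by (auto simp: power_measure_def)
qed

text \<open>Counting measures on finite sets have full support, so that finite convergence is obtained
  from the same scheme as accuracy.\<close>

lemma finite_measure_supported_on_counting:
  fixes V :: "'v::euclidean_space set"
  assumes V: "finite V"
  shows "finite_measure_supported_on (counting_measure_on V) V"
proof -
  have meas: "(\<lambda>x. x) \<in> count_space V \<rightarrow>\<^sub>M (borel :: 'v measure)" by simp
  have em: "emeasure (counting_measure_on V) X = of_nat (card (X \<inter> V))" if "X \<in> sets borel" for X
    unfolding counting_measure_on_def using that meas V
    by (simp add: emeasure_distr emeasure_count_space_finite)
  have "closed V" using V by (rule finite_imp_closed)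
  then have "emeasure (counting_measure_on V) (- V) = 0"
    by (subst em) (auto simp: borel_open open_Compl)
  moreover have "finite_measure (counting_measure_on V)"
    by (rule finite_measureI) (simp add: em counting_measure_on_def[THEN arg_cong[of _ _ space]] ennreal_of_nat_neq_top)
  moreover have "0 < emeasure (counting_measure_on V) U" if "x \<in> V" "open U" "x \<in> U" for x U
  proof -
    have "0 < card (U \<inter> V)" using that V by (auto simp: card_gt_0_iff)
    then show ?thesis using that by (simp add: em)
  qed
  ultimately show ?thesis
    unfolding finite_measure_supported_on_def by (auto simp: counting_measure_on_def)
qed

section \<open>Graded cones and their slices\<close>

text \<open>What an object and its dual have in common. Slices and tensor products are studied under
  this predicate, so that \<open>A\<close>, \<open>B\<close> and the dual of \<open>B\<close> are treated at once.\<close>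

definition graded_cone :: "'v::euclidean_space mc_obj \<Rightarrow> bool" where
  "graded_cone X \<longleftrightarrow> convex_cone (cone_of X) \<and> closed (cone_of X) \<and> is_grading (cone_of X) (grad X) \<and>
     sect X 1 \<in> slice X"

lemma MC_object_graded_cone: "MC_object X \<Longrightarrow> graded_cone X"
  unfolding MC_object_def AC_object_def graded_cone_def slice_def
  using interior_subset by blast

lemma linear_grad: "graded_cone X \<Longrightarrow> linear (grad X)"
  by (simp add: graded_cone_def is_grading_def)

lemma subspace_espace: "graded_cone X \<Longrightarrow> subspace (espace X)"
  using linear_grad[of X] by (simp add: espace_def subspace_def linear_0 linear_add linear_scale)

lemma convex_slice:
  assumes "graded_cone X" shows "convex (slice X)"
proof -
  have "convex {x. grad X x = 1}"
  proof -
    have "{x. grad X x = 1} = grad X -` {1}" by auto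
    then show ?thesis using linear_grad[OF assms] by (simp add: convex_linear_vimage)
  qed
  then show ?thesis
    unfolding slice_def using assms by (intro convex_Int) (auto simp: graded_cone_def convex_cone_def)
qed

lemma closed_grad_level: "graded_cone X \<Longrightarrow> closed {x. grad X x = t}"
  using linear_continuous_on[of "grad X" UNIV] linear_grad[of X]
  by (intro closed_Collect_eq) (auto simp: linear_conv_bounded_linear)

text \<open>The grading is bounded below by a positive constant on the unit vectors of the cone.\<close>

lemma compact_slice:
  fixes X :: "'v::euclidean_space mc_obj"
  assumes X: "graded_cone X" shows "compact (slice X)"
proof -
  have cl: "closed (slice X)"
    unfolding slice_def using X closed_grad_level[OF X] by (auto simp: graded_cone_def)
  have g: "continuous_on UNIV (grad X)"
    using linear_grad[OF X] by (simp add: linear_conv_bounded_linear linear_continuous_on)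
  let ?N = "cone_of X \<inter> sphere 0 1"
  have pos: "0 < grad X x" if "x \<in> ?N" for x
  proof -
    have "x \<noteq> 0" using that by auto
    then have "grad X x \<noteq> 0" using X that by (auto simp: graded_cone_def is_grading_def)
    then show ?thesis using X that by (force simp: graded_cone_def is_grading_def)
  qed
  have "\<exists>\<delta>>0. \<forall>x\<in>?N. \<delta> \<le> grad X x"
  proof (cases "?N = {}")
    case True
    then show ?thesis by (intro exI[of _ 1]) auto
  next
    case False
    have "compact ?N" using X by (intro closed_Int_compact) (auto simp: graded_cone_def)
    then obtain x where "x \<in> ?N" "\<forall>y\<in>?N. grad X x \<le> grad X y"
      using continuous_attains_inf[OF _ False continuous_on_subset[OF g]] by blast
    then show ?thesis using pos by (intro exI[of _ "grad X x"]) auto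
  qed
  then obtain \<delta> where \<delta>: "0 < \<delta>" "\<And>x. x \<in> ?N \<Longrightarrow> \<delta> \<le> grad X x" by blast
  have "norm x \<le> 1 / \<delta>" if "x \<in> slice X" for x
  proof (cases "x = 0")
    case False
    have "(1 / norm x) *\<^sub>R x \<in> ?N"
      using that False X by (auto simp: slice_def graded_cone_def convex_cone_iff)
    then have "\<delta> \<le> grad X ((1 / norm x) *\<^sub>R x)" by (rule \<delta>(2))
    also have "\<dots> = 1 / norm x" using that linear_grad[OF X] by (simp add: linear_scale slice_def)
    finally show ?thesis using \<delta>(1) False by (simp add: field_simps)
  qed (use \<delta> in simp)
  then have "bounded (slice X)" unfolding bounded_iff by blast
  with cl show ?thesis by (simp add: compact_eq_bounded_closed)
qed

lemma cone_of_eq_scaled_slice: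
  assumes X: "graded_cone X" and x: "x \<in> cone_of X"
  obtains c p where "0 \<le> c" "p \<in> slice X" "x = c *\<^sub>R p"
proof (cases "x = 0")
  case True
  then show ?thesis using X that[of 0 "sect X 1"] by (simp add: graded_cone_def)
next
  case False
  then have "grad X x \<noteq> 0" using X x by (auto simp: graded_cone_def is_grading_def)
  moreover have "0 \<le> grad X x" using X x by (auto simp: graded_cone_def is_grading_def)
  ultimately have pos: "0 < grad X x" by simp
  have "(1 / grad X x) *\<^sub>R x \<in> slice X"
    using X x pos linear_grad[OF X] by (auto simp: slice_def graded_cone_def convex_cone_iff linear_scale)
  then show ?thesis using that[of "grad X x" "(1 / grad X x) *\<^sub>R x"] pos by simp
qed

lemma slice_subset_cone: "slice X \<subseteq> cone_of X"
  by (auto simp: slice_def)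

lemma slice_diff_espace:
  assumes "graded_cone X" "grad X x = 1" shows "x - sect X 1 \<in> espace X"
  using assms linear_grad[OF assms(1)] by (simp add: espace_def linear_diff graded_cone_def slice_def)

lemma finite_vertices_slice:
  fixes X :: "'v::euclidean_space mc_obj"
  assumes X: "graded_cone X" and "polyhedron (cone_of X)"
  shows "finite (vertices (slice X))"
proof -
  obtain a where a: "\<And>x. grad X x = a \<bullet> x"
  proof -
    have "grad X x = (\<Sum>b\<in>Basis. grad X b *\<^sub>R b) \<bullet> x" for x
    proof -
      have "grad X x = grad X (\<Sum>b\<in>Basis. (x \<bullet> b) *\<^sub>R b)" by (simp add: euclidean_representation)
      also have "\<dots> = (\<Sum>b\<in>Basis. grad X b *\<^sub>R b) \<bullet> x"
        using linear_grad[OF X]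
        by (simp add: linear_sum linear_scale inner_sum_left inner_sum_right inner_commute[of _ x] mult.commute)
      finally show ?thesis .
    qed
    then show ?thesis using that by blast
  qed
  have "polyhedron (slice X)"
    unfolding slice_def a using assms(2) polyhedron_hyperplane by blast
  then show ?thesis unfolding vertices_def by (rule finite_polyhedron_extreme_points)
qed

lemma convex_hull_vertices_slice:
  "graded_cone X \<Longrightarrow> convex hull (vertices (slice X)) = slice X"
  unfolding vertices_def by (rule Krein_Milman_Minkowski[OF compact_slice convex_slice, symmetric])

lemma vertices_subset: "vertices P \<subseteq> P"
  by (auto simp: vertices_def extreme_point_of_def)

text \<open>Normalising the generators of a cone to degree one exhibits it as the cone over their hull.\<close>

lemma cone_hull_convex_hull_generators:
  assumes "\<And>x. x \<in> G \<Longrightarrow> x \<in> G'" "\<And>x. x \<in> G' \<Longrightarrow> \<exists>c\<ge>0. \<exists>y\<in>G. x = c *\<^sub>R y" "G \<noteq> {}"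
  shows "cone hull (convex hull G) = convex_cone hull G'"
proof
  show "cone hull (convex hull G) \<subseteq> convex_cone hull G'"
  proof (rule hull_minimal)
    show "convex hull G \<subseteq> convex_cone hull G'"
      using assms(1) by (intro hull_minimal convex_convex_cone_hull) (auto intro: hull_inc)
    show "cone (convex_cone hull G')"
      by (simp add: cone_def convex_cone_hull_mul)
  qed
  show "convex_cone hull G' \<subseteq> cone hull (convex hull G)"
  proof (rule hull_minimal)
    show "G' \<subseteq> cone hull (convex hull G)"
    proof
      fix x assume "x \<in> G'"
      then obtain c y where "0 \<le> c" "y \<in> G" "x = c *\<^sub>R y" using assms(2) by blast
      then show "x \<in> cone hull (convex hull G)" by (auto intro: mem_cone_hull hull_inc)
    qed
    have "cone hull (convex hull G) \<noteq> {}" using assms(3) cone_hull_empty_iff[of "convex hull G"] by simp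
    then show "convex_cone (cone hull (convex hull G))"
      unfolding convex_cone_def conic_def
      using convex_cone_hull[OF convex_convex_hull, of G] cone_cone_hull[of "convex hull G"]
      by (auto simp: cone_def)
  qed
qed

lemma closed_cone_hull_compact:
  fixes K :: "'a::euclidean_space set"
  assumes "compact K" "0 \<notin> K"
  shows "closed (cone hull K)"
proof -
  have "(cone :: 'a set \<Rightarrow> bool) = conic" by (auto simp: cone_def conic_def fun_eq_iff)
  then show ?thesis using closed_conic_hull[of K] assms by simp
qed

text \<open>Approximation of the base yields approximation of the cone. As the base is compact and
  embedded away from the origin, the cone over it is closed.\<close>

lemma closure_Union_cone_hull:
  fixes P :: "nat \<Rightarrow> 'a::euclidean_space set" and f :: "'a \<Rightarrow> 'b::euclidean_space"
  assumes f: "continuous_on UNIV f" and K: "closure (\<Union>k. P k) = K" "compact K" "0 \<notin> f ` K"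
  shows "closure (\<Union>k. cone hull (f ` P k)) = cone hull (f ` K)"
proof
  have "P k \<subseteq> K" for k
    unfolding K(1)[symmetric] by (rule order_trans[OF _ closure_subset]) auto
  then have "cone hull (f ` P k) \<subseteq> cone hull (f ` K)" for k
    by (intro hull_mono image_mono)
  moreover have "closed (cone hull (f ` K))"
    using K continuous_on_subset[OF f] by (intro closed_cone_hull_compact compact_continuous_image) auto
  ultimately show "closure (\<Union>k. cone hull (f ` P k)) \<subseteq> cone hull (f ` K)"
    by (intro closure_minimal) auto
  show "cone hull (f ` K) \<subseteq> closure (\<Union>k. cone hull (f ` P k))"
  proof
    fix z assume "z \<in> cone hull (f ` K)"
    then obtain c x where z: "0 \<le> c" "x \<in> K" "z = c *\<^sub>R f x"
      by (auto simp: cone_hull_expl)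
    let ?g = "\<lambda>x. c *\<^sub>R f x"
    have "?g ` closure (\<Union>k. P k) \<subseteq> closure (\<Union>k. cone hull (f ` P k))"
    proof (rule image_closure_subset)
      show "continuous_on (closure (\<Union>k. P k)) ?g"
        by (intro continuous_intros continuous_on_subset[OF f]) simp
      show "?g ` (\<Union>k. P k) \<subseteq> closure (\<Union>k. cone hull (f ` P k))"
      proof (rule order_trans[OF _ closure_subset], clarify)
        fix x k assume "x \<in> P k"
        then have "c *\<^sub>R f x \<in> cone hull (f ` P k)" using z(1) by (intro mem_cone_hull) auto
        then show "c *\<^sub>R f x \<in> (\<Union>k. cone hull (f ` P k))" by blast
      qed
    qed simp
    then show "z \<in> closure (\<Union>k. cone hull (f ` P k))" using z K(1) by blast
  qed
qed

section \<open>Affine maps and convex hulls\<close>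

definition affine_map :: "('a::real_vector \<Rightarrow> 'b::real_vector) \<Rightarrow> bool" where
  "affine_map f \<longleftrightarrow> (\<forall>x y u v. u + v = 1 \<longrightarrow> f (u *\<^sub>R x + v *\<^sub>R y) = u *\<^sub>R f x + v *\<^sub>R f y)"

lemma affine_map_add_linear: "linear f \<Longrightarrow> affine_map (\<lambda>x. c + f x)"
  unfolding affine_map_def
proof (intro allI impI)
  fix x y and u v :: real
  assume f: "linear f" and uv: "u + v = 1"
  have "c = u *\<^sub>R c + v *\<^sub>R c" using uv by (simp add: scaleR_left_distrib[symmetric])
  then show "c + f (u *\<^sub>R x + v *\<^sub>R y) = u *\<^sub>R (c + f x) + v *\<^sub>R (c + f y)"
    using f by (simp add: linear_add linear_scale scaleR_right_distrib add_ac)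
qed

lemma convex_affine_vimage: "affine_map f \<Longrightarrow> convex H \<Longrightarrow> convex {x. f x \<in> H}"
  unfolding convex_def affine_map_def by simp

lemma affine_map_in_convex_hull:
  assumes f: "affine_map f" and H: "convex H" "\<And>x. x \<in> X \<Longrightarrow> f x \<in> H" and x: "x \<in> convex hull X"
  shows "f x \<in> H"
proof -
  have "convex hull X \<subseteq> {x. f x \<in> H}"
    using assms by (intro hull_minimal convex_affine_vimage) auto
  then show ?thesis using x by auto
qed

lemma affine_map_image_convex_hull:
  assumes f: "affine_map f" shows "f ` (convex hull X) = convex hull (f ` X)"
proof
  show "f ` (convex hull X) \<subseteq> convex hull (f ` X)"
  proof clarify
    fix x assume x: "x \<in> convex hull X"
    show "f x \<in> convex hull (f ` X)"
      by (rule affine_map_in_convex_hull[OF f convex_convex_hull _ x]) (simp add: hull_inc)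
  qed
  show "convex hull (f ` X) \<subseteq> f ` (convex hull X)"
  proof (rule hull_minimal)
    show "convex (f ` (convex hull X))"
    proof (rule convexI)
      fix p q and u v :: real
      assume "p \<in> f ` (convex hull X)" "q \<in> f ` (convex hull X)" and uv: "0 \<le> u" "0 \<le> v" "u + v = 1"
      then obtain x y where xy: "x \<in> convex hull X" "y \<in> convex hull X" "p = f x" "q = f y" by blast
      have "u *\<^sub>R x + v *\<^sub>R y \<in> convex hull X"
        using convexD[OF convex_convex_hull xy(1,2) uv] .
      moreover have "u *\<^sub>R p + v *\<^sub>R q = f (u *\<^sub>R x + v *\<^sub>R y)"
        using f uv(3) xy by (simp add: affine_map_def)
      ultimately show "u *\<^sub>R p + v *\<^sub>R q \<in> f ` (convex hull X)" by simp
    qed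
  qed (auto intro: hull_inc)
qed

text \<open>The functional \<open>L\<close> will be the grading of the cone spanned by \<open>X\<close>.\<close>

lemma zero_notin_convex_hull:
  fixes L :: "'a::real_vector \<Rightarrow> real"
  assumes L: "linear L" "\<And>x. x \<in> X \<Longrightarrow> L x = 1"
  shows "0 \<notin> convex hull X"
proof
  assume "0 \<in> convex hull X"
  moreover have "affine_map L" using affine_map_add_linear[OF L(1), of 0] by simp
  ultimately have "L 0 \<in> {1}" using affine_map_in_convex_hull[of L "{1}" X 0] L(2) by auto
  then show False using L(1) by (simp add: linear_0)
qed


section \<open>Duality of graded cones\<close>

lemma grad_mc_dual:
  assumes "MC_object B" shows "grad (mc_dual B) \<phi> = \<phi> \<bullet> sect B 1"
proof -
  have "linear (sect B)" using assms by (simp add: MC_object_def AC_hom_def)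
  then have "1 \<bullet> adjoint (sect B) \<phi> = sect B 1 \<bullet> \<phi>" by (rule adjoint_works)
  then show ?thesis by (simp add: mc_dual_def inner_commute)
qed

lemma sect_mc_dual:
  assumes "MC_object B" shows "sect (mc_dual B) 1 \<bullet> x = grad B x"
proof -
  have "linear (grad B)" using assms by (simp add: MC_object_def AC_hom_def)
  then have "x \<bullet> adjoint (grad B) 1 = grad B x \<bullet> 1" by (rule adjoint_works)
  then show ?thesis by (simp add: mc_dual_def inner_commute)
qed

lemma cone_of_mc_dual: "cone_of (mc_dual B) = dual_cone (cone_of B)"
  by (simp add: mc_dual_def)

text \<open>A functional in the dual cone that vanishes at the interior point \<open>sect B 1\<close> would become
  negative at a nearby point of the cone unless it is zero; so evaluation there is a grading.\<close>

lemma graded_cone_mc_dual: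
  assumes B: "MC_object B" shows "graded_cone (mc_dual B)"
proof -
  let ?s = "sect B 1" and ?C = "cone_of B"
  have s: "?s \<in> interior ?C" using B by (simp add: MC_object_def)
  then have sC: "?s \<in> ?C" using interior_subset by blast
  have dual: "dual_cone ?C = (\<Inter>x\<in>?C. {\<phi>. x \<bullet> \<phi> \<ge> 0})"
    by (auto simp: dual_cone_def inner_commute)
  have "convex_cone (dual_cone ?C)"
    by (auto simp: dual_cone_def convex_cone_iff inner_add_left)
  moreover have "closed (dual_cone ?C)"
    unfolding dual by (intro closed_INT ballI closed_halfspace_ge)
  moreover have "is_grading (dual_cone ?C) (grad (mc_dual B))"
    unfolding is_grading_def
  proof (intro conjI ballI)
    have "linear (sect B)" using B by (simp add: MC_object_def AC_hom_def)
    then show "linear (grad (mc_dual B))" by (simp add: mc_dual_def adjoint_linear)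
    show "0 \<le> grad (mc_dual B) \<phi>" if "\<phi> \<in> dual_cone ?C" for \<phi>
      using that sC by (simp add: grad_mc_dual[OF B] dual_cone_def)
    show "dual_cone ?C \<inter> {\<phi>. grad (mc_dual B) \<phi> = 0} = {0}"
    proof -
      have "\<phi> = 0" if \<phi>: "\<phi> \<in> dual_cone ?C" "\<phi> \<bullet> ?s = 0" for \<phi>
      proof (rule ccontr)
        assume nz: "\<phi> \<noteq> 0"
        obtain e where e: "0 < e" "cball ?s e \<subseteq> ?C"
          using s by (meson mem_interior_cball)
        let ?x = "?s - (e / norm \<phi>) *\<^sub>R \<phi>"
        have "dist ?s ?x \<le> e" using e nz by (simp add: dist_norm)
        then have "?x \<in> ?C" using e by auto
        then have "0 \<le> \<phi> \<bullet> ?x" using \<phi> by (simp add: dual_cone_def)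
        also have "\<phi> \<bullet> ?x = - (e / norm \<phi>) * (\<phi> \<bullet> \<phi>)" using \<phi> by (simp add: inner_diff_right)
        also have "\<dots> < 0" using e nz by (simp add: mult_pos_pos)
        finally show False by simp
      qed
      then show ?thesis by (auto simp: grad_mc_dual[OF B] dual_cone_def)
    qed
  qed
  moreover have "sect (mc_dual B) 1 \<in> slice (mc_dual B)"
    using B sect_mc_dual[OF B]
    by (auto simp: slice_def cone_of_mc_dual dual_cone_def grad_mc_dual[OF B] MC_object_def is_grading_def)
  ultimately show ?thesis by (simp add: graded_cone_def cone_of_mc_dual)
qed

lemma dual_cone_bidual:
  fixes C :: "'v::euclidean_space set"
  assumes C: "convex_cone C" "closed C" and x: "\<And>\<phi>. \<phi> \<in> dual_cone C \<Longrightarrow> 0 \<le> \<phi> \<bullet> x"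
  shows "x \<in> C"
proof (rule ccontr)
  assume "x \<notin> C"
  moreover have "convex C" using C(1) by (simp add: convex_cone_def)
  ultimately obtain a b where ab: "a \<bullet> x < b" "\<And>y. y \<in> C \<Longrightarrow> b < a \<bullet> y"
    using separating_hyperplane_closed_point[of C x] C(2) by blast
  have b: "b < 0" using ab(2)[OF convex_cone_contains_0[OF C(1)]] by simp
  have "0 \<le> a \<bullet> y" if y: "y \<in> C" for y
  proof (rule ccontr)
    assume neg: "\<not> 0 \<le> a \<bullet> y"
    have "(b / (a \<bullet> y)) *\<^sub>R y \<in> C"
      using neg b y by (intro convex_cone_scaleR[OF C(1)]) (auto simp: divide_nonpos_neg)
    then show False using ab(2)[of "(b / (a \<bullet> y)) *\<^sub>R y"] neg by simp
  qed
  then have "a \<in> dual_cone C" by (simp add: dual_cone_def)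
  then show False using x[of a] ab(1) b by simp
qed

lemma vertices_slice_nonempty: "graded_cone X \<Longrightarrow> vertices (slice X) \<noteq> {}"
  using convex_hull_vertices_slice[of X] by (auto simp: graded_cone_def)

lemma cone_hull_vertices:
  assumes X: "graded_cone X"
  shows "cone_of X = convex_cone hull (vertices (slice X))"
proof
  show "convex_cone hull (vertices (slice X)) \<subseteq> cone_of X"
    using X vertices_subset[of "slice X"] slice_subset_cone[of X]
    by (intro hull_minimal) (auto simp: graded_cone_def)
  show "cone_of X \<subseteq> convex_cone hull (vertices (slice X))"
  proof
    fix x assume "x \<in> cone_of X"
    then obtain c p where "0 \<le> c" "p \<in> slice X" "x = c *\<^sub>R p" by (rule cone_of_eq_scaled_slice[OF X])
    moreover then have "p \<in> convex_cone hull (vertices (slice X))"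
      using convex_hull_vertices_slice[OF X] convex_hull_subset_convex_cone_hull by blast
    ultimately show "x \<in> convex_cone hull (vertices (slice X))" by (simp add: convex_cone_hull_mul)
  qed
qed

lemma polyhedron_dual_cone:
  fixes C :: "'v::euclidean_space set"
  assumes "C = convex_cone hull V" "finite V" shows "polyhedron (dual_cone C)"
proof -
  have "dual_cone C = (\<Inter>v\<in>V. {\<phi>. v \<bullet> \<phi> \<ge> 0})"
  proof
    show "dual_cone C \<subseteq> (\<Inter>v\<in>V. {\<phi>. v \<bullet> \<phi> \<ge> 0})"
      using assms(1) by (auto simp: dual_cone_def inner_commute intro: hull_inc)
    show "(\<Inter>v\<in>V. {\<phi>. v \<bullet> \<phi> \<ge> 0}) \<subseteq> dual_cone C"
    proof
      fix \<phi> assume \<phi>: "\<phi> \<in> (\<Inter>v\<in>V. {\<phi>. v \<bullet> \<phi> \<ge> 0})"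
      have "C \<subseteq> {x. \<phi> \<bullet> x \<ge> 0}"
        unfolding assms(1) using \<phi> by (intro hull_minimal convex_cone_halfspace_ge) (auto simp: inner_commute)
      then show "\<phi> \<in> dual_cone C" by (auto simp: dual_cone_def)
    qed
  qed
  also have "polyhedron \<dots>"
    using assms(2) by (intro polyhedron_Inter) (auto simp: polyhedron_halfspace_ge)
  finally show ?thesis .
qed


section \<open>Tensor products\<close>

lemma linear_tensor_left: "linear (\<lambda>a. tensor a b)"
  by (rule linearI) (simp_all add: tensor_def vec_eq_iff algebra_simps)

lemma linear_tensor_right: "linear (tensor a)"
  by (rule linearI) (simp_all add: tensor_def vec_eq_iff algebra_simps)

lemmas tensor_left_simps =
  linear_add[OF linear_tensor_left] linear_diff[OF linear_tensor_left]
  linear_scale[OF linear_tensor_left] linear_0[OF linear_tensor_left]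

lemmas tensor_right_simps =
  linear_add[OF linear_tensor_right] linear_diff[OF linear_tensor_right]
  linear_scale[OF linear_tensor_right] linear_0[OF linear_tensor_right]

lemma continuous_tensor:
  "continuous_on S f \<Longrightarrow> continuous_on S g \<Longrightarrow> continuous_on S (\<lambda>x. tensor (f x) (g x))"
  unfolding tensor_def by (intro continuous_intros)

lemma tensor_map_apply:
  "tensor_map A B (a, b) = (a - sect A 1, b - sect B 1, tensor (a - sect A 1) (b - sect B 1))"
  by (simp add: tensor_map_def Let_def)

lemma continuous_tensor_map: "continuous_on UNIV (tensor_map A B)"
  unfolding tensor_map_def Let_def by (intro continuous_intros continuous_tensor)

lemma tensor_map_in_tensor_space:
  assumes "graded_cone A" "graded_cone B" "grad A a = 1" "grad B b = 1"
  shows "tensor_map A B (a, b) \<in> tensor_space A B"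
  unfolding tensor_map_apply tensor_space_def
  using slice_diff_espace[OF assms(1,3)] slice_diff_espace[OF assms(2,4)]
  by (auto intro!: span_base)

lemma subspace_tensor_space: "graded_cone A \<Longrightarrow> graded_cone B \<Longrightarrow> subspace (tensor_space A B)"
  unfolding tensor_space_def by (intro subspace_Times subspace_espace subspace_span)

lemma moment_scheme_tensor:
  assumes A: "graded_cone A" and B: "graded_cone B"
    and SA: "compact SA" "SA \<subseteq> slice A" "finite_measure_supported_on mA SA"
    and SB: "compact SB" "SB \<subseteq> slice B" "finite_measure_supported_on mB SB"
  shows "moment_scheme (mA \<Otimes>\<^sub>M mB) (SA \<times> SB) (tensor_space A B) (tensor_map A B)"
proof
  show "compact (SA \<times> SB)" using SA SB by (simp add: compact_Times)
  show "finite_measure_supported_on (mA \<Otimes>\<^sub>M mB) (SA \<times> SB)"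
    using SA SB by (intro finite_measure_supported_on_Times) (auto simp: compact_imp_closed)
  show "subspace (tensor_space A B)" by (rule subspace_tensor_space[OF A B])
  show "continuous_on UNIV (tensor_map A B)" by (rule continuous_tensor_map)
  show "tensor_map A B x \<in> tensor_space A B" if xS: "x \<in> SA \<times> SB" for x
  proof -
    obtain a b where x: "x = (a, b)" "a \<in> slice A" "b \<in> slice B"
      using xS SA(2) SB(2) by blast
    then show ?thesis using tensor_map_in_tensor_space[OF A B, of a b] by (simp add: slice_def)
  qed
qed

lemma zero_in_tensor_base:
  assumes "graded_cone A" "graded_cone B" shows "0 \<in> tensor_base A B"
proof -
  have "tensor_map A B (sect A 1, sect B 1) = 0"
    by (simp add: tensor_map_apply tensor_left_simps zero_prod_def)
  then show ?thesis
    unfolding tensor_base_def using assms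
    by (metis (no_types, lifting) SigmaI graded_cone_def hull_inc image_eqI)
qed

lemma affine_tensor_map_left:
  fixes A :: "(real^'d) mc_obj" and B :: "(real^'e) mc_obj"
  shows "affine_map (\<lambda>a. tensor_map A B (a, b))"
proof -
  have "(\<lambda>a. tensor_map A B (a, b)) = (\<lambda>a. (- sect A 1, b - sect B 1, - tensor (sect A 1) (b - sect B 1)) + (a, 0, tensor a (b - sect B 1)))"
    by (intro ext) (simp add: tensor_map_apply tensor_left_simps)
  then show ?thesis
  proof (simp only:)
    have "linear (\<lambda>a. (a, 0::real^'e, tensor a (b - sect B 1)))"
      by (rule linearI) (simp_all add: tensor_left_simps)
    then show "affine_map (\<lambda>a. (- sect A 1, b - sect B 1, - tensor (sect A 1) (b - sect B 1)) + (a, 0, tensor a (b - sect B 1)))"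
      by (rule affine_map_add_linear)
  qed
qed

lemma affine_tensor_map_right:
  fixes A :: "(real^'d) mc_obj" and B :: "(real^'e) mc_obj"
  shows "affine_map (\<lambda>b. tensor_map A B (a, b))"
proof -
  have "(\<lambda>b. tensor_map A B (a, b)) = (\<lambda>b. (a - sect A 1, - sect B 1, - tensor (a - sect A 1) (sect B 1)) + (0, b, tensor (a - sect A 1) b))"
    by (intro ext) (simp add: tensor_map_apply tensor_right_simps)
  then show ?thesis
  proof (simp only:)
    have "linear (\<lambda>b. (0::real^'d, b, tensor (a - sect A 1) b))"
      by (rule linearI) (simp_all add: tensor_right_simps)
    then show "affine_map (\<lambda>b. (a - sect A 1, - sect B 1, - tensor (a - sect A 1) (sect B 1)) + (0, b, tensor (a - sect A 1) b))"
      by (rule affine_map_add_linear)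
  qed
qed

text \<open>The slices are the convex hulls of their vertices, and \<open>tensor_map\<close> is affine in each of
  its two arguments.\<close>

lemma tensor_base_vertices:
  assumes A: "graded_cone A" and B: "graded_cone B"
  shows "tensor_base A B = convex hull (tensor_map A B ` (vertices (slice A) \<times> vertices (slice B)))"
    (is "_ = ?H")
proof
  show "?H \<subseteq> tensor_base A B"
    unfolding tensor_base_def by (intro hull_mono image_mono Sigma_mono vertices_subset)
  show "tensor_base A B \<subseteq> ?H"
    unfolding tensor_base_def
  proof (intro hull_minimal convex_convex_hull image_subsetI)
    fix x assume "x \<in> slice A \<times> slice B"
    then obtain a b where x: "x = (a, b)" and a: "a \<in> slice A" and b: "b \<in> slice B" by blast
    have a': "a \<in> convex hull (vertices (slice A))" and b': "b \<in> convex hull (vertices (slice B))"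
      using a b convex_hull_vertices_slice[OF A] convex_hull_vertices_slice[OF B] by auto
    have "tensor_map A B (a, w) \<in> ?H" if "w \<in> vertices (slice B)" for w
      using that by (intro affine_map_in_convex_hull[OF affine_tensor_map_left convex_convex_hull _ a']) (auto intro!: hull_inc)
    then show "tensor_map A B x \<in> ?H"
      unfolding x by (intro affine_map_in_convex_hull[OF affine_tensor_map_right convex_convex_hull _ b'])
  qed
qed

lemma tensor_embed_tensor_map: "tensor_embed A B (tensor_map A B (a, b)) = tensor a b"
  by (simp add: tensor_embed_def tensor_map_apply tensor_left_simps tensor_right_simps algebra_simps)

lemma affine_tensor_embed: "affine_map (tensor_embed A B)"
proof -
  have "linear (\<lambda>(x, y, z). tensor x (sect B 1) + tensor (sect A 1) y + z)"
    by (rule linearI) (auto simp: tensor_left_simps tensor_right_simps algebra_simps)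
  then have "affine_map (\<lambda>p. tensor (sect A 1) (sect B 1) + (\<lambda>(x, y, z). tensor x (sect B 1) + tensor (sect A 1) y + z) p)"
    by (rule affine_map_add_linear)
  moreover have "tensor_embed A B = (\<lambda>p. tensor (sect A 1) (sect B 1) + (\<lambda>(x, y, z). tensor x (sect B 1) + tensor (sect A 1) y + z) p)"
    by (auto simp: tensor_embed_def fun_eq_iff)
  ultimately show ?thesis by simp
qed

lemma continuous_tensor_embed: "continuous_on UNIV (tensor_embed A B)"
  unfolding tensor_embed_def case_prod_beta by (intro continuous_intros continuous_tensor)

lemma tensor_embed_base:
  assumes "tensor_base A B = convex hull (tensor_map A B ` (SA \<times> SB))"
  shows "tensor_embed A B ` tensor_base A B = convex hull {tensor a b | a b. a \<in> SA \<and> b \<in> SB}"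
proof -
  have "tensor_embed A B ` tensor_map A B ` (SA \<times> SB) = {tensor a b | a b. a \<in> SA \<and> b \<in> SB}"
    by (force simp: tensor_embed_tensor_map image_iff)
  then show ?thesis unfolding assms affine_map_image_convex_hull[OF affine_tensor_embed] by simp
qed

lemma tensor_cone_over_base:
  assumes A: "graded_cone A" and B: "graded_cone B"
  shows "tensor_cone_over A B (tensor_base A B) = tensor_cone A B"
  unfolding tensor_cone_over_def tensor_embed_base[OF tensor_base_def] tensor_cone_def
proof (rule cone_hull_convex_hull_generators)
  let ?G = "{tensor a b |a b. a \<in> slice A \<and> b \<in> slice B}"
  show "?G \<noteq> {}" using A B by (auto simp: graded_cone_def)
  show "x \<in> {tensor a b |a b. a \<in> cone_of A \<and> b \<in> cone_of B}" if "x \<in> ?G" for x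
    using that by (auto simp: slice_def)
  fix x assume "x \<in> {tensor a b |a b. a \<in> cone_of A \<and> b \<in> cone_of B}"
  then obtain a b where ab: "a \<in> cone_of A" "b \<in> cone_of B" "x = tensor a b" by blast
  obtain c p where cp: "0 \<le> c" "p \<in> slice A" "a = c *\<^sub>R p" by (rule cone_of_eq_scaled_slice[OF A ab(1)])
  obtain d q where dq: "0 \<le> d" "q \<in> slice B" "b = d *\<^sub>R q" by (rule cone_of_eq_scaled_slice[OF B ab(2)])
  have "x = (c * d) *\<^sub>R tensor p q"
    using ab cp dq by (simp add: tensor_left_simps tensor_right_simps)
  then show "\<exists>c\<ge>0. \<exists>y\<in>?G. x = c *\<^sub>R y" using cp dq by (intro exI[of _ "c * d"]) auto
qed

text \<open>The witnessing functional is the tensor product of the two gradings.\<close>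

lemma zero_notin_tensor_embed_base:
  assumes A: "graded_cone A" and B: "graded_cone B"
  shows "0 \<notin> tensor_embed A B ` tensor_base A B"
  unfolding tensor_embed_base[OF tensor_base_def]
proof (rule zero_notin_convex_hull)
  let ?L = "\<lambda>w. grad A (\<chi> i. grad B (w $ i))"
  note lA = linear_grad[OF A] and lB = linear_grad[OF B]
  have add: "(\<chi> i. f i + g i) = (\<chi> i. f i) + (\<chi> i. g i)" for f g :: "_ \<Rightarrow> real" by (simp add: vec_eq_iff)
  have scale: "(\<chi> i. c * f i) = c *\<^sub>R (\<chi> i. f i)" for c and f :: "_ \<Rightarrow> real" by (simp add: vec_eq_iff)
  show "linear ?L"
    by (rule linearI) (simp_all add: linear_add[OF lA] linear_add[OF lB] linear_scale[OF lA] linear_scale[OF lB] add scale)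
  fix x assume "x \<in> {tensor a b |a b. a \<in> slice A \<and> b \<in> slice B}"
  then obtain a b where ab: "a \<in> slice A" "b \<in> slice B" "x = tensor a b" by blast
  have "x $ i = a $ i *\<^sub>R b" for i by (simp add: ab tensor_def vec_eq_iff)
  then show "?L x = 1" using ab by (simp add: linear_scale[OF lB] slice_def)
qed

lemma tensor_accurate_scheme:
  assumes A: "graded_cone A" and B: "graded_cone B"
    and mA: "finite_measure_supported_on mA (slice A)" and mB: "finite_measure_supported_on mB (slice B)"
  shows "tensor_accurate A B (tensor_scheme A B (slice A) mA (slice B) mB)"
proof -
  interpret moment_scheme "mA \<Otimes>\<^sub>M mB" "slice A \<times> slice B" "tensor_space A B" "tensor_map A B"
    using A B mA mB by (intro moment_scheme_tensor compact_slice) auto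
  have base: "closure (\<Union>k. polar_in (tensor_space A B) (Q k)) = tensor_base A B"
    using closure_Union_polar_moment_set zero_in_tensor_base[OF A B] by (simp add: tensor_base_def)
  have "closure (\<Union>k. tensor_cone_over A B (polar_in (tensor_space A B) (Q k))) = tensor_cone_over A B (tensor_base A B)"
    unfolding tensor_cone_over_def
    using compact_convex_hull_T zero_notin_tensor_embed_base[OF A B]
    by (intro closure_Union_cone_hull continuous_tensor_embed base) (auto simp: tensor_base_def)
  then show ?thesis
    unfolding tensor_accurate_def tensor_scheme_def
    using SDR_polar_moment_set base tensor_cone_over_base[OF A B] by simp
qed

lemma moment_scheme_tensor_vertices:
  assumes A: "graded_cone A" "finite (vertices (slice A))" and B: "graded_cone B" "finite (vertices (slice B))"
  shows "moment_scheme (counting_measure_on (vertices (slice A)) \<Otimes>\<^sub>M counting_measure_on (vertices (slice B)))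
    (vertices (slice A) \<times> vertices (slice B)) (tensor_space A B) (tensor_map A B)"
  using A B by (intro moment_scheme_tensor vertices_subset finite_measure_supported_on_counting finite_imp_compact)

lemma tensor_finitely_convergent_scheme:
  assumes A: "graded_cone A" "finite (vertices (slice A))" and B: "graded_cone B" "finite (vertices (slice B))"
  defines "VA \<equiv> vertices (slice A)" and "VB \<equiv> vertices (slice B)"
  shows "tensor_finitely_convergent A B
    (tensor_scheme A B VA (counting_measure_on VA) VB (counting_measure_on VB))"
proof -
  interpret moment_scheme "counting_measure_on VA \<Otimes>\<^sub>M counting_measure_on VB" "VA \<times> VB" "tensor_space A B" "tensor_map A B"
    unfolding VA_def VB_def by (rule moment_scheme_tensor_vertices[OF A B])
  have base: "tensor_base A B = convex hull (tensor_map A B ` (VA \<times> VB))"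
    unfolding VA_def VB_def by (rule tensor_base_vertices[OF A(1) B(1)])
  obtain k where "Q k = polar_in (tensor_space A B) (tensor_map A B ` (VA \<times> VB))"
    using moment_set_finite A B by (auto simp: VA_def VB_def)
  then have "polar_in (tensor_space A B) (Q k) = tensor_base A B"
    using polar_polar_T zero_in_tensor_base[OF A(1) B(1)] base by simp
  then show ?thesis
    unfolding tensor_finitely_convergent_def tensor_scheme_def
    using SDR_polar_moment_set[of k] tensor_cone_over_base[OF A(1) B(1)] by (intro exI[of _ k]) simp
qed

lemma SDR_tensor_cone:
  assumes A: "graded_cone A" "finite (vertices (slice A))" and B: "graded_cone B" "finite (vertices (slice B))"
  shows "SDR_in UNIV (tensor_cone A B)"
proof -
  let ?G = "{tensor a b | a b. a \<in> vertices (slice A) \<and> b \<in> vertices (slice B)}"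
  have "?G = (\<lambda>(a, b). tensor a b) ` (vertices (slice A) \<times> vertices (slice B))" by auto
  then have fin: "finite ?G" using A B by simp
  have eq: "tensor_cone A B = cone hull (convex hull ?G)"
    using tensor_cone_over_base[OF A(1) B(1)] tensor_embed_base[OF tensor_base_vertices[OF A(1) B(1)]]
    by (simp add: tensor_cone_over_def)
  have "?G \<noteq> {}"
    using vertices_slice_nonempty[OF A(1)] vertices_slice_nonempty[OF B(1)] by blast
  then have "tensor_cone A B = convex_cone hull ?G"
    unfolding eq
  proof (intro cone_hull_convex_hull_generators)
    show "\<exists>c\<ge>0. \<exists>y\<in>?G. x = c *\<^sub>R y" if "x \<in> ?G" for x
      by (rule exI[of _ 1], intro conjI, simp, rule bexI[OF _ that], simp)
  qed
  then have "polyhedron (tensor_cone A B)" using polyhedron_convex_cone_hull[OF fin] by simp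
  then show ?thesis by (rule SDR_in_polyhedron) simp
qed

section \<open>Cones of homomorphisms\<close>

lemma inner_tensor_transpose: "transpose f \<bullet> tensor x y = y \<bullet> (f *v x)" for f :: "real^'d^'e"
proof -
  have "transpose f \<bullet> tensor x y = (\<Sum>i\<in>UNIV. \<Sum>j\<in>UNIV. f $ j $ i * (x $ i * y $ j))"
    by (simp add: inner_vec_def transpose_def tensor_def)
  also have "\<dots> = (\<Sum>j\<in>UNIV. \<Sum>i\<in>UNIV. f $ j $ i * (x $ i * y $ j))" by (rule sum.swap)
  also have "\<dots> = y \<bullet> (f *v x)"
    by (simp add: inner_vec_def matrix_vector_mult_def sum_distrib_left mult_ac)
  finally show ?thesis .
qed

lemma inner_tensor_matrix: "tensor y x \<bullet> f = y \<bullet> (f *v x)" for f :: "real^'d^'e"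
  by (simp add: inner_vec_def tensor_def matrix_vector_mult_def sum_distrib_left mult_ac)

lemma inner_transpose_vec: "(transpose f *v t) \<bullet> x = t \<bullet> (f *v x)" for f :: "real^'d^'e"
  by (metis dot_lmul_matrix inner_commute transpose_matrix_vector)

lemma Hom_cone_iff:
  assumes A: "graded_cone A" and B: "MC_object B"
  shows "f \<in> Hom_cone A B \<longleftrightarrow> (\<forall>a\<in>slice A. \<forall>\<beta>\<in>slice (mc_dual B). 0 \<le> \<beta> \<bullet> (f *v a))"
proof
  assume "f \<in> Hom_cone A B"
  then show "\<forall>a\<in>slice A. \<forall>\<beta>\<in>slice (mc_dual B). 0 \<le> \<beta> \<bullet> (f *v a)"
    by (auto simp: Hom_cone_def AC_hom_def slice_def cone_of_mc_dual dual_cone_def)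
next
  assume R: "\<forall>a\<in>slice A. \<forall>\<beta>\<in>slice (mc_dual B). 0 \<le> \<beta> \<bullet> (f *v a)"
  have "f *v a \<in> cone_of B" if a: "a \<in> cone_of A" for a
  proof (rule dual_cone_bidual)
    show "convex_cone (cone_of B)" "closed (cone_of B)"
      using MC_object_graded_cone[OF B] by (auto simp: graded_cone_def)
    fix \<phi> assume "\<phi> \<in> dual_cone (cone_of B)"
    then have "\<phi> \<in> cone_of (mc_dual B)" by (simp add: cone_of_mc_dual)
    then obtain d q where dq: "0 \<le> d" "q \<in> slice (mc_dual B)" "\<phi> = d *\<^sub>R q"
      by (rule cone_of_eq_scaled_slice[OF graded_cone_mc_dual[OF B]])
    obtain c p where cp: "0 \<le> c" "p \<in> slice A" "a = c *\<^sub>R p" by (rule cone_of_eq_scaled_slice[OF A a])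
    have "\<phi> \<bullet> (f *v a) = d * (c * (q \<bullet> (f *v p)))"
      using cp dq by (simp add: linear_scale[OF matrix_vector_mul_linear])
    also have "\<dots> \<ge> 0" using R cp(1,2) dq(1,2) by (intro mult_nonneg_nonneg) auto
    finally show "0 \<le> \<phi> \<bullet> (f *v a)" .
  qed
  then show "f \<in> Hom_cone A B" by (auto simp: Hom_cone_def AC_hom_def)
qed

lemma Hom_base_eq_polar:
  assumes "tensor_base A (mc_dual B) = convex hull X"
  shows "Hom_base A B = polar_in (Hom_space A B) X"
  unfolding Hom_base_def assms polar_in_convex_hull ..

text \<open>The bilinear form of \<open>f\<close> is the homogenisation of the affine function \<open>1 + u\<close> on the base of
  the tensor product.\<close>

definition hom_point :: "(real^'d) mc_obj \<Rightarrow> (real^'e) mc_obj \<Rightarrow> (real^'d) \<times> (real^'e) \<times> (real^'e^'d) \<Rightarrow> real^'d^'e \<Rightarrow> bool" where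
  "hom_point A B u f \<longleftrightarrow> (\<forall>a \<beta>. grad A a = 1 \<and> grad (mc_dual B) \<beta> = 1 \<longrightarrow>
     \<beta> \<bullet> (f *v a) = 1 + u \<bullet> tensor_map A (mc_dual B) (a, \<beta>))"

lemma Hom_cone_over_alt: "Hom_cone_over A B K = cone hull {f. \<exists>u\<in>K. hom_point A B u f}"
  by (simp add: Hom_cone_over_def hom_point_def)

text \<open>Expanding \<open>\<beta> \<bullet> f a\<close> around the two sections gives a functional with components
  \<open>f\<^sup>T t\<close>, \<open>f s\<close> and \<open>f\<^sup>T\<close>, which is then projected to the tensor space.\<close>

lemma hom_point_exists:
  fixes A :: "(real^'d) mc_obj" and B :: "(real^'e) mc_obj"
  assumes A: "graded_cone A" and B: "MC_object B" and f: "grad B (f *v sect A 1) = 1"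
  obtains u where "u \<in> Hom_space A B" "hom_point A B u f"
proof -
  let ?s = "sect A 1" and ?t = "sect (mc_dual B) 1"
  have dB: "graded_cone (mc_dual B)" by (rule graded_cone_mc_dual[OF B])
  let ?w = "(transpose f *v ?t, f *v ?s, transpose f)"
  obtain u where u: "u \<in> Hom_space A B" "\<And>v. v \<in> Hom_space A B \<Longrightarrow> u \<bullet> v = ?w \<bullet> v"
    using subspace_representative[OF subspace_tensor_space[OF A dB], of ?w] unfolding Hom_space_def by blast
  have "hom_point A B u f"
    unfolding hom_point_def
  proof (intro allI impI)
    fix a \<beta> assume ab: "grad A a = 1 \<and> grad (mc_dual B) \<beta> = 1"
    have "u \<bullet> tensor_map A (mc_dual B) (a, \<beta>) = ?w \<bullet> tensor_map A (mc_dual B) (a, \<beta>)"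
      using u(2) tensor_map_in_tensor_space[OF A dB] ab by (simp add: Hom_space_def)
    also have "\<dots> = ?t \<bullet> (f *v (a - ?s)) + (\<beta> - ?t) \<bullet> (f *v ?s) + (\<beta> - ?t) \<bullet> (f *v (a - ?s))"
      by (simp add: tensor_map_apply inner_transpose_vec inner_tensor_transpose inner_commute[of "f *v ?s"]
          del: transpose_matrix_vector)
    also have "\<dots> = \<beta> \<bullet> (f *v a) - ?t \<bullet> (f *v ?s)"
      by (simp add: matrix_vector_mult_diff_distrib inner_diff_left inner_diff_right)
    finally show "\<beta> \<bullet> (f *v a) = 1 + u \<bullet> tensor_map A (mc_dual B) (a, \<beta>)"
      using f sect_mc_dual[OF B] by simp
  qed
  with u(1) show ?thesis by (rule that)
qed

lemma hom_point_zero: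
  fixes A :: "(real^'d) mc_obj" and B :: "(real^'e) mc_obj"
  assumes A: "graded_cone A" and B: "MC_object B"
  obtains f where "hom_point A B 0 f"
proof -
  let ?f = "matrix (\<lambda>a. grad A a *\<^sub>R sect B 1)"
  have "linear (\<lambda>a. grad A a *\<^sub>R sect B 1)"
    using linear_grad[OF A] by (intro linearI) (simp_all add: linear_add linear_scale scaleR_left_distrib)
  then have "?f *v a = grad A a *\<^sub>R sect B 1" for a by (simp add: matrix_works)
  then have "hom_point A B 0 ?f" by (simp add: hom_point_def grad_mc_dual[OF B])
  then show ?thesis by (rule that)
qed

text \<open>If \<open>f\<close> has degree zero, it kills the interior point \<open>sect A 1\<close>; moving from there in a
  direction and in the opposite one, it maps into the cone both times, where the grading of \<open>B\<close>
  forces it to vanish.\<close>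

lemma Hom_cone_eq_0_of_degree_0:
  assumes A: "MC_object A" and B: "MC_object B" and f: "f \<in> Hom_cone A B" "grad B (f *v sect A 1) = 0"
  shows "f = 0"
proof -
  let ?s = "sect A 1"
  have s: "?s \<in> interior (cone_of A)" using A by (simp add: MC_object_def)
  have fB: "f *v a \<in> cone_of B" if "a \<in> cone_of A" for a
    using f(1) that by (auto simp: Hom_cone_def AC_hom_def)
  have gB: "is_grading (cone_of B) (grad B)" using B by (simp add: MC_object_def)
  have fs: "f *v ?s = 0"
    using fB[of ?s] s interior_subset f(2) gB unfolding is_grading_def by blast
  obtain e where e: "0 < e" "cball ?s e \<subseteq> cone_of A" using s by (meson mem_interior_cball)
  have "f *v x = 0" for x
  proof (cases "x = 0")
    case False
    let ?y = "(e / norm x) *\<^sub>R x"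
    have "dist ?s (?s + ?y) \<le> e" "dist ?s (?s - ?y) \<le> e" using e False by (simp_all add: dist_norm)
    then have "?s + ?y \<in> cone_of A" "?s - ?y \<in> cone_of A" using e(2) by (auto simp: subset_iff)
    then have pm: "f *v ?y \<in> cone_of B" "- (f *v ?y) \<in> cone_of B"
      using fB[of "?s + ?y"] fB[of "?s - ?y"] fs
      by (simp_all add: matrix_vector_right_distrib matrix_vector_mult_diff_distrib)
    have "linear (grad B)" using gB by (simp add: is_grading_def)
    then have "grad B (- (f *v ?y)) = - grad B (f *v ?y)" by (rule linear_neg)
    then have "grad B (f *v ?y) = 0" using pm gB unfolding is_grading_def by (metis antisym neg_0_le_iff_le)
    then have "f *v ?y = 0" using pm gB unfolding is_grading_def by blast
    then show ?thesis using e False by (simp add: linear_scale[OF matrix_vector_mul_linear])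
  qed simp
  then show ?thesis by (metis matrix_eq matrix_vector_mult_0)
qed

lemma Hom_cone_scale: "f \<in> Hom_cone A B \<Longrightarrow> 0 \<le> c \<Longrightarrow> convex_cone (cone_of B) \<Longrightarrow> c *\<^sub>R f \<in> Hom_cone A B"
  by (auto simp: Hom_cone_def AC_hom_def scaleR_matrix_vector_assoc[symmetric] convex_cone_scaleR)

text \<open>A map of positive degree is scaled to degree one, where it corresponds to a point of the
  base. The map of degree zero is the zero map, which lies in every nonempty cone hull.\<close>

lemma Hom_cone_subset_over:
  fixes A :: "(real^'d) mc_obj" and B :: "(real^'e) mc_obj"
  assumes A: "MC_object A" and B: "MC_object B" and K: "Hom_base A B \<subseteq> K"
  shows "Hom_cone A B \<subseteq> Hom_cone_over A B K"
proof
  note gA = MC_object_graded_cone[OF A] and gB = MC_object_graded_cone[OF B]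
  fix f assume f: "f \<in> Hom_cone A B"
  have sA: "sect A 1 \<in> cone_of A" using gA by (simp add: graded_cone_def slice_def)
  define d where "d = grad B (f *v sect A 1)"
  have "0 \<le> d"
    using f sA gB by (auto simp: d_def Hom_cone_def AC_hom_def graded_cone_def is_grading_def)
  show "f \<in> Hom_cone_over A B K"
  proof (cases "d = 0")
    case True
    then have "f = 0" using Hom_cone_eq_0_of_degree_0[OF A B f] by (simp add: d_def)
    moreover obtain f0 where f0: "hom_point A B 0 f0" by (rule hom_point_zero[OF gA B])
    moreover have "0 \<in> Hom_base A B"
      unfolding Hom_base_def Hom_space_def
      by (intro zero_in_polar_in subspace_tensor_space gA graded_cone_mc_dual[OF B])
    then have "f0 \<in> {f. \<exists>u\<in>K. hom_point A B u f}" using K f0 by blast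
    then have "0 *\<^sub>R f0 \<in> Hom_cone_over A B K"
      unfolding Hom_cone_over_alt by (rule mem_cone_hull) simp
    ultimately show ?thesis by simp
  next
    case False
    with \<open>0 \<le> d\<close> have d: "0 < d" by simp
    let ?g = "(1 / d) *\<^sub>R f"
    have gH: "?g \<in> Hom_cone A B" using f d gB by (intro Hom_cone_scale) (auto simp: graded_cone_def)
    have "grad B (?g *v sect A 1) = 1"
      using d linear_grad[OF gB] by (simp add: scaleR_matrix_vector_assoc[symmetric] linear_scale d_def[symmetric])
    then obtain u where u: "u \<in> Hom_space A B" "hom_point A B u ?g" by (rule hom_point_exists[OF gA B])
    have "u \<in> Hom_base A B"
    proof -
      have "-1 \<le> u \<bullet> tensor_map A (mc_dual B) (a, \<beta>)" if "a \<in> slice A" "\<beta> \<in> slice (mc_dual B)" for a \<beta>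
      proof -
        have "0 \<le> \<beta> \<bullet> (?g *v a)" using gH that by (simp only: Hom_cone_iff[OF gA B])
        then show ?thesis using u(2) that by (simp add: hom_point_def slice_def)
      qed
      then show ?thesis
        unfolding Hom_base_eq_polar[OF tensor_base_def] using u(1) by (auto simp: polar_in_def)
    qed
    then have "?g \<in> {f. \<exists>u\<in>K. hom_point A B u f}" using u(2) K by blast
    then have "d *\<^sub>R ?g \<in> Hom_cone_over A B K"
      unfolding Hom_cone_over_alt using d by (intro mem_cone_hull) auto
    then show ?thesis using d by simp
  qed
qed

lemma hom_point_in_Hom_cone:
  assumes A: "graded_cone A" and B: "MC_object B" and u: "u \<in> Hom_base A B" "hom_point A B u f"
  shows "f \<in> Hom_cone A B"
  unfolding Hom_cone_iff[OF A B]
proof (intro ballI)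
  fix a \<beta> assume ab: "a \<in> slice A" "\<beta> \<in> slice (mc_dual B)"
  then have "-1 \<le> u \<bullet> tensor_map A (mc_dual B) (a, \<beta>)"
    using u(1) unfolding Hom_base_eq_polar[OF tensor_base_def] by (auto simp: polar_in_def)
  then show "0 \<le> \<beta> \<bullet> (f *v a)" using u(2) ab by (simp add: hom_point_def slice_def)
qed

lemma Hom_cone_over_base:
  fixes A :: "(real^'d) mc_obj" and B :: "(real^'e) mc_obj"
  assumes A: "MC_object A" and B: "MC_object B"
  shows "Hom_cone_over A B (Hom_base A B) = Hom_cone A B"
proof
  note gA = MC_object_graded_cone[OF A] and gB = MC_object_graded_cone[OF B]
  show "Hom_cone A B \<subseteq> Hom_cone_over A B (Hom_base A B)"
    by (rule Hom_cone_subset_over[OF A B order_refl])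
  show "Hom_cone_over A B (Hom_base A B) \<subseteq> Hom_cone A B"
    unfolding Hom_cone_over_alt
  proof (rule hull_minimal)
    show "{f. \<exists>u\<in>Hom_base A B. hom_point A B u f} \<subseteq> Hom_cone A B"
      using hom_point_in_Hom_cone[OF gA B] by blast
    show "cone (Hom_cone A B)"
      unfolding cone_def using Hom_cone_scale[of _ A B] gB by (auto simp: graded_cone_def)
  qed
qed

lemma hom_point_degree:
  assumes A: "graded_cone A" and B: "MC_object B" and u: "hom_point A B u f"
  shows "sect (mc_dual B) 1 \<bullet> (f *v sect A 1) = 1"
proof -
  have "grad A (sect A 1) = 1" "grad (mc_dual B) (sect (mc_dual B) 1) = 1"
    using A graded_cone_mc_dual[OF B] by (auto simp: graded_cone_def slice_def)
  then have "sect (mc_dual B) 1 \<bullet> (f *v sect A 1) = 1 + u \<bullet> tensor_map A (mc_dual B) (sect A 1, sect (mc_dual B) 1)"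
    using u by (simp add: hom_point_def)
  then show ?thesis by (simp add: tensor_map_apply tensor_left_simps zero_prod_def[symmetric])
qed

text \<open>For the cones, the inclusion from right to left needs one point \<open>u\<close> that serves all the
  \<open>Q k\<close>. The degree of \<open>f\<close> determines the scaling factor, and \<open>f\<close> then determines the values
  \<open>u \<bullet> T\<close> on the slices, on which membership in \<open>Q k\<close> depends.\<close>

lemma Hom_accurate_scheme:
  fixes A :: "(real^'d) mc_obj" and B :: "(real^'e) mc_obj"
  assumes A: "MC_object A" and B: "MC_object B"
    and mA: "finite_measure_supported_on mA (slice A)"
    and mB: "finite_measure_supported_on mB' (slice (mc_dual B))"
  shows "Hom_accurate A B (Hom_scheme A B (slice A) mA (slice (mc_dual B)) mB')"
proof -
  note gA = MC_object_graded_cone[OF A] and gB = MC_object_graded_cone[OF B] and dB = graded_cone_mc_dual[OF B]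
  let ?T = "tensor_map A (mc_dual B)" and ?S = "slice A \<times> slice (mc_dual B)"
  interpret moment_scheme "mA \<Otimes>\<^sub>M mB'" ?S "Hom_space A B" ?T
    unfolding Hom_space_def using gA dB mA mB by (intro moment_scheme_tensor compact_slice) auto
  have base: "Hom_base A B = (\<Inter>k. Q k)"
    unfolding Inter_moment_set by (rule Hom_base_eq_polar[OF tensor_base_def])
  have "Hom_cone A B = (\<Inter>k. Hom_cone_over A B (Q k))"
  proof
    show "Hom_cone A B \<subseteq> (\<Inter>k. Hom_cone_over A B (Q k))"
      using base by (intro INT_greatest Hom_cone_subset_over[OF A B]) auto
    show "(\<Inter>k. Hom_cone_over A B (Q k)) \<subseteq> Hom_cone A B"
    proof
      fix f assume f: "f \<in> (\<Inter>k. Hom_cone_over A B (Q k))"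
      have "\<exists>c g u. 0 \<le> c \<and> f = c *\<^sub>R g \<and> u \<in> Q k \<and> hom_point A B u g" for k
      proof -
        have "f \<in> cone hull {f. \<exists>u\<in>Q k. hom_point A B u f}" using f by (simp add: Hom_cone_over_alt)
        then show ?thesis unfolding cone_hull_expl by blast
      qed
      then obtain c g u where cgu: "\<And>k. 0 \<le> c k" "\<And>k. f = c k *\<^sub>R g k" "\<And>k. u k \<in> Q k" "\<And>k. hom_point A B (u k) (g k)"
        by metis
      define d where "d = sect (mc_dual B) 1 \<bullet> (f *v sect A 1)"
      have c: "c k = d" for k
      proof -
        have "d = c k * (sect (mc_dual B) 1 \<bullet> (g k *v sect A 1))"
          unfolding d_def cgu(2)[of k] by (simp add: scaleR_matrix_vector_assoc[symmetric])
        then show ?thesis using hom_point_degree[OF gA B cgu(4)[of k]] by simp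
      qed
      show "f \<in> Hom_cone A B"
      proof (cases "d = 0")
        case True
        then have "f = 0" using cgu(2)[of 0] c[of 0] by simp
        then show ?thesis by (simp add: Hom_cone_iff[OF gA B])
      next
        case False
        have g: "g k = g 0" for k
          using cgu(2)[of k] cgu(2)[of 0] c False by simp
        have same: "u k \<bullet> ?T x = u 0 \<bullet> ?T x" if x: "x \<in> ?S" for k x
        proof -
          obtain a \<beta> where ab: "x = (a, \<beta>)" "grad A a = 1" "grad (mc_dual B) \<beta> = 1"
            using x by (auto simp: slice_def)
          then show ?thesis
            using cgu(4)[of k] cgu(4)[of 0] g[of k] by (simp add: hom_point_def)
        qed
        have "u 0 \<in> Q k" for k
        proof -
          have eq: "I (\<lambda>x. (1 + u k \<bullet> ?T x) * (a x)\<^sup>2) = I (\<lambda>x. (1 + u 0 \<bullet> ?T x) * (a x)\<^sup>2)" for a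
          proof (rule I_cong)
            fix x assume "x \<in> ?S"
            then show "(1 + u k \<bullet> ?T x) * (a x)\<^sup>2 = (1 + u 0 \<bullet> ?T x) * (a x)\<^sup>2"
              by (simp only: same[of x k])
          qed
          have "0 \<le> I (\<lambda>x. (1 + u 0 \<bullet> ?T x) * (a x)\<^sup>2)" if a: "a \<in> polynomials_upto k" for a
          proof -
            have "0 \<le> I (\<lambda>x. (1 + u k \<bullet> ?T x) * (a x)\<^sup>2)"
              using cgu(3)[of k] a unfolding moment_set_def by blast
            then show ?thesis by (simp only: eq)
          qed
          moreover have "u 0 \<in> Hom_space A B" using cgu(3)[of 0] unfolding moment_set_def by blast
          ultimately show ?thesis unfolding moment_set_def by blast
        qed
        then have "u 0 \<in> Hom_base A B" using base by blast
        then have "g 0 \<in> Hom_cone A B" using hom_point_in_Hom_cone[OF gA B] cgu(4) by blast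
        then show ?thesis
          using Hom_cone_scale[of "g 0" A B "c 0"] cgu(1,2)[of 0] gB by (simp add: graded_cone_def)
      qed
    qed
  qed
  then show ?thesis
    unfolding Hom_accurate_def Hom_scheme_def tensor_scheme_def
    using spectrahedron_moment_set base by (simp add: Hom_space_def)
qed

lemma Hom_finitely_convergent_scheme:
  fixes A :: "(real^'d) mc_obj" and B :: "(real^'e) mc_obj"
  assumes A: "MC_object A" "finite (vertices (slice A))"
    and B: "MC_object B" "finite (vertices (slice (mc_dual B)))"
  defines "VA \<equiv> vertices (slice A)" and "VB \<equiv> vertices (slice (mc_dual B))"
  shows "Hom_finitely_convergent A B
    (Hom_scheme A B VA (counting_measure_on VA) VB (counting_measure_on VB))"
proof -
  note gA = MC_object_graded_cone[OF A(1)] and dB = graded_cone_mc_dual[OF B(1)]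
  interpret moment_scheme "counting_measure_on VA \<Otimes>\<^sub>M counting_measure_on VB" "VA \<times> VB" "Hom_space A B" "tensor_map A (mc_dual B)"
    unfolding VA_def VB_def Hom_space_def by (rule moment_scheme_tensor_vertices[OF gA A(2) dB B(2)])
  have "Hom_base A B = polar_in (Hom_space A B) (tensor_map A (mc_dual B) ` (VA \<times> VB))"
    unfolding VA_def VB_def by (rule Hom_base_eq_polar[OF tensor_base_vertices[OF gA dB]])
  moreover obtain k where "Q k = polar_in (Hom_space A B) (tensor_map A (mc_dual B) ` (VA \<times> VB))"
    using moment_set_finite A B by (auto simp: VA_def VB_def)
  ultimately have "Q k = Hom_base A B" by simp
  then show ?thesis
    unfolding Hom_finitely_convergent_def Hom_scheme_def tensor_scheme_def
    using spectrahedron_moment_set[of k] Hom_cone_over_base[OF A(1) B(1)]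
    by (intro exI[of _ k]) (simp add: Hom_space_def)
qed

lemma SDR_Hom_cone:
  fixes A :: "(real^'d) mc_obj" and B :: "(real^'e) mc_obj"
  assumes A: "MC_object A" "finite (vertices (slice A))"
    and B: "MC_object B" "finite (vertices (slice (mc_dual B)))"
  shows "SDR_in UNIV (Hom_cone A B)"
proof -
  note gA = MC_object_graded_cone[OF A(1)] and dB = graded_cone_mc_dual[OF B(1)]
  let ?P = "\<Inter>(a, \<beta>) \<in> vertices (slice A) \<times> vertices (slice (mc_dual B)). {f. tensor \<beta> a \<bullet> f \<ge> 0}"
  have half: "convex {x. 0 \<le> x \<bullet> y}" for y :: "real^'k"
    using convex_halfspace_ge[of 0 y] by (simp add: inner_commute)
  have "Hom_cone A B = ?P"
  proof
    show "Hom_cone A B \<subseteq> ?P"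
    proof (clarsimp simp: inner_tensor_matrix Hom_cone_iff[OF gA B(1)])
      fix f a \<beta>
      assume "\<forall>a\<in>slice A. \<forall>\<beta>\<in>slice (mc_dual B). 0 \<le> \<beta> \<bullet> (f *v a)"
        "a \<in> vertices (slice A)" "\<beta> \<in> vertices (slice (mc_dual B))"
      then show "0 \<le> \<beta> \<bullet> (f *v a)"
        using vertices_subset[of "slice A"] vertices_subset[of "slice (mc_dual B)"] by blast
    qed
    show "?P \<subseteq> Hom_cone A B"
    proof
      fix f assume f: "f \<in> ?P"
      have lin: "affine_map ((*v) f)"
        using affine_map_add_linear[OF matrix_vector_mul_linear, of 0 f] by simp
      have "0 \<le> \<beta> \<bullet> (f *v a)" if a: "a \<in> slice A" and b: "\<beta> \<in> slice (mc_dual B)" for a \<beta>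
      proof -
        have "0 \<le> \<beta> \<bullet> (f *v a)" if \<beta>: "\<beta> \<in> vertices (slice (mc_dual B))" for \<beta>
        proof -
          have "f *v a \<in> {x. \<beta> \<bullet> x \<ge> 0}"
          proof (rule affine_map_in_convex_hull[OF lin convex_halfspace_ge])
            show "a \<in> convex hull (vertices (slice A))"
              using a convex_hull_vertices_slice[OF gA] by simp
            show "f *v x \<in> {x. \<beta> \<bullet> x \<ge> 0}" if "x \<in> vertices (slice A)" for x
            proof -
              have "f \<in> {f. tensor \<beta> x \<bullet> f \<ge> 0}" using f that \<beta> by blast
              then show ?thesis by (simp add: inner_tensor_matrix)
            qed
          qed
          then show ?thesis by simp
        qed
        then have "convex hull (vertices (slice (mc_dual B))) \<subseteq> {\<beta>. 0 \<le> \<beta> \<bullet> (f *v a)}"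
          by (intro hull_minimal half) auto
        then show ?thesis using b convex_hull_vertices_slice[OF dB] by auto
      qed
      then show "f \<in> Hom_cone A B" by (simp add: Hom_cone_iff[OF gA B(1)])
    qed
  qed
  moreover have "polyhedron ?P"
    using A B by (intro polyhedron_Inter) (auto simp: polyhedron_halfspace_ge)
  ultimately show ?thesis by (intro SDR_in_polyhedron) auto
qed

section \<open>Products of linear forms in the symmetric algebra\<close>

lemma prod_single:
  "(\<Prod>i\<in>J. Poly_Mapping.single (k i) (c i)) = Poly_Mapping.single (\<Sum>i\<in>J. k i) (\<Prod>i\<in>J. c i :: real)"
  if "finite J" for k :: "'i \<Rightarrow> 'd \<Rightarrow>\<^sub>0 nat"
  using that by (induction J rule: finite_induct) (simp_all add: mult_single)

text \<open>The monomial of the word that \<open>f\<close> spells on \<open>J\<close>: a word up to reordering of its letters.\<close>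

definition word_monom :: "'i set \<Rightarrow> ('i \<Rightarrow> 'd) \<Rightarrow> 'd \<Rightarrow>\<^sub>0 nat" where
  "word_monom J f = (\<Sum>i\<in>J. Poly_Mapping.single (f i) 1)"

text \<open>Choosing one variable from each factor expands the product into monomials. Degrees,
  continuity in \<open>x\<close> and the grading of the symmetric power are all read off from this formula.\<close>

lemma prod_lin:
  fixes x :: "'i \<Rightarrow> real^'d"
  assumes "finite J"
  shows "(\<Prod>i\<in>J. lin (x i)) =
    (\<Sum>f\<in>J \<rightarrow>\<^sub>E UNIV. Poly_Mapping.single (word_monom J f) (\<Prod>i\<in>J. x i $ f i))"
  unfolding lin_def word_monom_def prod_single[OF assms, symmetric]
  by (rule prod_sum_PiE[OF assms]) simp

lemma lookup_prod_lin:
  fixes x :: "'i \<Rightarrow> real^'d"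
  assumes "finite J"
  shows "Poly_Mapping.lookup (\<Prod>i\<in>J. lin (x i)) m =
    (\<Sum>f\<in>J \<rightarrow>\<^sub>E UNIV. if word_monom J f = m then \<Prod>i\<in>J. x i $ f i else 0)"
  unfolding prod_lin[OF assms] lookup_sum by (simp add: lookup_single when_def)

lemma mdeg_word_monom: "finite J \<Longrightarrow> mdeg (word_monom J f) = card J"
proof -
  assume J: "finite J"
  have "mdeg (word_monom J f) = (\<Sum>d\<in>UNIV. \<Sum>i\<in>J. if f i = d then 1 else 0)"
    unfolding mdeg_def word_monom_def by (simp add: lookup_sum lookup_single when_def del: One_nat_def)
  also have "\<dots> = (\<Sum>i\<in>J. \<Sum>d\<in>UNIV. if f i = d then 1 else 0)" by (rule sum.swap)
  also have "\<dots> = card J" by simp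
  finally show ?thesis .
qed

definition homogeneous :: "nat \<Rightarrow> 'd::finite sym_alg \<Rightarrow> bool" where
  "homogeneous j p \<longleftrightarrow> (\<forall>m. Poly_Mapping.lookup p m \<noteq> 0 \<longrightarrow> mdeg m = j)"

lemma homogeneous_prod_lin:
  assumes "finite J" shows "homogeneous (card J) (\<Prod>i\<in>J. lin (x i))"
  unfolding homogeneous_def
proof (intro allI impI, rule ccontr)
  fix m assume nz: "Poly_Mapping.lookup (\<Prod>i\<in>J. lin (x i)) m \<noteq> 0" and "mdeg m \<noteq> card J"
  then have "word_monom J f \<noteq> m" for f using mdeg_word_monom[OF assms, of f] by auto
  then show False using nz by (simp add: lookup_prod_lin[OF assms])
qed

lemma homogeneous_elem_sym: "homogeneous j (elem_sym j y)"
  unfolding homogeneous_def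
proof (intro allI impI, rule ccontr)
  fix m assume nz: "Poly_Mapping.lookup (elem_sym j y) m \<noteq> 0" and deg: "mdeg m \<noteq> j"
  have "Poly_Mapping.lookup (\<Prod>i\<in>J. lin (y $ i)) m = 0" if "card J = j" for J
    using homogeneous_prod_lin[of J "\<lambda>i. y $ i"] that deg by (auto simp: homogeneous_def)
  then show False using nz by (simp add: elem_sym_def lookup_sum)
qed

text \<open>The case \<open>c = 1\<close> describes \<open>Sym_map\<close>, and the case where \<open>c\<close> is the linear form of the
  section describes \<open>Sym_embed\<close>.\<close>

lemma prod_const_add_lin:
  fixes y :: "(real^'d)^'n"
  shows "(\<Prod>i\<in>UNIV. c + lin (y $ i)) = (\<Sum>j=0..CARD('n). c ^ (CARD('n) - j) * elem_sym j y)"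
proof -
  have subsets: "(\<Prod>i\<in>A. c + lin (y $ i)) = (\<Sum>J\<in>Pow A. c ^ (card A - card J) * (\<Prod>i\<in>J. lin (y $ i)))"
    if "finite A" for A
    using that
  proof (induction A rule: finite_induct)
    case (insert a A)
    have inj: "inj_on (insert a) (Pow A)" 
      using insert.hyps(2) unfolding inj_on_def by (metis Pow_iff insert_ident subsetD)
    have "(\<Sum>J\<in>Pow (insert a A). c ^ (card (insert a A) - card J) * (\<Prod>i\<in>J. lin (y $ i))) =
        (\<Sum>J\<in>Pow A. c ^ (card (insert a A) - card J) * (\<Prod>i\<in>J. lin (y $ i))) +
        (\<Sum>J\<in>Pow A. c ^ (card (insert a A) - card (insert a J)) * (\<Prod>i\<in>insert a J. lin (y $ i)))"
      unfolding Pow_insert using insert.hyps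
      by (subst sum.union_disjoint) (auto simp: sum.reindex[OF inj])
    also have "(\<Sum>J\<in>Pow A. c ^ (card (insert a A) - card J) * (\<Prod>i\<in>J. lin (y $ i))) =
        c * (\<Sum>J\<in>Pow A. c ^ (card A - card J) * (\<Prod>i\<in>J. lin (y $ i)))"
      unfolding sum_distrib_left
    proof (intro sum.cong refl)
      fix J assume "J \<in> Pow A"
      then have "card J \<le> card A" using insert.hyps by (auto intro: card_mono)
      then show "c ^ (card (insert a A) - card J) * (\<Prod>i\<in>J. lin (y $ i)) =
          c * (c ^ (card A - card J) * (\<Prod>i\<in>J. lin (y $ i)))"
        using insert.hyps by (simp add: Suc_diff_le mult.assoc)
    qed
    also have "(\<Sum>J\<in>Pow A. c ^ (card (insert a A) - card (insert a J)) * (\<Prod>i\<in>insert a J. lin (y $ i))) =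
        lin (y $ a) * (\<Sum>J\<in>Pow A. c ^ (card A - card J) * (\<Prod>i\<in>J. lin (y $ i)))"
      unfolding sum_distrib_left
    proof (intro sum.cong refl)
      fix J assume J: "J \<in> Pow A"
      then have "finite J" "a \<notin> J" using insert.hyps by (auto intro: finite_subset)
      then show "c ^ (card (insert a A) - card (insert a J)) * (\<Prod>i\<in>insert a J. lin (y $ i)) =
          lin (y $ a) * (c ^ (card A - card J) * (\<Prod>i\<in>J. lin (y $ i)))"
        using insert.hyps by (simp add: mult_ac)
    qed
    finally show ?case using insert by (simp add: distrib_right)
  qed simp
  have "(\<Sum>J\<in>UNIV. c ^ (CARD('n) - card J) * (\<Prod>i\<in>J. lin (y $ i))) =
      (\<Sum>j\<in>{0..CARD('n)}. \<Sum>J\<in>{J\<in>UNIV. card J = j}. c ^ (CARD('n) - card J) * (\<Prod>i\<in>J. lin (y $ i)))"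
    by (rule sum.group[symmetric]) (auto intro: card_mono[OF finite subset_UNIV])
  also have "\<dots> = (\<Sum>j=0..CARD('n). c ^ (CARD('n) - j) * elem_sym j y)"
    unfolding elem_sym_def sum_distrib_left by (intro sum.cong refl) auto
  finally show ?thesis using subsets[of UNIV] by simp
qed

lemma elem_sym_0: "elem_sym 0 y = 1"
proof -
  have "{J::'b set. card J = 0} = {{}}" by auto
  then show ?thesis by (simp add: elem_sym_def)
qed

lemma lin_add: "lin (a + b) = lin a + lin b"
  by (simp add: lin_def single_add sum.distrib)

lemma lin_scale: "lin (c *\<^sub>R a) = Poly_Mapping.single 0 c * lin a"
  by (simp add: lin_def sum_distrib_left mult_single)

lemma lin_diff: "lin (a - b) = lin a - lin b"
  by (simp add: lin_def single_diff sum_subtractf)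

lemma lookup_const_mult:
  "Poly_Mapping.lookup (Poly_Mapping.single 0 c * p) m = c * Poly_Mapping.lookup p m"
  for p :: "'d sym_alg"
proof -
  have "Poly_Mapping.single 0 c * p = Poly_Mapping.map ((*) c) p"
    by (rule mult_map_scale_conv_mult[symmetric])
  then show ?thesis by (simp add: Poly_Mapping.map.rep_eq when_def)
qed

lemma to_vec_add: "to_vec (p + q) = to_vec p + to_vec q"
  by (simp add: to_vec_def lookup_add vec_eq_iff)

lemma to_vec_sum: "to_vec (\<Sum>i\<in>A. p i) = (\<Sum>i\<in>A. to_vec (p i))"
  by (simp add: to_vec_def lookup_sum vec_eq_iff)

lemma to_vec_scale: "to_vec (Poly_Mapping.single 0 c * p) = c *\<^sub>R to_vec p"
  by (simp add: to_vec_def lookup_const_mult vec_eq_iff)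

lemma of_vec_add: "of_vec (z + w) = of_vec z + of_vec w"
  by (simp add: of_vec_def single_add sum.distrib)

lemma of_vec_scale: "of_vec (c *\<^sub>R z) = Poly_Mapping.single 0 c * of_vec z"
  by (simp add: of_vec_def sum_distrib_left mult_single)

lemma lookup_of_vec:
  fixes z :: "real^('d::finite, 'n::finite) monom_upto"
  shows "Poly_Mapping.lookup (of_vec z) k = (if mdeg k \<le> CARD('n) then z $ monom_of k else 0)"
proof -
  have "Poly_Mapping.lookup (of_vec z) k = (\<Sum>m\<in>UNIV. if exponent_of m = k then z $ m else 0)"
    by (simp add: of_vec_def lookup_sum lookup_single when_def)
  also have "\<dots> = (if mdeg k \<le> CARD('n) then z $ monom_of k else 0)"
  proof (cases "mdeg k \<le> CARD('n)")
    case True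
    then have k: "exponent_of (monom_of k :: ('d, 'n) monom_upto) = k"
      by (simp add: monom_of_inverse)
    have "exponent_of m = k \<longleftrightarrow> m = monom_of k" for m :: "('d, 'n) monom_upto"
      using k by (metis exponent_of_inverse)
    then show ?thesis using True by simp
  next
    case False
    have "exponent_of m \<noteq> k" for m :: "('d, 'n) monom_upto"
      using exponent_of[of m] False by auto
    then show ?thesis using False by simp
  qed
  finally show ?thesis .
qed

text \<open>Coefficient vectors see the monomials of degree at most \<open>CARD('n)\<close> only.\<close>

lemma of_vec_to_vec:
  assumes "homogeneous j p" "j \<le> CARD('n)"
  shows "of_vec (to_vec p :: real^('d::finite, 'n::finite) monom_upto) = p"
proof (rule poly_mapping_eqI)
  fix k
  show "Poly_Mapping.lookup (of_vec (to_vec p :: real^('d, 'n) monom_upto)) k = Poly_Mapping.lookup p k"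
    using assms by (auto simp: lookup_of_vec to_vec_def monom_of_inverse homogeneous_def)
qed

lemma hom_part_add: "hom_part j (z + w) = hom_part j z + hom_part j w"
  by (simp add: hom_part_def vec_eq_iff)

lemma hom_part_scale: "hom_part j (c *\<^sub>R z) = c *\<^sub>R hom_part j z"
  by (simp add: hom_part_def vec_eq_iff)

lemma linear_hom_part: "linear (hom_part j)"
  by (rule linearI) (simp_all add: hom_part_add hom_part_scale)

lemma hom_part_to_vec:
  assumes "homogeneous i p"
  shows "hom_part j (to_vec p) = (if i = j then to_vec p else 0)"
  using assms by (auto simp: hom_part_def to_vec_def homogeneous_def vec_eq_iff)


section \<open>Symmetric powers\<close>

text \<open>In this form \<open>Sym_map\<close> is visibly affine in each coordinate of \<open>p\<close>.\<close>

lemma Sym_map_eq_prod: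
  "Sym_map A (p :: (real^'d)^'n) = to_vec ((\<Prod>i\<in>UNIV. 1 + lin (p $ i - sect A 1)) - 1)"
proof -
  let ?y = "\<chi> i. p $ i - sect A 1"
  have "(\<Prod>i\<in>UNIV. 1 + lin (p $ i - sect A 1)) = (\<Sum>j=0..CARD('n). elem_sym j ?y)"
    using prod_const_add_lin[of 1 ?y] by simp
  also have "\<dots> = 1 + (\<Sum>j=1..CARD('n). elem_sym j ?y)"
    by (subst sum.atLeast_Suc_atMost) (simp_all add: elem_sym_0)
  finally show ?thesis by (simp add: Sym_map_def to_vec_sum)
qed

lemma Sym_embed_Sym_map:
  "Sym_embed A (Sym_map A (p :: (real^'d)^'n)) = to_vec (\<Prod>i\<in>UNIV. lin (p $ i))"
proof -
  let ?y = "\<chi> i. p $ i - sect A 1"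
  have part: "of_vec (hom_part j (Sym_map A p)) = elem_sym j ?y" if "j \<in> {1..CARD('n)}" for j
  proof -
    have "hom_part j (Sym_map A p) = (\<Sum>k=1..CARD('n). hom_part j (to_vec (elem_sym k ?y)))"
      unfolding Sym_map_def by (rule linear_sum[OF linear_hom_part])
    also have "\<dots> = (\<Sum>k=1..CARD('n). if k = j then to_vec (elem_sym k ?y) else 0)"
      by (simp add: hom_part_to_vec[OF homogeneous_elem_sym])
    also have "\<dots> = to_vec (elem_sym j ?y)" using that by simp
    finally show ?thesis using that by (simp add: of_vec_to_vec[OF homogeneous_elem_sym])
  qed
  have "(\<Prod>i\<in>UNIV. lin (p $ i)) = (\<Prod>i\<in>UNIV. lin (sect A 1) + lin (?y $ i))"
    by (simp add: lin_add[symmetric])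
  also have "\<dots> = (\<Sum>j=0..CARD('n). lin (sect A 1) ^ (CARD('n) - j) * elem_sym j ?y)"
    by (rule prod_const_add_lin)
  also have "\<dots> = lin (sect A 1) ^ CARD('n) + (\<Sum>j=1..CARD('n). lin (sect A 1) ^ (CARD('n) - j) * elem_sym j ?y)"
    by (subst sum.atLeast_Suc_atMost) (simp_all add: elem_sym_0)
  also have "\<dots> = lin (sect A 1) ^ CARD('n) +
      (\<Sum>j=1..CARD('n). lin (sect A 1) ^ (CARD('n) - j) * of_vec (hom_part j (Sym_map A p)))"
    using part by simp
  finally show ?thesis by (simp add: Sym_embed_def)
qed

lemma linear_Sym_embed_part:
  "linear (\<lambda>z :: real^('d, 'n) monom_upto. to_vec (\<Sum>j=1..CARD('n). lin (s :: real^'d) ^ (CARD('n) - j) * of_vec (hom_part j z))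
     :: real^('d::finite, 'n::finite) monom_upto)"
proof (rule linearI)
  show "to_vec (\<Sum>j=1..CARD('n). lin s ^ (CARD('n) - j) * of_vec (hom_part j (z + w))) =
    to_vec (\<Sum>j=1..CARD('n). lin s ^ (CARD('n) - j) * of_vec (hom_part j z)) +
    to_vec (\<Sum>j=1..CARD('n). lin s ^ (CARD('n) - j) * of_vec (hom_part j w))"
    for z w :: "real^('d, 'n) monom_upto"
    by (simp add: hom_part_add of_vec_add distrib_left sum.distrib to_vec_add)
  show "to_vec (\<Sum>j=1..CARD('n). lin s ^ (CARD('n) - j) * of_vec (hom_part j (c *\<^sub>R z))) =
    c *\<^sub>R to_vec (\<Sum>j=1..CARD('n). lin s ^ (CARD('n) - j) * of_vec (hom_part j z))"
    for c and z :: "real^('d, 'n) monom_upto"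
  proof -
    have "(\<Sum>j=1..CARD('n). lin s ^ (CARD('n) - j) * of_vec (hom_part j (c *\<^sub>R z))) =
      Poly_Mapping.single 0 c * (\<Sum>j=1..CARD('n). lin s ^ (CARD('n) - j) * of_vec (hom_part j z))"
      by (simp add: hom_part_scale of_vec_scale sum_distrib_left mult_ac)
    then show ?thesis by (simp add: to_vec_scale)
  qed
qed

lemma affine_Sym_embed: "affine_map (Sym_embed A)"
  unfolding Sym_embed_def[abs_def] to_vec_add
  by (rule affine_map_add_linear[OF linear_Sym_embed_part])

lemma continuous_Sym_embed: "continuous_on UNIV (Sym_embed A)"
  unfolding Sym_embed_def[abs_def] to_vec_add
  using linear_Sym_embed_part[of "sect A 1"]
  by (intro continuous_intros linear_continuous_on) (simp add: linear_conv_bounded_linear)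

lemma continuous_Sym_map: "continuous_on UNIV (Sym_map A :: (real^'d)^'n \<Rightarrow> real^('d, 'n::finite) monom_upto)"
proof -
  have "Sym_map A p = (\<chi> m. \<Sum>j=1..CARD('n). \<Sum>J | card J = j. \<Sum>f\<in>J \<rightarrow>\<^sub>E UNIV.
      if word_monom J f = exponent_of m then \<Prod>i\<in>J. (p $ i - sect A 1) $ f i else 0)"
    for p :: "(real^'d)^'n"
    by (simp add: Sym_map_def to_vec_def elem_sym_def lookup_sum lookup_prod_lin vec_eq_iff)
  then have "Sym_map A = (\<lambda>p :: (real^'d)^'n. \<chi> m. \<Sum>j=1..CARD('n). \<Sum>J | card J = j. \<Sum>f\<in>J \<rightarrow>\<^sub>E UNIV.
      if word_monom J f = exponent_of m then \<Prod>i\<in>J. (p $ i - sect A 1) $ f i else 0)"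
    by (intro ext)
  moreover have "continuous_on UNIV (\<lambda>p :: (real^'d)^'n. if b then \<Prod>i\<in>J. (p $ i - sect A 1) $ f i else 0)" for b J f
    by (cases b) (auto intro!: continuous_intros)
  then have "continuous_on UNIV (\<lambda>p :: (real^'d)^'n. (\<chi> m. \<Sum>j=1..CARD('n). \<Sum>J | card J = j. \<Sum>f\<in>J \<rightarrow>\<^sub>E UNIV.
      if word_monom J f = exponent_of m then \<Prod>i\<in>J. (p $ i - sect A 1) $ f i else 0) :: real^('d, 'n) monom_upto)"
    by (intro continuous_on_vec_lambda continuous_on_sum)
  ultimately show ?thesis by simp
qed

lemma Sym_map_in_Sym_space:
  fixes A :: "(real^'d) mc_obj" and p :: "(real^'d)^'n"
  assumes A: "graded_cone A" and p: "\<And>i. grad A (p $ i) = 1"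
  shows "Sym_map A p \<in> Sym_space A"
proof -
  let ?y = "\<chi> i. p $ i - sect A 1"
  have "to_vec (\<Prod>i\<in>J. lin (?y $ i)) \<in> (Sym_space A :: (real^('d, 'n) monom_upto) set)"
    if J: "card J \<in> {1..CARD('n)}" for J :: "'n set"
  proof -
    obtain h where h: "bij_betw h {0..<card J} J"
      using ex_bij_betw_nat_finite[of J] by auto
    then have h': "bij_betw h {..<card J} J" by (simp add: lessThan_atLeast0)
    have "(\<Prod>i\<in>J. lin (?y $ i)) = (\<Prod>i<card J. lin (?y $ h i))"
      by (rule prod.reindex_bij_betw[OF h', symmetric])
    moreover have "\<forall>i<card J. ?y $ h i \<in> espace A"
      using slice_diff_espace[OF A p] by simp
    ultimately show ?thesis
      unfolding Sym_space_def using J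
      by (intro span_base CollectI exI[of _ "card J"] exI[of _ "\<lambda>i. ?y $ h i"]) simp
  qed
  moreover have sub: "subspace (Sym_space A :: (real^('d, 'n) monom_upto) set)"
    unfolding Sym_space_def by (rule subspace_span)
  ultimately show ?thesis
    unfolding Sym_map_def elem_sym_def to_vec_sum
    by (intro subspace_sum sub) auto
qed

abbreviation lin_products :: "(real^'d) set \<Rightarrow> (real^('d::finite, 'n::finite) monom_upto) set" where
  "lin_products V \<equiv> {to_vec (\<Prod>i\<in>UNIV. lin (a i)) | a::'n \<Rightarrow> real^'d. \<forall>i. a i \<in> V}"

lemma Sym_embed_image:
  fixes A :: "(real^'d) mc_obj"
  shows "Sym_embed A ` Sym_map A ` (power_set V :: ((real^'d)^'n) set) =
    lin_products V"
proof
  show "Sym_embed A ` Sym_map A ` (power_set V :: ((real^'d)^'n) set) \<subseteq> lin_products V"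
  proof clarify
    fix p :: "(real^'d)^'n" assume "p \<in> power_set V"
    then show "\<exists>a :: 'n \<Rightarrow> real^'d. Sym_embed A (Sym_map A p) = to_vec (\<Prod>i\<in>UNIV. lin (a i)) \<and> (\<forall>i. a i \<in> V)"
      by (intro exI[of _ "\<lambda>i. p $ i"]) (simp add: Sym_embed_Sym_map power_set_def)
  qed
  show "lin_products V \<subseteq> Sym_embed A ` Sym_map A ` (power_set V :: ((real^'d)^'n) set)"
  proof clarify
    fix a :: "'n \<Rightarrow> real^'d" assume "\<forall>i. a i \<in> V"
    then have "(\<chi> i. a i) \<in> power_set V" by (simp add: power_set_def)
    moreover have "to_vec (\<Prod>i\<in>UNIV. lin (a i)) = Sym_embed A (Sym_map A (\<chi> i. a i))"
      by (simp add: Sym_embed_Sym_map)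
    ultimately show "to_vec (\<Prod>i\<in>UNIV. lin (a i)) \<in> Sym_embed A ` Sym_map A ` (power_set V :: ((real^'d)^'n) set)"
      by blast
  qed
qed

lemma affine_Sym_map_coordinate:
  fixes A :: "(real^'d) mc_obj" and p :: "(real^'d)^'n"
  shows "affine_map (\<lambda>a. Sym_map A (\<chi> i. if i = k then a else p $ i) :: real^('d, 'n) monom_upto)"
proof -
  let ?R = "\<Prod>i\<in>UNIV - {k}. 1 + lin (p $ i - sect A 1)"
  have "Sym_map A (\<chi> i. if i = k then a else p $ i) =
     to_vec ((1 - lin (sect A 1)) * ?R - 1) + to_vec (lin a * ?R)" for a
  proof -
    have "(\<Prod>i\<in>UNIV. 1 + lin ((\<chi> i. if i = k then a else p $ i) $ i - sect A 1)) =
       (1 + lin (a - sect A 1)) * ?R"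
      by (subst prod.remove[of _ k]) auto
    then show ?thesis
      unfolding Sym_map_eq_prod to_vec_add[symmetric] by (simp only:) (simp add: lin_diff algebra_simps)
  qed
  moreover have "linear (\<lambda>a. to_vec (lin a * ?R) :: real^('d, 'n) monom_upto)"
    by (rule linearI) (simp_all add: lin_add lin_scale distrib_right to_vec_add mult.assoc to_vec_scale)
  ultimately show ?thesis using affine_map_add_linear by simp
qed

text \<open>The coordinates of \<open>p\<close> are replaced by points of \<open>V\<close> one at a time, which is possible
  because \<open>Sym_map\<close> is affine in each of them.\<close>

lemma Sym_map_in_convex_hull:
  fixes A :: "(real^'d) mc_obj" and p :: "(real^'d)^'n"
  assumes p: "\<And>i. p $ i \<in> convex hull V"
  shows "Sym_map A p \<in> convex hull (Sym_map A ` power_set V)" (is "_ \<in> ?H")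
proof -
  have "Sym_map A p \<in> ?H" if "\<And>i. i \<in> I \<Longrightarrow> p $ i \<in> convex hull V" "\<And>i. i \<notin> I \<Longrightarrow> p $ i \<in> V" "finite I"
    for I :: "'n set" and p :: "(real^'d)^'n"
    using that(3,1,2)
  proof (induction I arbitrary: p rule: finite_induct)
    case empty
    then show ?case by (intro hull_inc imageI) (simp add: power_set_def)
  next
    case (insert k I)
    have vert: "Sym_map A (\<chi> i. if i = k then a else p $ i) \<in> ?H" if "a \<in> V" for a
      using that insert.prems insert.hyps by (intro insert.IH) auto
    have "Sym_map A (\<chi> i. if i = k then p $ k else p $ i) \<in> ?H"
    proof (rule affine_map_in_convex_hull[where f = "\<lambda>a. Sym_map A (\<chi> i. if i = k then a else p $ i)" and x = "p $ k" and X = V])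
      show "p $ k \<in> convex hull V" by (rule insert.prems(1)) simp
    qed (use vert in \<open>simp_all add: affine_Sym_map_coordinate\<close>)
    moreover have "(\<chi> i. if i = k then p $ k else p $ i) = p" by (simp add: vec_eq_iff)
    ultimately show ?case by simp
  qed
  from this[of UNIV] p show ?thesis by simp
qed

lemma Sym_base_vertices:
  fixes A :: "(real^'d) mc_obj"
  assumes A: "graded_cone A"
  shows "(Sym_base A :: (real^('d, 'n::finite) monom_upto) set) = convex hull (Sym_map A ` power_set (vertices (slice A)))"
    (is "_ = ?H")
proof
  have "power_set (vertices (slice A)) \<subseteq> (power_set (slice A) :: ((real^'d)^'n) set)"
    using vertices_subset[of "slice A"] by (auto simp: power_set_def)
  then show "?H \<subseteq> Sym_base A"
    unfolding Sym_base_def by (intro hull_mono image_mono)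
  show "Sym_base A \<subseteq> ?H"
    unfolding Sym_base_def
  proof (intro hull_minimal convex_convex_hull image_subsetI)
    fix p :: "(real^'d)^'n" assume "p \<in> power_set (slice A)"
    then show "Sym_map A p \<in> ?H"
      using convex_hull_vertices_slice[OF A] by (intro Sym_map_in_convex_hull) (simp add: power_set_def)
  qed
qed

lemma zero_in_Sym_base:
  assumes A: "graded_cone A" shows "0 \<in> (Sym_base A :: (real^('d::finite, 'n::finite) monom_upto) set)"
proof -
  let ?p = "(\<chi> i. sect A 1) :: (real^'d)^'n"
  have "lin (0 :: real^'d) = 0" using lin_diff[of 0 0] by simp
  then have "Sym_map A ?p = to_vec 0" by (simp add: Sym_map_eq_prod)
  also have "\<dots> = 0" by (simp add: to_vec_def vec_eq_iff)
  finally have "Sym_map A ?p = 0" .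
  moreover have "?p \<in> power_set (slice A)" using A by (simp add: power_set_def graded_cone_def)
  ultimately show ?thesis unfolding Sym_base_def by (metis hull_inc imageI)
qed

lemma Sym_embed_base:
  assumes "(Sym_base A :: (real^('d::finite, 'n::finite) monom_upto) set) = convex hull (Sym_map A ` power_set V)"
  shows "Sym_embed A ` (Sym_base A :: (real^('d, 'n) monom_upto) set) =
    convex hull lin_products V"
  unfolding assms affine_map_image_convex_hull[OF affine_Sym_embed] Sym_embed_image ..

lemma to_vec_prod_lin_scale:
  fixes c :: "'n::finite \<Rightarrow> real"
  shows "to_vec (\<Prod>i\<in>UNIV. lin (c i *\<^sub>R a i)) = (\<Prod>i\<in>UNIV. c i) *\<^sub>R to_vec (\<Prod>i\<in>UNIV. lin (a i))"
proof -
  have "(\<Prod>i\<in>UNIV. lin (c i *\<^sub>R a i)) = Poly_Mapping.single 0 (\<Prod>i\<in>UNIV. c i) * (\<Prod>i\<in>UNIV. lin (a i))"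
    by (simp add: lin_scale prod.distrib prod_single)
  then show ?thesis by (simp add: to_vec_scale)
qed

lemma Sym_cone_over_base:
  assumes A: "graded_cone A"
  shows "Sym_cone_over A (Sym_base A) = (Sym_cone A :: (real^('d::finite, 'n::finite) monom_upto) set)"
  unfolding Sym_cone_over_def Sym_embed_base[OF Sym_base_def] Sym_cone_def
proof (rule cone_hull_convex_hull_generators)
  let ?G = "lin_products (slice A) :: (real^('d, 'n) monom_upto) set"
  show "?G \<noteq> {}" using A by (auto simp: graded_cone_def)
  show "x \<in> lin_products (cone_of A)" if "x \<in> ?G" for x
    using that slice_subset_cone[of A] by blast
  fix x :: "real^('d, 'n) monom_upto"
  assume "x \<in> lin_products (cone_of A)"
  then obtain a :: "'n \<Rightarrow> real^'d" where a: "\<forall>i. a i \<in> cone_of A" "x = to_vec (\<Prod>i\<in>UNIV. lin (a i))" by blast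
  have "\<exists>c p. 0 \<le> c \<and> p \<in> slice A \<and> a i = c *\<^sub>R p" for i
  proof -
    obtain c p where "0 \<le> c" "p \<in> slice A" "a i = c *\<^sub>R p"
      using cone_of_eq_scaled_slice[OF A a(1)[rule_format, of i]] by blast
    then show ?thesis by blast
  qed
  then obtain c p where cp: "\<And>i. 0 \<le> c i" "\<And>i. p i \<in> slice A" "\<And>i. a i = c i *\<^sub>R p i" by metis
  have "x = (\<Prod>i\<in>UNIV. c i) *\<^sub>R to_vec (\<Prod>i\<in>UNIV. lin (p i))"
    unfolding a(2) cp(3) by (rule to_vec_prod_lin_scale)
  moreover have "0 \<le> (\<Prod>i\<in>UNIV. c i)" using cp(1) by (intro prod_nonneg) auto
  moreover have "to_vec (\<Prod>i\<in>UNIV. lin (p i)) \<in> ?G" using cp(2) by blast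
  ultimately show "\<exists>c\<ge>0. \<exists>y\<in>?G. x = c *\<^sub>R y" by blast
qed

text \<open>The witnessing functional evaluates a polynomial at the coordinates \<open>g\<close> of the grading; being
  multiplicative, it sends a product of points of the slice to one.\<close>

lemma zero_notin_Sym_embed_base:
  assumes A: "graded_cone A"
  shows "0 \<notin> Sym_embed A ` (Sym_base A :: (real^('d::finite, 'n::finite) monom_upto) set)"
  unfolding Sym_embed_base[OF Sym_base_def]
proof (rule zero_notin_convex_hull)
  define g where "g d = grad A (axis d 1)" for d
  define w where "w k = (\<Prod>d\<in>UNIV. g d ^ Poly_Mapping.lookup k d)" for k
  let ?L = "\<lambda>z :: real^('d, 'n) monom_upto. \<Sum>m\<in>UNIV. z $ m * w (exponent_of m)"
  show "linear ?L"
    by (rule linearI) (simp_all add: distrib_right sum.distrib sum_distrib_left mult.assoc)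
  fix x :: "real^('d, 'n) monom_upto"
  assume "x \<in> lin_products (slice A)"
  then obtain a :: "'n \<Rightarrow> real^'d" where a: "\<forall>i. a i \<in> slice A" "x = to_vec (\<Prod>i\<in>UNIV. lin (a i))" by blast
  have grad: "(\<Sum>d\<in>UNIV. v $ d * g d) = grad A v" for v
  proof -
    have "v = (\<Sum>d\<in>UNIV. v $ d *\<^sub>R axis d 1)" by (simp add: basis_expansion flip: scalar_mult_eq_scaleR)
    then have "grad A v = grad A (\<Sum>d\<in>UNIV. v $ d *\<^sub>R axis d 1)" by simp
    then show ?thesis using linear_grad[OF A] by (simp add: linear_sum linear_scale g_def)
  qed
  have word: "w (word_monom UNIV f) = (\<Prod>i\<in>UNIV. g (f i))" for f :: "'n \<Rightarrow> 'd"
  proof -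
    have "w (word_monom UNIV f) = (\<Prod>d\<in>UNIV. \<Prod>i\<in>UNIV. g d ^ (if f i = d then 1 else 0))"
      by (simp add: w_def word_monom_def lookup_sum power_sum lookup_single when_def del: One_nat_def)
    also have "\<dots> = (\<Prod>i\<in>UNIV. \<Prod>d\<in>UNIV. g d ^ (if f i = d then 1 else 0))" by (rule prod.swap)
    also have "\<dots> = (\<Prod>i\<in>UNIV. g (f i))"
      by (intro prod.cong refl) (simp add: if_distrib[of "\<lambda>k. _ ^ k"] cong: if_cong)
    finally show ?thesis .
  qed
  have hit: "(\<Sum>m\<in>(UNIV :: ('d, 'n) monom_upto set). (if word_monom UNIV f = exponent_of m then c else 0) * w (exponent_of m)) = c * w (word_monom UNIV f)"
    for f :: "'n \<Rightarrow> 'd" and c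
  proof -
    have "mdeg (word_monom UNIV f) \<le> CARD('n)" by (simp add: mdeg_word_monom)
    then have k: "exponent_of (monom_of (word_monom UNIV f) :: ('d, 'n) monom_upto) = word_monom UNIV f"
      by (simp add: monom_of_inverse)
    have "(\<Sum>m\<in>(UNIV :: ('d, 'n) monom_upto set). (if word_monom UNIV f = exponent_of m then c else 0) * w (exponent_of m)) =
       (\<Sum>m\<in>(UNIV :: ('d, 'n) monom_upto set). if m = (monom_of (word_monom UNIV f) :: ('d, 'n) monom_upto) then c * w (word_monom UNIV f) else 0)"
      by (intro sum.cong refl) (use k in \<open>metis exponent_of_inverse mult_zero_left\<close>)
    then show ?thesis by simp
  qed
  have "?L x = (\<Sum>m\<in>(UNIV :: ('d, 'n) monom_upto set). (\<Sum>f\<in>UNIV \<rightarrow>\<^sub>E UNIV. if word_monom UNIV f = exponent_of m then \<Prod>i\<in>UNIV. a i $ f i else 0) * w (exponent_of m))"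
    by (simp add: a(2) to_vec_def lookup_prod_lin)
  also have "\<dots> = (\<Sum>f\<in>UNIV \<rightarrow>\<^sub>E UNIV. (\<Prod>i\<in>UNIV. a i $ f i) * w (word_monom UNIV f))"
    unfolding sum_distrib_right by (subst sum.swap) (simp only: hit)
  also have "\<dots> = (\<Sum>f\<in>UNIV \<rightarrow>\<^sub>E UNIV. \<Prod>i\<in>UNIV. a i $ f i * g (f i))"
    by (simp add: word prod.distrib)
  also have "\<dots> = (\<Prod>i\<in>UNIV. \<Sum>d\<in>UNIV. a i $ d * g d)"
    by (rule prod_sum_PiE[symmetric]) auto
  also have "\<dots> = 1" using a(1) by (simp add: grad slice_def)
  finally show "?L x = 1" .
qed

lemma moment_scheme_Sym:
  fixes A :: "(real^'d) mc_obj"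
  assumes A: "graded_cone A" and SA: "compact SA" "SA \<subseteq> slice A" "finite_measure_supported_on mA SA"
  shows "moment_scheme (power_measure mA) (power_set SA :: ((real^'d)^'n) set)
    (Sym_space A :: (real^('d, 'n::finite) monom_upto) set) (Sym_map A)"
proof
  show "compact (power_set SA :: ((real^'d)^'n) set)" by (rule compact_power_set[OF SA(1)])
  show "finite_measure_supported_on (power_measure mA) (power_set SA :: ((real^'d)^'n) set)"
    by (rule finite_measure_supported_on_power[OF SA(3) compact_imp_closed[OF SA(1)]])
  show "subspace (Sym_space A :: (real^('d, 'n) monom_upto) set)"
    unfolding Sym_space_def by (rule subspace_span)
  show "continuous_on UNIV (Sym_map A :: _ \<Rightarrow> real^('d, 'n) monom_upto)" by (rule continuous_Sym_map)
  show "Sym_map A p \<in> Sym_space A" if "p \<in> power_set SA" for p :: "(real^'d)^'n"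
  proof (rule Sym_map_in_Sym_space[OF A])
    fix i
    have "p $ i \<in> slice A" using that SA(2) unfolding power_set_def by blast
    then show "grad A (p $ i) = 1" by (simp add: slice_def)
  qed
qed

lemma Sym_accurate_scheme:
  fixes A :: "(real^'d) mc_obj"
  assumes A: "graded_cone A" and mA: "finite_measure_supported_on mA (slice A)"
  shows "Sym_accurate A (Sym_scheme A (slice A) mA :: nat \<Rightarrow> (real^('d, 'n::finite) monom_upto) set)"
proof -
  interpret moment_scheme "power_measure mA" "power_set (slice A) :: ((real^'d)^'n) set"
    "Sym_space A :: (real^('d, 'n) monom_upto) set" "Sym_map A"
    using A mA by (intro moment_scheme_Sym compact_slice) auto
  have base: "closure (\<Union>k. polar_in (Sym_space A) (Q k)) = Sym_base A"
    using closure_Union_polar_moment_set zero_in_Sym_base[OF A] by (simp add: Sym_base_def)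
  have "closure (\<Union>k. Sym_cone_over A (polar_in (Sym_space A) (Q k))) = Sym_cone_over A (Sym_base A)"
    unfolding Sym_cone_over_def
    using compact_convex_hull_T zero_notin_Sym_embed_base[OF A]
    by (intro closure_Union_cone_hull continuous_Sym_embed base) (auto simp: Sym_base_def)
  then show ?thesis
    unfolding Sym_accurate_def Sym_scheme_def
    using SDR_polar_moment_set base Sym_cone_over_base[OF A, where 'n='n] by simp
qed

lemma finite_power_set:
  assumes "finite V" shows "finite (power_set V :: ('v^'n::finite) set)"
proof -
  have "(power_set V :: ('v^'n) set) \<subseteq> vec_lambda ` (UNIV \<rightarrow>\<^sub>E V)"
  proof
    fix p :: "'v^'n" assume "p \<in> power_set V"
    then have "(\<lambda>i. p $ i) \<in> UNIV \<rightarrow>\<^sub>E V" by (simp add: power_set_def PiE_UNIV_domain)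
    moreover have "p = vec_lambda (\<lambda>i. p $ i)" by simp
    ultimately show "p \<in> vec_lambda ` (UNIV \<rightarrow>\<^sub>E V)" by (metis image_eqI)
  qed
  from finite_subset[OF this] show ?thesis using assms by (simp add: finite_PiE)
qed

lemma Sym_finitely_convergent_scheme:
  fixes A :: "(real^'d) mc_obj"
  assumes A: "graded_cone A" "finite (vertices (slice A))"
  defines "VA \<equiv> vertices (slice A)"
  shows "Sym_finitely_convergent A
    (Sym_scheme A VA (counting_measure_on VA) :: nat \<Rightarrow> (real^('d, 'n::finite) monom_upto) set)"
proof -
  interpret moment_scheme "power_measure (counting_measure_on VA)" "power_set VA :: ((real^'d)^'n) set"
    "Sym_space A :: (real^('d, 'n) monom_upto) set" "Sym_map A"
    unfolding VA_def
    by (intro moment_scheme_Sym A vertices_subset finite_measure_supported_on_counting finite_imp_compact)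
  have base: "(Sym_base A :: (real^('d, 'n) monom_upto) set) = convex hull (Sym_map A ` power_set VA)"
    unfolding VA_def by (rule Sym_base_vertices[OF A(1)])
  obtain k where "Q k = polar_in (Sym_space A) (Sym_map A ` power_set VA)"
    using moment_set_finite finite_power_set A(2) by (auto simp: VA_def)
  then have "polar_in (Sym_space A) (Q k) = Sym_base A"
    using polar_polar_T zero_in_Sym_base[OF A(1), where 'n='n] base by simp
  then show ?thesis
    unfolding Sym_finitely_convergent_def Sym_scheme_def
    using SDR_polar_moment_set[of k] Sym_cone_over_base[OF A(1), where 'n='n] by (intro exI[of _ k]) simp
qed

lemma SDR_Sym_cone:
  fixes A :: "(real^'d) mc_obj"
  assumes A: "graded_cone A" "finite (vertices (slice A))"
  shows "SDR_in Sym_top (Sym_cone A :: (real^('d, 'n::finite) monom_upto) set)"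
proof -
  define G where "G = (lin_products (vertices (slice A)) :: (real^('d, 'n) monom_upto) set)"
  have "G = Sym_embed A ` Sym_map A ` power_set (vertices (slice A))"
    unfolding G_def by (rule Sym_embed_image[symmetric])
  then have fin: "finite G" using A(2) by (simp add: finite_power_set)
  have eq: "Sym_cone A = cone hull (convex hull G)"
    using Sym_cone_over_base[OF A(1), where 'n='n] Sym_embed_base[OF Sym_base_vertices[OF A(1)], where 'n='n]
    by (simp add: Sym_cone_over_def G_def)
  obtain v where "v \<in> vertices (slice A)" using vertices_slice_nonempty[OF A(1)] by blast
  then have "to_vec (\<Prod>i\<in>(UNIV::'n set). lin v) \<in> G" unfolding G_def by (intro CollectI exI[of _ "\<lambda>_. v"]) simp
  then have ne: "G \<noteq> {}" by blast
  have "Sym_cone A = convex_cone hull G"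
    unfolding eq
  proof (intro cone_hull_convex_hull_generators ne)
    show "\<exists>c\<ge>0. \<exists>y\<in>G. x = c *\<^sub>R y" if "x \<in> G" for x
      by (rule exI[of _ 1], intro conjI, simp, rule bexI[OF _ that], simp)
  qed
  then have "polyhedron (Sym_cone A :: (real^('d, 'n) monom_upto) set)" using polyhedron_convex_cone_hull[OF fin] by simp
  moreover have "Sym_cone A \<subseteq> (Sym_top :: (real^('d, 'n) monom_upto) set)"
    unfolding Sym_cone_def
  proof (rule hull_minimal)
    show "lin_products (cone_of A) \<subseteq> (Sym_top :: (real^('d, 'n) monom_upto) set)"
      by (auto simp: Sym_top_def hom_part_to_vec[OF homogeneous_prod_lin])
    have "hom_part CARD('n) (0 :: real^('d, 'n) monom_upto) = 0" by (simp add: hom_part_def vec_eq_iff)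
    then show "convex_cone (Sym_top :: (real^('d, 'n) monom_upto) set)"
      by (auto simp: convex_cone_iff Sym_top_def hom_part_add hom_part_scale)
  qed
  ultimately show ?thesis by (rule SDR_in_polyhedron)
qed

theorem theorem4p4:
  fixes A :: "(real^'d) mc_obj" and B :: "(real^'e) mc_obj"
  assumes "MC_object A" and "MC_object B"
  shows "(\<forall>mA mB mB'.
            finite_measure_supported_on mA (slice A) \<and>
            finite_measure_supported_on mB (slice B) \<and>
            finite_measure_supported_on mB' (slice (mc_dual B)) \<longrightarrow>
              tensor_accurate A B (tensor_scheme A B (slice A) mA (slice B) mB) \<and>
              Sym_accurate A
                (Sym_scheme A (slice A) mA :: nat \<Rightarrow> (real^('d, 'n::finite) monom_upto) set) \<and>
              Hom_accurate A B (Hom_scheme A B (slice A) mA (slice (mc_dual B)) mB'))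
       \<and> (\<forall>VA VB VB' mA mB mB'.
            polyhedron (cone_of A) \<and> polyhedron (cone_of B) \<and>
            VA = vertices (slice A) \<and> mA = counting_measure_on VA \<and>
            VB = vertices (slice B) \<and> mB = counting_measure_on VB \<and>
            VB' = vertices (slice (mc_dual B)) \<and> mB' = counting_measure_on VB' \<longrightarrow>
              tensor_finitely_convergent A B (tensor_scheme A B VA mA VB mB) \<and>
              SDR_in UNIV (tensor_cone A B) \<and>
              Sym_finitely_convergent A
                (Sym_scheme A VA mA :: nat \<Rightarrow> (real^('d, 'n) monom_upto) set) \<and>
              SDR_in Sym_top (Sym_cone A :: (real^('d, 'n) monom_upto) set) \<and>
              Hom_finitely_convergent A B (Hom_scheme A B VA mA VB' mB') \<and>
              SDR_in UNIV (Hom_cone A B))"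
proof (intro conjI allI impI; elim conjE)
  note gA = MC_object_graded_cone[OF assms(1)] and gB = MC_object_graded_cone[OF assms(2)]
  fix mA :: "(real^'d) measure" and mB mB' :: "(real^'e) measure"
  assume m: "finite_measure_supported_on mA (slice A)" "finite_measure_supported_on mB (slice B)"
    "finite_measure_supported_on mB' (slice (mc_dual B))"
  show "tensor_accurate A B (tensor_scheme A B (slice A) mA (slice B) mB)"
    by (rule tensor_accurate_scheme[OF gA gB m(1,2)])
  show "Sym_accurate A (Sym_scheme A (slice A) mA :: nat \<Rightarrow> (real^('d, 'n) monom_upto) set)"
    by (rule Sym_accurate_scheme[OF gA m(1)])
  show "Hom_accurate A B (Hom_scheme A B (slice A) mA (slice (mc_dual B)) mB')"
    by (rule Hom_accurate_scheme[OF assms m(1,3)])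
next
  note gA = MC_object_graded_cone[OF assms(1)] and gB = MC_object_graded_cone[OF assms(2)]
    and dB = graded_cone_mc_dual[OF assms(2)]
  fix VA VB VB' mA mB mB'
  assume poly: "polyhedron (cone_of A)" "polyhedron (cone_of B)"
    and V: "VA = vertices (slice A)" "mA = counting_measure_on VA"
      "VB = vertices (slice B)" "mB = counting_measure_on VB"
      "VB' = vertices (slice (mc_dual B))" "mB' = counting_measure_on VB'"
  have fA: "finite (vertices (slice A))" and fB: "finite (vertices (slice B))"
    using finite_vertices_slice gA gB poly by blast+
  have "polyhedron (cone_of (mc_dual B))"
    unfolding cone_of_mc_dual by (rule polyhedron_dual_cone[OF cone_hull_vertices[OF gB] fB])
  then have fB': "finite (vertices (slice (mc_dual B)))"
    by (rule finite_vertices_slice[OF dB])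
  show "tensor_finitely_convergent A B (tensor_scheme A B VA mA VB mB)"
    unfolding V by (rule tensor_finitely_convergent_scheme[OF gA fA gB fB])
  show "SDR_in UNIV (tensor_cone A B)"
    by (rule SDR_tensor_cone[OF gA fA gB fB])
  show "Sym_finitely_convergent A (Sym_scheme A VA mA :: nat \<Rightarrow> (real^('d, 'n) monom_upto) set)"
    unfolding V by (rule Sym_finitely_convergent_scheme[OF gA fA])
  show "SDR_in Sym_top (Sym_cone A :: (real^('d, 'n) monom_upto) set)"
    by (rule SDR_Sym_cone[OF gA fA])
  show "Hom_finitely_convergent A B (Hom_scheme A B VA mA VB' mB')"
    unfolding V by (rule Hom_finitely_convergent_scheme[OF assms(1) fA assms(2) fB'])
  show "SDR_in UNIV (Hom_cone A B)"
    by (rule SDR_Hom_cone[OF assms(1) fA assms(2) fB'])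
qed

end
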